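(* Let $(\boldsymbol\sigma,u)\in H(\operatorname{div};\Omega)\times H^1(\Omega)$ be the solution of $\boldsymbol\sigma+\nabla u=0$ in $\Omega$, $\operatorname{div}\boldsymbol\sigma=f$ in $\Omega$, $u=g$ on $\Gamma$, and let $(\boldsymbol\sigma_h,u_h)\in\boldsymbol\Sigma_h\times V_h$ be the solution of $$a_s(\boldsymbol\sigma_h,\boldsymbol\tau)-b(\boldsymbol\tau,u_h)=-G(\boldsymbol\tau)\quad\forall\,\boldsymbol\tau\in\boldsymbol\Sigma_h,\qquad -b(\boldsymbol\sigma_h,v)=-F(v)\quad\forall\,v\in V_h .$$ Then for every $T\in\mathcal T_h$ $$\|\operatorname{div}(\boldsymbol\sigma-\boldsymbol\sigma_h)\|_{0,T}=\inf_{v\in V_h}\|v-\operatorname{div}\boldsymbol\sigma\|_{0,T}=\inf_{v\in V_h}\|v-f\|_{0,T}.$$ In particular, if $\operatorname{div}\boldsymbol\sigma=f\in H^s(\Omega)$ for some $0<s\le1$, then $$\|\operatorname{div}(\boldsymbol\sigma-\boldsymbol\sigma_h)\|_{0,T}\le C\,h_T^s\,\|f\|_{s,T}$$ with a constant $C>0$ independent of the mesh and of the data. In fact, if $s=1$ then $C=1/\pi$.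
   Context: $\Omega\subset\mathbb R^2$ is a bounded, simply connected domain with polygonal boundary $\Gamma$; $f\in L^2(\Omega)$, $g\in H^{1/2}(\Gamma)$. $\{\mathcal T_h\}_{h>0}$ is a family of conforming triangulations of $\bar\Omega$ into straight-sided triangles $T$ with diameter $h_T$ and unit outward normal $\boldsymbol\nu_T$. $\mathcal E_I$ is the set of interior edges, $|e|$ the length of an edge $e$. For $e=\partial T\cap\partial T'\in\mathcal E_I$, a piecewise smooth vector field $\boldsymbol\tau$ has normal jump $[\![\boldsymbol\tau]\!]=\boldsymbol\tau|_T\cdot\boldsymbol\nu_T+\boldsymbol\tau|_{T'}\cdot\boldsymbol\nu_{T'}$, and a piecewise smooth scalar $q$ has jump $[\![q]\!]=q|_T\boldsymbol\nu_T+q|_{T'}\boldsymbol\nu_{T'}$. Spaces: $H(\operatorname{div};\Omega)=\{\boldsymbol\tau\in[L^2(\Omega)]^2:\operatorname{div}\boldsymbol\tau\in L^2(\Omega)\}$; $V_h$ is the space of functions that are constant on each $T\in\mathcal T_h$; $\mathrm{CR}_h$ is the space of $v\in L^2(\Omega)$ with $v|_T$ affine for each $T\in\mathcal T_h$ and $\int_e[\![v]\!]=0$ for all $e\in\mathcal E_I$; $\boldsymbol\Sigma_h=[\mathrm{CR}_h]^2$. Forms, with $\operatorname{div}_h$ the elementwise divergence, $\gamma|_e=1/|e|$, and $\boldsymbol\nu$ the outward unit normal on $\Gamma$: $a_s(\boldsymbol\sigma,\boldsymbol\tau)=\int_\Omega\boldsymbol\sigma\cdot\boldsymbol\tau+\sum_{e\in\mathcal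 E_I}\int_e\gamma[\![\boldsymbol\sigma]\!][\![\boldsymbol\tau]\!]$, $\ b(\boldsymbol\tau,v)=\int_\Omega v\,\operatorname{div}_h\boldsymbol\tau$, $\ G(\boldsymbol\tau)=\int_\Gamma g\,(\boldsymbol\tau\cdot\boldsymbol\nu)$, $\ F(v)=\int_\Omega fv$. $\|\cdot\|_{0,T}$ is the $L^2(T)$ norm and $\|\cdot\|_{s,T}$ the $H^s(T)$ norm. *)

theory Defs
  imports "HOL-Analysis.Analysis"
begin

type_synonym point = "real^2"

section \<open>Polygonal domains and triangulations\<close>

text \<open>The boundary is a simple closed polygon: a closed Jordan curve that is a finite union of
  segments. This excludes slits, for which boundary data on both sides would differ.\<close>

definition polygonal_domain :: "point set \<Rightarrow> bool" where
  "polygonal_domain \<Omega> \<longleftrightarrow>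
     \<Omega> \<noteq> {} \<and> open \<Omega> \<and> connected \<Omega> \<and> bounded \<Omega> \<and> simply_connected \<Omega> \<and>
     (\<exists>p. simple_path p \<and> pathfinish p = pathstart p \<and> path_image p = frontier \<Omega>) \<and>
     (\<exists>S. finite S \<and> (\<forall>s\<in>S. \<exists>a b. s = closed_segment a b) \<and> frontier \<Omega> = \<Union>S)"

text \<open>The library constant \<^const>\<open>triangulation\<close> already contains finiteness and conformity (any two cells
  meet in a common face, possibly empty).\<close>

definition conforming_mesh :: "point set \<Rightarrow> point set set \<Rightarrow> bool" where
  "conforming_mesh \<Omega> \<T> \<longleftrightarrow>
     triangulation \<T> \<and> (\<forall>T\<in>\<T>. 2 simplex T) \<and> \<Union>\<T> = closure \<Omega>"

definition interior_edges :: "point set set \<Rightarrow> point set set" where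
  "interior_edges \<T> =
     {e. \<exists>T\<in>\<T>. \<exists>T'\<in>\<T>. T \<noteq> T' \<and> e = frontier T \<inter> frontier T' \<and> e edge_of T \<and> e edge_of T'}"

text \<open>The unit outward normal of the triangle \<open>T\<close> on its edge \<open>e\<close>; since \<open>e \<subseteq> T\<close>, the condition
  forces orthogonality to \<open>e\<close>.\<close>

definition outward_normal :: "point set \<Rightarrow> point set \<Rightarrow> point" where
  "outward_normal T e = (THE n. norm n = 1 \<and> (\<forall>x\<in>T. \<forall>y\<in>e. n \<bullet> (x - y) \<le> 0))"

text \<open>Arc-length integral over a segment; the value does not depend on which endpoint comes first.\<close>

definition edge_integral :: "point set \<Rightarrow> (point \<Rightarrow> 'b::euclidean_space) \<Rightarrow> 'b" where
  "edge_integral e \<phi> =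
     (SOME I. \<exists>a b. e = closed_segment a b \<and>
        I = dist a b *\<^sub>R (LINT t|lebesgue_on {0..1}. \<phi> (linepath a b t)))"


section \<open>Lebesgue and Sobolev spaces\<close>

definition L2_space :: "'a measure \<Rightarrow> ('a \<Rightarrow> 'b::euclidean_space) set" where
  "L2_space M = {f \<in> borel_measurable M. integrable M (\<lambda>x. (norm (f x))\<^sup>2)}"

definition L2_norm :: "'a measure \<Rightarrow> ('a \<Rightarrow> 'b::euclidean_space) \<Rightarrow> real" where
  "L2_norm M f = sqrt (LINT x|M. (norm (f x))\<^sup>2)"

abbreviation L2_on :: "point set \<Rightarrow> (point \<Rightarrow> 'b::euclidean_space) set" where
  "L2_on S \<equiv> L2_space (lebesgue_on S)"

abbreviation norm_L2 :: "point set \<Rightarrow> (point \<Rightarrow> 'b::euclidean_space) \<Rightarrow> real" where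
  "norm_L2 S \<equiv> L2_norm (lebesgue_on S)"

definition partial :: "2 \<Rightarrow> (point \<Rightarrow> real) \<Rightarrow> point \<Rightarrow> real" where
  "partial i \<phi> x = frechet_derivative \<phi> (at x) (axis i 1)"

definition classical_grad :: "(point \<Rightarrow> real) \<Rightarrow> point \<Rightarrow> point" where
  "classical_grad \<phi> x = (\<chi> i. partial i \<phi> x)"

primrec Ck :: "nat \<Rightarrow> (point \<Rightarrow> real) \<Rightarrow> bool" where
  "Ck 0 \<phi> \<longleftrightarrow> continuous_on UNIV \<phi>"
| "Ck (Suc k) \<phi> \<longleftrightarrow> (\<forall>x. \<phi> differentiable (at x)) \<and> (\<forall>i. Ck k (partial i \<phi>))"

definition smooth :: "(point \<Rightarrow> real) \<Rightarrow> bool" where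
  "smooth \<phi> \<longleftrightarrow> (\<forall>k. Ck k \<phi>)"

definition test_functions :: "point set \<Rightarrow> (point \<Rightarrow> real) set" where
  "test_functions S =
     {\<phi>. smooth \<phi> \<and> compact (closure {x. \<phi> x \<noteq> 0}) \<and> closure {x. \<phi> x \<noteq> 0} \<subseteq> S}"

definition has_weak_grad :: "point set \<Rightarrow> (point \<Rightarrow> real) \<Rightarrow> (point \<Rightarrow> point) \<Rightarrow> bool" where
  "has_weak_grad S u p \<longleftrightarrow> p \<in> L2_on S \<and>
     (\<forall>\<phi>\<in>test_functions S.
        (LINT x|lebesgue_on S. u x *\<^sub>R classical_grad \<phi> x) = - (LINT x|lebesgue_on S. \<phi> x *\<^sub>R p x))"

definition has_weak_div :: "point set \<Rightarrow> (point \<Rightarrow> point) \<Rightarrow> (point \<Rightarrow> real) \<Rightarrow> bool" where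
  "has_weak_div S \<tau> d \<longleftrightarrow> d \<in> L2_on S \<and>
     (\<forall>\<phi>\<in>test_functions S.
        (LINT x|lebesgue_on S. \<tau> x \<bullet> classical_grad \<phi> x) = - (LINT x|lebesgue_on S. \<phi> x * d x))"

text \<open>Representatives; they are determined up to null subsets of \<open>S\<close> and are arbitrary outside \<open>S\<close>.\<close>

definition weak_grad :: "point set \<Rightarrow> (point \<Rightarrow> real) \<Rightarrow> point \<Rightarrow> point" where
  "weak_grad S u = (SOME p. has_weak_grad S u p)"

definition weak_div :: "point set \<Rightarrow> (point \<Rightarrow> point) \<Rightarrow> point \<Rightarrow> real" where
  "weak_div S \<tau> = (SOME d. has_weak_div S \<tau> d)"

definition Hdiv :: "point set \<Rightarrow> (point \<Rightarrow> point) set" where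
  "Hdiv S = {\<tau> \<in> L2_on S. \<exists>d. has_weak_div S \<tau> d}"

definition H1 :: "point set \<Rightarrow> (point \<Rightarrow> real) set" where
  "H1 S = {u \<in> L2_on S. \<exists>p. has_weak_grad S u p}"

definition norm_H1 :: "point set \<Rightarrow> (point \<Rightarrow> real) \<Rightarrow> real" where
  "norm_H1 S u = sqrt ((norm_L2 S u)\<^sup>2 + (norm_L2 S (weak_grad S u))\<^sup>2)"

text \<open>For \<open>0 < s < 1\<close> the space \<open>H\<^sup>s(S)\<close> and its norm are those of the real interpolation space
  \<open>[L\<^sup>2(S), H\<^sup>1(S)]\<close> with parameters \<open>s, 2\<close>, given by Peetre's K-method. Unlike the constants
  relating it to the Sobolev-Slobodeckij norm, the constants obtained by interpolation do not
  depend on the shape of \<open>S\<close>. The K-method integral diverges at the endpoint \<open>s = 1\<close>, where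
  \<open>H\<^sup>1\<close> itself is used.\<close>

definition K_functional :: "point set \<Rightarrow> real \<Rightarrow> (point \<Rightarrow> real) \<Rightarrow> real" where
  "K_functional S t f = (INF w\<in>H1 S. norm_L2 S (\<lambda>x. f x - w x) + t * norm_H1 S w)"

definition interpolation_integral :: "real \<Rightarrow> point set \<Rightarrow> (point \<Rightarrow> real) \<Rightarrow> ennreal" where
  "interpolation_integral s S f =
     (\<integral>\<^sup>+ t\<in>{0<..}. ennreal ((t powr (- s) * K_functional S t f)\<^sup>2 / t) \<partial>lborel)"

definition Hs :: "real \<Rightarrow> point set \<Rightarrow> (point \<Rightarrow> real) set" where
  "Hs s S = (if s = 1 then H1 S else {f \<in> L2_on S. interpolation_integral s S f < \<infinity>})"

definition norm_Hs :: "real \<Rightarrow> point set \<Rightarrow> (point \<Rightarrow> real) \<Rightarrow> real" where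
  "norm_Hs s S f =
     (if s = 1 then norm_H1 S f else sqrt (enn2real (interpolation_integral s S f)))"

text \<open>The trace operator is the extension by density of the restriction of smooth functions to
  the boundary, continuous from \<open>H\<^sup>1(\<Omega>)\<close> to \<open>L\<^sup>2(\<partial>\<Omega>)\<close>. On a polygon, convergence in
  \<open>L\<^sup>2(\<partial>\<Omega>)\<close> is convergence in \<open>L\<^sup>2\<close> of every nondegenerate boundary segment, for which
  the affine parametrisation only contributes a constant factor.\<close>

definition has_trace :: "point set \<Rightarrow> (point \<Rightarrow> real) \<Rightarrow> (point \<Rightarrow> real) \<Rightarrow> bool" where
  "has_trace \<Omega> u g \<longleftrightarrow>
     (\<forall>a b. a \<noteq> b \<and> closed_segment a b \<subseteq> frontier \<Omega> \<longrightarrow>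
        g \<circ> linepath a b \<in> L2_space (lebesgue_on {0..1})) \<and>
     (\<exists>\<phi>::nat \<Rightarrow> point \<Rightarrow> real.
        (\<forall>n. smooth (\<phi> n)) \<and>
        (\<lambda>n. norm_H1 \<Omega> (\<lambda>x. \<phi> n x - u x)) \<longlonglongrightarrow> 0 \<and>
        (\<forall>a b. a \<noteq> b \<and> closed_segment a b \<subseteq> frontier \<Omega> \<longrightarrow>
           (\<lambda>n. L2_norm (lebesgue_on {0..1})
                  (\<lambda>t. \<phi> n (linepath a b t) - g (linepath a b t))) \<longlonglongrightarrow> 0))"

text \<open>\<open>H\<^sup>1\<^sup>/\<^sup>2(\<partial>\<Omega>)\<close> as the trace space of \<open>H\<^sup>1(\<Omega>)\<close>.\<close>

definition H_half :: "point set \<Rightarrow> (point \<Rightarrow> real) set" where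
  "H_half \<Omega> = {g. \<exists>w\<in>H1 \<Omega>. has_trace \<Omega> w g}"


section \<open>Discrete spaces and forms\<close>

text \<open>Piecewise polynomial functions are prescribed on the open triangles; their values on the
  mesh skeleton, a null set, are irrelevant. The value on an edge of the polynomial
  \<open>q|\<^sub>T\<close> is the limit from inside \<open>T\<close>.\<close>

definition from_element :: "point set \<Rightarrow> (point \<Rightarrow> 'b::euclidean_space) \<Rightarrow> point \<Rightarrow> 'b" where
  "from_element T q x = Lim (at x within interior T) q"

text \<open>For an interior edge the sums run over exactly the two adjacent triangles.\<close>

definition jump :: "point set set \<Rightarrow> (point \<Rightarrow> real) \<Rightarrow> point set \<Rightarrow> point \<Rightarrow> point" where
  "jump \<T> q e x = (\<Sum>T | T \<in> \<T> \<and> e edge_of T. from_element T q x *\<^sub>R outward_normal T e)"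

definition normal_jump :: "point set set \<Rightarrow> (point \<Rightarrow> point) \<Rightarrow> point set \<Rightarrow> point \<Rightarrow> real" where
  "normal_jump \<T> \<tau> e x = (\<Sum>T | T \<in> \<T> \<and> e edge_of T. from_element T \<tau> x \<bullet> outward_normal T e)"

definition V_space :: "point set set \<Rightarrow> (point \<Rightarrow> real) set" where
  "V_space \<T> = {v. \<forall>T\<in>\<T>. \<exists>c. \<forall>x\<in>interior T. v x = c}"

definition CR_space :: "point set \<Rightarrow> point set set \<Rightarrow> (point \<Rightarrow> real) set" where
  "CR_space \<Omega> \<T> =
     {v \<in> L2_on \<Omega>. (\<forall>T\<in>\<T>. \<exists>c a. \<forall>x\<in>interior T. v x = c + a \<bullet> x) \<and>
        (\<forall>e\<in>interior_edges \<T>. edge_integral e (jump \<T> v e) = 0)}"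

definition Sigma_space :: "point set \<Rightarrow> point set set \<Rightarrow> (point \<Rightarrow> point) set" where
  "Sigma_space \<Omega> \<T> = {\<tau>. \<forall>i. (\<lambda>x. \<tau> x $ i) \<in> CR_space \<Omega> \<T>}"

definition div_h :: "point set set \<Rightarrow> (point \<Rightarrow> point) \<Rightarrow> point \<Rightarrow> real" where
  "div_h \<T> \<tau> x = (\<Sum>T\<in>\<T>. indicator (interior T) x * weak_div (interior T) \<tau> x)"

definition form_a ::
  "point set \<Rightarrow> point set set \<Rightarrow> (point \<Rightarrow> point) \<Rightarrow> (point \<Rightarrow> point) \<Rightarrow> real" where
  "form_a \<Omega> \<T> \<sigma> \<tau> =
     (LINT x|lebesgue_on \<Omega>. \<sigma> x \<bullet> \<tau> x) +
     (\<Sum>e\<in>interior_edges \<T>.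
        edge_integral e (\<lambda>x. 1 / diameter e * normal_jump \<T> \<sigma> e x * normal_jump \<T> \<tau> e x))"

definition form_b ::
  "point set \<Rightarrow> point set set \<Rightarrow> (point \<Rightarrow> point) \<Rightarrow> (point \<Rightarrow> real) \<Rightarrow> real" where
  "form_b \<Omega> \<T> \<tau> v = (LINT x|lebesgue_on \<Omega>. v x * div_h \<T> \<tau> x)"

text \<open>The boundary integral is split along the boundary edges of the mesh; on such an edge the
  outward normal of the domain is that of the unique adjacent triangle.\<close>

definition form_G ::
  "point set \<Rightarrow> point set set \<Rightarrow> (point \<Rightarrow> real) \<Rightarrow> (point \<Rightarrow> point) \<Rightarrow> real" where
  "form_G \<Omega> \<T> g \<tau> =
     (\<Sum>T\<in>\<T>. \<Sum>e | e edge_of T \<and> e \<subseteq> frontier \<Omega>.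
        edge_integral e (\<lambda>x. g x * (from_element T \<tau> x \<bullet> outward_normal T e)))"

definition form_F :: "point set \<Rightarrow> (point \<Rightarrow> real) \<Rightarrow> (point \<Rightarrow> real) \<Rightarrow> real" where
  "form_F \<Omega> f v = (LINT x|lebesgue_on \<Omega>. f x * v x)"


section \<open>The continuous and the discrete problem\<close>

definition exact_solution ::
  "point set \<Rightarrow> (point \<Rightarrow> real) \<Rightarrow> (point \<Rightarrow> real) \<Rightarrow> (point \<Rightarrow> point) \<Rightarrow> (point \<Rightarrow> real) \<Rightarrow> bool" where
  "exact_solution \<Omega> f g \<sigma> u \<longleftrightarrow>
     \<sigma> \<in> Hdiv \<Omega> \<and> u \<in> H1 \<Omega> \<and>
     (AE x in lebesgue_on \<Omega>. \<sigma> x + weak_grad \<Omega> u x = 0) \<and>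
     (AE x in lebesgue_on \<Omega>. weak_div \<Omega> \<sigma> x = f x) \<and>
     has_trace \<Omega> u g"

definition discrete_solution ::
  "point set \<Rightarrow> point set set \<Rightarrow> (point \<Rightarrow> real) \<Rightarrow> (point \<Rightarrow> real) \<Rightarrow>
     (point \<Rightarrow> point) \<Rightarrow> (point \<Rightarrow> real) \<Rightarrow> bool" where
  "discrete_solution \<Omega> \<T> f g \<sigma>h uh \<longleftrightarrow>
     \<sigma>h \<in> Sigma_space \<Omega> \<T> \<and> uh \<in> V_space \<T> \<and>
     (\<forall>\<tau>\<in>Sigma_space \<Omega> \<T>. form_a \<Omega> \<T> \<sigma>h \<tau> - form_b \<Omega> \<T> \<tau> uh = - form_G \<Omega> \<T> g \<tau>) \<and>
     (\<forall>v\<in>V_space \<T>. - form_b \<Omega> \<T> \<sigma>h v = - form_F \<Omega> f v)"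

end

theory Submission
  imports Defs
begin

text \<open>On a triangle \<open>T\<close> of the mesh the field \<open>\<sigma>h\<close> is affine, so \<open>div \<sigma>h\<close> is a constant \<open>\<delta>\<close> there. The
indicator function of \<open>T\<close> is an admissible test function in the second discrete equation, and that
equation then says that \<open>\<delta>\<close> is the mean value of \<open>f\<close> over \<open>T\<close>. Since \<open>div \<sigma> = f\<close>, the error
\<open>div (\<sigma> - \<sigma>h)\<close> is \<open>f\<close> minus its mean, and among all constants the mean is the best approximation in
the \<open>L\<^sup>2\<close> norm. This is the chain of equalities (\<open>divergence_error\<close>); it rests on the uniqueness
of weak derivatives (\<open>fundamental_lemma\<close>), on the weak divergence of an affine field
(\<open>affine_weak_div\<close>) and on the Jordan curve theorem, which keeps the open triangles inside the
domain (\<open>mesh_triangle\<close>).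

For \<open>s = 1\<close> the rate is the Poincare inequality with constant \<open>diameter T / \<pi>\<close>, the classical
Payne-Weinberger bound. The usual proof works for every convex domain by repeatedly bisecting it;
for a triangle the following argument avoids the limit of bisections. An affine map takes \<open>T\<close> to an
equilateral triangle, and an equilateral triangle is unfolded by reflections into a strip. A strip
segment of three rectangles covers the triangle three times and closes up, with a
flip, after these three rectangles. A function on the strip is split into its averages across the
strip and the deviation from these averages. The deviation is controlled by a Neumann inequality on
an interval, in the direction of the medians of \<open>T\<close> (\<open>neumann_inequality\<close>). The averages form a
function on a circle, whose derivative is taken along the edges of \<open>T\<close>
(\<open>three_arc_inequality\<close>). Summed over the three medians and the three edges, and with each edge
bounded by the diameter, this gives the constant \<open>173/1728\<close>, which is less than \<open>1/\<pi>\<^sup>2\<close>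
(\<open>poincare_smooth\<close>). The sharp constants of the two one-dimensional inequalities, \<open>1/\<pi>\<^sup>2\<close> and
\<open>9/(4\<pi>\<^sup>2)\<close>, would lead to \<open>7/(8\<pi>\<^sup>2)\<close>; the gap leaves room for elementary proofs of the
one-dimensional inequalities with rational constants.

Weakly differentiable functions are reached by mollification on slightly shrunk triangles
(\<open>poincare_triangle\<close>). The variance is written as a double integral of squared differences, so that
only pointwise convergence and Fatou's lemma are involved in the passage to the limit.

For \<open>0 < s < 1\<close> the two bounds, contraction and Poincare inequality, combine to
\<open>\<parallel>f - mean f\<parallel> \<le> K(t, f)\<close> for all \<open>t \<ge> diameter T / \<pi>\<close>. Restricting the integral that defines
the interpolation norm to one dyadic interval of such \<open>t\<close> yields the rate \<open>(diameter T)\<^sup>s\<close>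
(\<open>average_error_interpolation\<close>).\<close>

section \<open>One-dimensional Poincare inequalities\<close>

lemma abs_square_le: "\<bar>a\<bar> \<le> K \<Longrightarrow> a\<^sup>2 \<le> K\<^sup>2" for a K :: real
  using power_mono[of "\<bar>a\<bar>" K 2] by simp

text \<open>Expands \<open>0 \<le> \<integral> (B - k w)\<^sup>2 / w\<close> with the optimal \<open>k\<close> for the upper bound \<open>c\<close> of the total weight.\<close>

lemma weighted_cauchy_schwarz:
  fixes B w :: "'a \<Rightarrow> real"
  assumes "integrable M B" "integrable M w" "integrable M (\<lambda>t. (B t)\<^sup>2 / w t)"
    and w: "\<And>t. t \<in> space M \<Longrightarrow> 0 < w t" and c: "(LINT t|M. w t) \<le> c" "0 < c"
  shows "(LINT t|M. B t)\<^sup>2 \<le> c * (LINT t|M. (B t)\<^sup>2 / w t)"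
proof -
  define \<beta> k where "\<beta> = (LINT t|M. B t)" and "k = \<beta> / c"
  have "0 \<le> (LINT t|M. (B t - k * w t)\<^sup>2 / w t)"
    using w by (intro Bochner_Integration.integral_nonneg) (simp add: less_imp_le)
  also have "\<dots> = (LINT t|M. (B t)\<^sup>2 / w t - 2 * k * B t + k\<^sup>2 * w t)"
  proof (intro Bochner_Integration.integral_cong refl)
    fix t assume "t \<in> space M"
    then have "w t \<noteq> 0" using w by force
    then show "(B t - k * w t)\<^sup>2 / w t = (B t)\<^sup>2 / w t - 2 * k * B t + k\<^sup>2 * w t"
      by (simp add: power2_eq_square field_simps)
  qed
  also have "\<dots> = (LINT t|M. (B t)\<^sup>2 / w t) - 2 * k * \<beta> + k\<^sup>2 * (LINT t|M. w t)"
    using assms by (simp add: \<beta>_def)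
  also have "\<dots> \<le> (LINT t|M. (B t)\<^sup>2 / w t) - 2 * k * \<beta> + k\<^sup>2 * c"
    using c by (intro add_left_mono mult_left_mono) auto
  finally have "\<beta>\<^sup>2 / c \<le> (LINT t|M. (B t)\<^sup>2 / w t)"
    using c by (simp add: k_def power2_eq_square field_simps)
  then show ?thesis using c by (simp add: \<beta>_def field_simps)
qed

text \<open>This form of the variance contains only pointwise differences of values, so it survives Fatou's
lemma, while a form with the mean would ask for convergence of the means as well.\<close>

lemma variance_identity:
  fixes u :: "'a \<Rightarrow> real"
  assumes "finite_measure M" and "integrable M u" "integrable M (\<lambda>x. (u x)\<^sup>2)"
    and pos: "0 < measure M (space M)"
  shows "(LINT x|M. (LINT y|M. (u x - u y)\<^sup>2)) =
           2 * measure M (space M) * (LINT x|M. (u x - (LINT y|M. u y) / measure M (space M))\<^sup>2)"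
proof -
  interpret finite_measure M by fact
  define V S A where "V = measure M (space M)" and "S = (LINT x|M. (u x)\<^sup>2)" and "A = (LINT x|M. u x)"
  have sq: "(LINT y|M. (u y - k)\<^sup>2) = S - 2 * k * A + k\<^sup>2 * V" for k
  proof -
    have "(LINT y|M. (u y - k)\<^sup>2) = (LINT y|M. (u y)\<^sup>2 - 2 * k * u y + k\<^sup>2)"
      by (simp add: power2_eq_square algebra_simps)
    also have "\<dots> = S - 2 * k * A + k\<^sup>2 * V"
      using assms(2,3) by (simp add: S_def A_def V_def)
    finally show ?thesis .
  qed
  have "(LINT x|M. (LINT y|M. (u x - u y)\<^sup>2)) = (LINT x|M. S - 2 * A * u x + V * (u x)\<^sup>2)"
    by (subst power2_commute, subst sq) (simp add: ac_simps)
  also have "\<dots> = S * V - 2 * A * A + V * S"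
    using assms(2,3) by (simp add: S_def[symmetric] A_def[symmetric] V_def[symmetric])
  also have "\<dots> = 2 * V * (S - 2 * (A / V) * A + (A / V)\<^sup>2 * V)"
    using pos by (simp add: V_def[symmetric] power2_eq_square field_simps)
  also have "\<dots> = 2 * V * (LINT x|M. (u x - A / V)\<^sup>2)" by (simp add: sq)
  finally show ?thesis by (simp add: V_def A_def)
qed

text \<open>The polynomial inequality behind \<open>neumann_inequality\<close>. Both sides depend only on \<open>l\<close> and
\<open>s = t (l - t)\<close>, and \<open>4 s \<le> l\<^sup>2\<close> leaves an inequality that is linear in \<open>s\<close> after one factor \<open>s\<close>
has been bounded. The best constant for the weight \<open>t (l - t)\<close> alone would be \<open>5/48\<close>; the summand
\<open>l\<^sup>2 / 32\<close> costs the difference to \<open>23/216\<close>.\<close>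

lemma neumann_kernel_bound:
  fixes t l :: real
  assumes "0 \<le> t" "t \<le> l"
  defines "V \<equiv> \<lambda>t. l * t^3 / 6 - t^4 / 12 + l\<^sup>2 * t\<^sup>2 / 64"
  shows "t * V l - l * V t \<le> 23/216 * l^3 * (t * (l - t) + l\<^sup>2 / 32)"
proof -
  define s where "s = t * (l - t)"
  have s0: "0 \<le> s" using assms by (simp add: s_def)
  have "0 \<le> (l - 2 * t)\<^sup>2" by simp
  then have s1: "4 * s \<le> l\<^sup>2" by (simp add: s_def power2_eq_square algebra_simps)
  have "t * V l - l * V t = l * (s\<^sup>2 / 12 + l\<^sup>2 * s * (1/12 + 1/64))"
    by (simp add: V_def s_def power2_eq_square power3_eq_cube power4_eq_xxxx field_simps)
  also have "\<dots> \<le> l * (23/216 * l\<^sup>2 * (s + l\<^sup>2 / 32))"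
  proof (intro mult_left_mono)
    have "0 \<le> (l\<^sup>2 - 4 * s) * s" "0 \<le> (l\<^sup>2 - 4 * s) * l\<^sup>2" using s0 s1 by simp_all
    then show "s\<^sup>2 / 12 + l\<^sup>2 * s * (1/12 + 1/64) \<le> 23/216 * l\<^sup>2 * (s + l\<^sup>2 / 32)"
      by (simp add: power2_eq_square algebra_simps)
  qed (use assms in auto)
  also have "\<dots> = 23/216 * l^3 * (s + l\<^sup>2 / 32)" by (simp add: power2_eq_square power3_eq_cube)
  finally show ?thesis by (simp only: s_def)
qed

lemma integral_interval_FTC:
  fixes F f :: "real \<Rightarrow> real"
  assumes "a \<le> b" "\<And>x. (F has_real_derivative f x) (at x)" "continuous_on UNIV f"
  shows "(LINT x:{a..b}|lborel. f x) = F b - F a"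
proof -
  have "(LINT x|lborel. f x * indicator {a..b} x) = F b - F a"
    using assms by (intro integral_FTC_Icc_real) (auto simp: continuous_on_eq_continuous_at)
  then show ?thesis by (simp add: set_lebesgue_integral_def mult.commute)
qed

text \<open>Here \<open>B\<close> is the derivative of \<open>u\<close>. The weighted Cauchy-Schwarz inequality bounds \<open>(u y - u x)\<^sup>2\<close> by
\<open>(W y - W x) \<integral> B\<^sup>2 / w\<close> with \<open>W' = w\<close>. Integration over \<open>x\<close> and \<open>y\<close> turns the left side into the
variance and the right side into \<open>\<integral> kernel(t) B(t)\<^sup>2 / w(t)\<close>, and the kernel is at most a multiple of
\<open>w\<close> by \<open>neumann_kernel_bound\<close>. With the sine, the derivative of the first eigenfunction, as weight this
would give the sharp constant \<open>1/\<pi>\<^sup>2\<close>; the weight \<open>t (l - t)\<close> is its polynomial substitute, and the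
additional \<open>l\<^sup>2 / 32\<close> keeps the weight away from zero, so that \<open>B\<^sup>2 / w\<close> is bounded.\<close>

theorem neumann_inequality:
  fixes u B :: "real \<Rightarrow> real"
  assumes l: "0 < l" and B[measurable]: "B \<in> borel_measurable borel" and BK: "\<And>t. \<bar>B t\<bar> \<le> K"
    and cu: "continuous_on {0..l} u"
    and inc: "\<And>x y. 0 \<le> x \<Longrightarrow> x \<le> y \<Longrightarrow> y \<le> l \<Longrightarrow> u y - u x = (LINT t:{x..y}|lborel. B t)"
  defines "m \<equiv> (LINT x:{0..l}|lborel. u x) / l"
  shows "(LINT x:{0..l}|lborel. (u x - m)\<^sup>2) \<le> 23/216 * l\<^sup>2 * (LINT t:{0..l}|lborel. (B t)\<^sup>2)"
proof -
  define I where "I = restrict_space lborel {0..l}"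
  define w where "w = (\<lambda>t. t * (l - t) + l\<^sup>2 / 32)"
  define W where "W = (\<lambda>t. l * t\<^sup>2 / 2 - t^3 / 3 + l\<^sup>2 * t / 32)"
  define V where "V = (\<lambda>t. l * t^3 / 6 - t^4 / 12 + l\<^sup>2 * t\<^sup>2 / 64)"
  have spI: "space I = {0..l}" and setsI[measurable_cong]: "sets I = sets (restrict_space borel {0..l})"
    by (auto simp: I_def space_restrict_space intro!: sets_restrict_space_cong)
  have mI: "measure I (space I) = l"
    using l by (simp add: I_def space_restrict_space measure_restrict_space)
  interpret I: finite_measure I
    using l by (intro finite_measureI) (simp add: I_def space_restrict_space emeasure_restrict_space)
  interpret II: pair_sigma_finite I I ..
  interpret PP: finite_measure "I \<Otimes>\<^sub>M I" by (rule finite_measure_pair_measure) unfold_locales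
  interpret III: pair_sigma_finite "I \<Otimes>\<^sub>M I" I ..
  have LI: "(LINT x|I. f x) = (LINT x:{0..l}|lborel. f x)" for f :: "real \<Rightarrow> real"
    by (simp add: I_def integral_restrict_space set_lebesgue_integral_def)
  have um[measurable]: "u \<in> borel_measurable I"
    using borel_measurable_continuous_on_restrict[OF cu] by (simp add: setsI cong: measurable_cong_sets)
  obtain Ku where Ku: "\<And>x. x \<in> {0..l} \<Longrightarrow> \<bar>u x\<bar> \<le> Ku"
    using compact_imp_bounded[OF compact_continuous_image[OF cu]] by (fastforce simp: bounded_iff)
  have w1: "l\<^sup>2 / 32 \<le> w t" if "t \<in> {0..l}" for t using that by (simp add: w_def)
  have w0: "0 < w t" if "t \<in> {0..l}" for t
    using w1[OF that] l zero_less_power[of l 2] by linarith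
  have wm[measurable]: "w \<in> borel_measurable borel" and Wm[measurable]: "W \<in> borel_measurable borel"
    by (simp_all add: w_def W_def)
  have dW: "(W has_real_derivative w x) (at x)" for x
    unfolding W_def w_def by (auto intro!: derivative_eq_intros simp: power2_eq_square algebra_simps)
  have dV: "(V has_real_derivative W x) (at x)" for x
    unfolding V_def W_def by (auto intro!: derivative_eq_intros simp: power2_eq_square power3_eq_cube algebra_simps)
  have cw: "continuous_on UNIV w" "continuous_on UNIV W" by (auto simp: w_def W_def intro!: continuous_intros)
  have Wmono: "W x \<le> W y" if "0 \<le> x" "x \<le> y" "y \<le> l" for x y
    by (rule DERIV_nonneg_imp_nondecreasing[OF that(2)]) (use dW w0 that in \<open>force intro: less_imp_le\<close>)
  have BI: "integrable I f" if "f \<in> borel_measurable I" "\<And>t. t \<in> {0..l} \<Longrightarrow> \<bar>f t\<bar> \<le> C" for f :: "real \<Rightarrow> real" and C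
    using that by (intro I.integrable_const_bound[where B=C]) (auto simp: spI intro!: AE_I2)
  define q where "q = (\<lambda>t. (B t)\<^sup>2 / w t)"
  have qm[measurable]: "q \<in> borel_measurable borel" by (simp add: q_def)
  have q0: "0 \<le> q t" if "t \<in> {0..l}" for t using w0[OF that] by (simp add: q_def)
  have qK: "q t \<le> K\<^sup>2 / (l\<^sup>2 / 32)" if "t \<in> {0..l}" for t
    unfolding q_def using l w1[OF that] BK[of t] by (intro frac_le) (auto intro!: abs_square_le)
  define E where "E = (\<lambda>x y t. (if x < t \<and> t < y then (W y - W x) else 0) :: real)"
  have idI: "(\<lambda>x. x) \<in> I \<rightarrow>\<^sub>M borel"
    by (simp add: I_def measurable_restrict_space1)
  have idP: "(\<lambda>z. z) \<in> I \<Otimes>\<^sub>M I \<rightarrow>\<^sub>M borel \<Otimes>\<^sub>M borel"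
    using measurable_Pair[OF measurable_compose[OF measurable_fst idI] measurable_compose[OF measurable_snd idI]]
    by simp
  have idT: "(\<lambda>z. z) \<in> (I \<Otimes>\<^sub>M I) \<Otimes>\<^sub>M I \<rightarrow>\<^sub>M (borel \<Otimes>\<^sub>M borel) \<Otimes>\<^sub>M borel"
    using measurable_Pair[OF measurable_compose[OF measurable_fst idP] measurable_compose[OF measurable_snd idI]]
    by simp
  have Em[measurable]: "(\<lambda>p. E (fst (fst p)) (snd (fst p)) (snd p)) \<in> borel_measurable ((I \<Otimes>\<^sub>M I) \<Otimes>\<^sub>M I)"
    by (rule measurable_compose[OF idT, where g="\<lambda>p. E (fst (fst p)) (snd (fst p)) (snd p)"], unfold E_def, measurable)
  have Em'[measurable]: "(\<lambda>p. E (snd (fst p)) (fst (fst p)) (snd p)) \<in> borel_measurable ((I \<Otimes>\<^sub>M I) \<Otimes>\<^sub>M I)"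
    by (rule measurable_compose[OF idT, where g="\<lambda>p. E (snd (fst p)) (fst (fst p)) (snd p)"], unfold E_def, measurable)
  have Em2[measurable]: "(\<lambda>p. E (fst p) (snd p) t) \<in> borel_measurable (I \<Otimes>\<^sub>M I)" for t
    by (rule measurable_compose[OF idP, where g="\<lambda>p. E (fst p) (snd p) t"], unfold E_def, measurable)
  have Em2'[measurable]: "(\<lambda>p. E (snd p) (fst p) t) \<in> borel_measurable (I \<Otimes>\<^sub>M I)" for t
    by (rule measurable_compose[OF idP, where g="\<lambda>p. E (snd p) (fst p) t"], unfold E_def, measurable)
  have qI[measurable]: "q \<in> borel_measurable I" "B \<in> borel_measurable I"
    by (auto intro!: measurable_compose[OF idI])
  have E0: "0 \<le> E x y t" "E x y t \<le> W l - W 0" if "x \<in> {0..l}" "y \<in> {0..l}" for x y t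
    using Wmono[of x y] Wmono[of y l] Wmono[of 0 x] Wmono[of 0 l] that l by (auto simp: E_def)
  (* E x y is the indicator function of the open interval from x to y times the total
     weight of this interval, and it vanishes for y <= x, so E x y + E y x serves both orders. *)
  have cs: "(u y - u x)\<^sup>2 \<le> (LINT t|I. E x y t * q t)" if xy: "0 \<le> x" "x < y" "y \<le> l" for x y
  proof -
    define J where "J = restrict_space lborel {x<..<y}"
    have LJ: "(LINT t|J. f t) = (LINT t|lborel. indicator {x<..<y} t * f t)" for f :: "real \<Rightarrow> real"
      by (simp add: J_def integral_restrict_space set_lebesgue_integral_def)
    have LJ': "(LINT t|J. f t) = (LINT t:{x..y}|lborel. f t)" if "f \<in> borel_measurable borel" for f :: "real \<Rightarrow> real"
      unfolding LJ set_lebesgue_integral_def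
    proof (rule integral_cong_AE)
      have "AE t in lborel. t \<noteq> x" "AE t in lborel. t \<noteq> y" by (simp_all add: AE_lborel_singleton)
      then show "AE t in lborel. indicator {x<..<y} t * f t = indicator {x..y} t *\<^sub>R f t"
        by eventually_elim (auto split: split_indicator)
    qed (use that in measurable)
    interpret J: finite_measure J
      using xy by (intro finite_measureI) (simp add: J_def space_restrict_space emeasure_restrict_space)
    have spJ: "space J = {x<..<y}" by (simp add: J_def space_restrict_space)
    have [measurable_cong]: "sets J = sets (restrict_space borel {x<..<y})"
      by (auto simp: J_def intro!: sets_restrict_space_cong)
    have BJ: "integrable J f" if "f \<in> borel_measurable borel" "\<And>t. t \<in> {0..l} \<Longrightarrow> \<bar>f t\<bar> \<le> C" for f :: "real \<Rightarrow> real" and C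
      using that xy by (intro J.integrable_const_bound[where B=C])
         (auto simp: spJ J_def intro!: AE_I2 measurable_restrict_space1)
    have iw: "(LINT t|J. w t) = W y - W x"
      using xy by (simp add: LJ' integral_interval_FTC[OF _ dW cw(1)])
    have wb: "\<bar>w t\<bar> \<le> l * l + l\<^sup>2/32" if "t \<in> {0..l}" for t
      using that by (auto simp: w_def abs_of_nonneg intro!: mult_mono)
    have Wless: "W x < W y"
      using xy dW w0 by (intro DERIV_pos_imp_increasing[of x y W]) force+
    have "(u y - u x)\<^sup>2 = (LINT t|J. B t)\<^sup>2"
      using xy by (simp add: inc LJ')
    also have "\<dots> \<le> (W y - W x) * (LINT t|J. (B t)\<^sup>2 / w t)"
    proof (rule weighted_cauchy_schwarz)
      show "integrable J (\<lambda>t. (B t)\<^sup>2 / w t)"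
        by (rule BJ[of _ "K\<^sup>2 / (l\<^sup>2 / 32)"]) (simp, metis abs_of_nonneg q0 qK q_def)
    qed (use BJ[of B K] BJ[of w] BK wb w0 xy Wless in \<open>auto simp: iw spJ\<close>)
    also have "\<dots> = (LINT t|lborel. indicator {0..l} t * (E x y t * q t))"
      unfolding LJ q_def[symmetric]
      by (subst integral_mult_right_zero[symmetric], intro Bochner_Integration.integral_cong)
         (use xy in \<open>auto simp: E_def split: split_indicator\<close>)
    finally show ?thesis by (simp add: LI set_lebesgue_integral_def)
  qed
  have cs': "(u x - u y)\<^sup>2 \<le> (LINT t|I. (E x y t + E y x t) * q t)" if xy: "x \<in> {0..l}" "y \<in> {0..l}" for x y
  proof -
    have *: "E a b t = 0" if "b \<le> a" for a b t using that by (simp add: E_def)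
    consider "x < y" | "y < x" | "x = y" by linarith
    then show ?thesis
      using cs[of x y] cs[of y x] xy by cases (auto simp: * power2_commute)
  qed
  have int3: "integrable ((I \<Otimes>\<^sub>M I) \<Otimes>\<^sub>M I) (\<lambda>(z, t). (E (fst z) (snd z) t + E (snd z) (fst z) t) * q t)"
  proof -
    interpret PPP: finite_measure "(I \<Otimes>\<^sub>M I) \<Otimes>\<^sub>M I" by (rule finite_measure_pair_measure) unfold_locales
    show ?thesis
    proof (rule PPP.integrable_const_bound[where B="(2 * (W l - W 0)) * (K\<^sup>2 / (l\<^sup>2 / 32))"])
      show "AE x in (I \<Otimes>\<^sub>M I) \<Otimes>\<^sub>M I. norm (case x of (z, t) \<Rightarrow> (E (fst z) (snd z) t + E (snd z) (fst z) t) * q t)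
          \<le> 2 * (W l - W 0) * (K\<^sup>2 / (l\<^sup>2 / 32))"
      proof (rule AE_I2)
        fix p assume "p \<in> space ((I \<Otimes>\<^sub>M I) \<Otimes>\<^sub>M I)"
        then obtain x y t where p: "p = ((x, y), t)" and xyt: "x \<in> {0..l}" "y \<in> {0..l}" "t \<in> {0..l}"
          by (auto simp: space_pair_measure spI)
        have "\<bar>E x y t + E y x t\<bar> * \<bar>q t\<bar> \<le> 2 * (W l - W 0) * (K\<^sup>2 / (l\<^sup>2 / 32))"
          using E0[OF xyt(1,2), of t] E0[OF xyt(2,1), of t] q0[OF xyt(3)] qK[OF xyt(3)] by (intro mult_mono) auto
        then show "norm (case p of (z, t) \<Rightarrow> (E (fst z) (snd z) t + E (snd z) (fst z) t) * q t) \<le> 2 * (W l - W 0) * (K\<^sup>2 / (l\<^sup>2 / 32))"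
          by (simp add: p abs_mult)
      qed
    qed (simp add: split_beta')
  qed
  (* With V' = W and V 0 = 0, the double integral of W y - W x over x < t < y is
     t V(l) - l V(t). *)
  have kern: "(LINT z|(I \<Otimes>\<^sub>M I). E (fst z) (snd z) t + E (snd z) (fst z) t) = 2 * (t * V l - l * V t)" if t: "t \<in> {0..l}" for t
  proof -
    have V0: "V 0 = 0" by (simp add: V_def)
    have Wb: "\<bar>W x\<bar> \<le> \<bar>W 0\<bar> + \<bar>W l\<bar>" if "x \<in> {0..l}" for x
      using Wmono[of 0 x] Wmono[of x l] that by auto
    have intE: "integrable (I \<Otimes>\<^sub>M I) (\<lambda>z. E (fst z) (snd z) t)"
      using E0 by (intro PP.integrable_const_bound[where B="W l - W 0"])
        (auto simp: space_pair_measure spI abs_of_nonneg intro!: AE_I2)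
    have intE': "integrable (I \<Otimes>\<^sub>M I) (\<lambda>z. E (snd z) (fst z) t)"
      using E0 by (intro PP.integrable_const_bound[where B="W l - W 0"])
        (auto simp: space_pair_measure spI abs_of_nonneg intro!: AE_I2)
    have inner: "(LINT y|I. E x y t) = indicator {..<t} x * ((V l - V t) - (l - t) * W x)" for x
    proof (cases "x < t")
      case True
      have "(LINT y|I. E x y t) = (LINT y:{t..l}|lborel. W y - W x)"
        unfolding LI set_lebesgue_integral_def
      proof (rule integral_cong_AE)
        have "AE y in lborel. y \<noteq> t" by (simp add: AE_lborel_singleton)
        then show "AE y in lborel. indicat_real {0..l} y *\<^sub>R E x y t = indicat_real {t..l} y *\<^sub>R (W y - W x)"
          by eventually_elim (use True t in \<open>auto simp: E_def split: split_indicator\<close>)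
      qed (auto simp: E_def)
      also have "\<dots> = (V l - l * W x) - (V t - t * W x)"
        using t by (intro integral_interval_FTC)
          (auto intro!: derivative_eq_intros dV continuous_intros cw)
      finally show ?thesis using True by (simp add: algebra_simps)
    qed (simp add: E_def)
    have outer: "(LINT x|I. indicator {..<t} x * ((V l - V t) - (l - t) * W x)) = t * V l - l * V t"
    proof -
      have "(LINT x|I. indicator {..<t} x * ((V l - V t) - (l - t) * W x)) = (LINT x:{0..t}|lborel. (V l - V t) - (l - t) * W x)"
        unfolding LI set_lebesgue_integral_def
      proof (rule integral_cong_AE)
        have "AE y in lborel. y \<noteq> t" by (simp add: AE_lborel_singleton)
        then show "AE x in lborel. indicat_real {0..l} x *\<^sub>R (indicator {..<t} x * ((V l - V t) - (l - t) * W x))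
             = indicat_real {0..t} x *\<^sub>R ((V l - V t) - (l - t) * W x)"
          by eventually_elim (use t in \<open>auto split: split_indicator\<close>)
      qed auto
      also have "\<dots> = ((V l - V t) * t - (l - t) * V t) - ((V l - V t) * 0 - (l - t) * V 0)"
        using t by (intro integral_interval_FTC)
          (auto intro!: derivative_eq_intros dV continuous_intros cw)
      finally show ?thesis by (simp add: V0 algebra_simps)
    qed
    have "(LINT z|(I \<Otimes>\<^sub>M I). E (fst z) (snd z) t) = (LINT x|I. LINT y|I. E x y t)"
      using II.integral_fst[of "\<lambda>x y. E x y t"] intE by (simp add: split_beta')
    moreover have "(LINT z|(I \<Otimes>\<^sub>M I). E (snd z) (fst z) t) = (LINT x|I. LINT y|I. E x y t)"
      using II.integral_snd[of "\<lambda>x y. E y x t"] intE' by (simp add: split_beta')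
    ultimately show ?thesis using intE intE' by (simp add: inner outer)
  qed
  have "2 * l * (LINT x|I. (u x - m)\<^sup>2) = (LINT x|I. (LINT y|I. (u x - u y)\<^sup>2))"
  proof -
    have "integrable I u" by (rule BI[OF um]) (use Ku in auto)
    moreover have "integrable I (\<lambda>x. (u x)\<^sup>2)"
      by (rule BI[where C="Ku\<^sup>2"]) (use Ku um in \<open>auto intro!: abs_square_le\<close>)
    ultimately show ?thesis
      using variance_identity[of I u] l I.finite_measure_axioms by (simp add: mI m_def LI)
  qed
  also have "\<dots> \<le> (LINT z|(I \<Otimes>\<^sub>M I). (LINT t|I. (E (fst z) (snd z) t + E (snd z) (fst z) t) * q t))"
  proof -
    have intu: "integrable (I \<Otimes>\<^sub>M I) (\<lambda>z. (u (fst z) - u (snd z))\<^sup>2)"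
    proof (intro PP.integrable_const_bound[where B="(2 * Ku)\<^sup>2"] AE_I2)
      fix z assume "z \<in> space (I \<Otimes>\<^sub>M I)"
      then have "\<bar>u (fst z)\<bar> \<le> Ku" "\<bar>u (snd z)\<bar> \<le> Ku" by (auto simp: space_pair_measure spI intro!: Ku)
      then have "\<bar>u (fst z) - u (snd z)\<bar> \<le> \<bar>2 * Ku\<bar>" by linarith
      then show "norm ((u (fst z) - u (snd z))\<^sup>2) \<le> (2 * Ku)\<^sup>2" by (simp only: real_norm_def abs_power2 abs_le_square_iff)
    qed simp
    have "(LINT x|I. (LINT y|I. (u x - u y)\<^sup>2)) = (LINT z|(I \<Otimes>\<^sub>M I). (u (fst z) - u (snd z))\<^sup>2)"
      using II.integral_fst[of "\<lambda>x y. (u x - u y)\<^sup>2"] intu by (simp add: split_beta')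
    also have "\<dots> \<le> (LINT z|(I \<Otimes>\<^sub>M I). (LINT t|I. (E (fst z) (snd z) t + E (snd z) (fst z) t) * q t))"
      using III.integrable_fst[OF int3] intu
      by (intro integral_mono) (auto simp: split_beta' space_pair_measure spI intro!: cs')
    finally show ?thesis .
  qed
  also have "\<dots> = (LINT t|I. (LINT z|(I \<Otimes>\<^sub>M I). (E (fst z) (snd z) t + E (snd z) (fst z) t) * q t))"
    using III.Fubini_integral[OF int3] by simp
  also have "\<dots> = (LINT t|I. 2 * (t * V l - l * V t) * q t)"
    by (intro Bochner_Integration.integral_cong refl) (simp add: kern spI)
  also have "\<dots> \<le> (LINT t|I. 2 * l * (23/216 * l\<^sup>2 * (B t)\<^sup>2))"
  proof (rule integral_mono)
    show "integrable I (\<lambda>t. 2 * l * (23/216 * l\<^sup>2 * (B t)\<^sup>2))"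
      by (rule BI[where C="2 * l * (23/216 * l\<^sup>2 * K\<^sup>2)"])
         (use l BK in \<open>auto simp: abs_mult intro!: mult_left_mono abs_square_le\<close>)
    show "integrable I (\<lambda>t. 2 * (t * V l - l * V t) * q t)"
    proof -
      have "integrable I (\<lambda>t. (LINT z|(I \<Otimes>\<^sub>M I). (E (fst z) (snd z) t + E (snd z) (fst z) t) * q t))"
        using III.integrable_snd[of "\<lambda>z t. (E (fst z) (snd z) t + E (snd z) (fst z) t) * q t"] int3 by (simp add: split_beta')
      then show ?thesis
        by (rule Bochner_Integration.integrable_cong[THEN iffD1, rotated -1]) (simp_all add: kern spI)
    qed
    fix t assume "t \<in> space I"
    then have t: "t \<in> {0..l}" by (simp add: spI)
    have "(t * V l - l * V t) * q t \<le> (23/216 * l^3 * w t) * q t"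
      unfolding V_def w_def using t by (intro mult_right_mono neumann_kernel_bound q0) auto
    also have "\<dots> = l * (23/216 * l\<^sup>2 * (B t)\<^sup>2)"
      using w0[OF t] by (simp add: q_def power2_eq_square power3_eq_cube)
    finally show "2 * (t * V l - l * V t) * q t \<le> 2 * l * (23/216 * l\<^sup>2 * (B t)\<^sup>2)" by linarith
  qed
  finally have "2 * l * (LINT x|I. (u x - m)\<^sup>2) \<le> 2 * l * (23/216 * l\<^sup>2 * (LINT t|I. (B t)\<^sup>2))"
    by simp
  then show ?thesis using l by (simp add: LI)
qed

lemma bounded_set_integrable:
  fixes f :: "real \<Rightarrow> real"
  assumes "f \<in> borel_measurable borel" "\<And>t. \<bar>f t\<bar> \<le> C"
  shows "set_integrable lborel {a..b} f"
  unfolding set_integrable_def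
  by (rule integrableI_bounded_set_indicator[where B=C]) (use assms in \<open>auto simp: emeasure_lborel_Icc_eq\<close>)

lemma set_integral_split:
  fixes f :: "real \<Rightarrow> real"
  assumes "set_integrable lborel {a..c} f" "a \<le> b" "b \<le> c"
  shows "(LINT x:{a..c}|lborel. f x) = (LINT x:{a..b}|lborel. f x) + (LINT x:{b..c}|lborel. f x)"
proof -
  have *: "{a..c} = {a..b} \<union> {b..c}" using assms by auto
  show ?thesis unfolding *
  proof (rule set_integral_Un_AE)
    show "AE x in lborel. \<not> (x \<in> {a..b} \<and> x \<in> {b..c})"
      using AE_lborel_singleton[of b] by eventually_elim auto
  qed (use assms in \<open>auto intro: set_integrable_subset\<close>)
qed

lemma set_integral_affine_real:
  fixes f :: "real \<Rightarrow> real"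
  shows "(LINT x:{a..b}|lborel. f (x + c)) = (LINT x:{a+c..b+c}|lborel. f x)"
    and "(LINT x:{a..b}|lborel. f (c - x)) = (LINT x:{c-b..c-a}|lborel. f x)"
proof -
  have "(LINT x:{a+c..b+c}|lborel. f x) = (LINT x|lborel. indicator {a+c..b+c} (c + 1 * x) *\<^sub>R f (c + 1 * x))"
    unfolding set_lebesgue_integral_def by (subst lborel_integral_real_affine[of 1 _ c]) auto
  then show "(LINT x:{a..b}|lborel. f (x + c)) = (LINT x:{a+c..b+c}|lborel. f x)"
    unfolding set_lebesgue_integral_def
    by (simp, intro Bochner_Integration.integral_cong) (auto simp: add.commute split: split_indicator)
  have "(LINT x:{c-b..c-a}|lborel. f x) = (LINT x|lborel. indicator {c-b..c-a} (c + (-1) * x) *\<^sub>R f (c + (-1) * x))"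
    unfolding set_lebesgue_integral_def by (subst lborel_integral_real_affine[of "-1" _ c]) auto
  then show "(LINT x:{a..b}|lborel. f (c - x)) = (LINT x:{c-b..c-a}|lborel. f x)"
    unfolding set_lebesgue_integral_def
    by (simp, intro Bochner_Integration.integral_cong) (auto split: split_indicator)
qed

lemma increment_square_bound:
  fixes B :: "real \<Rightarrow> real"
  assumes B: "B \<in> borel_measurable borel" "\<And>t. \<bar>B t\<bar> \<le> K" and xy: "x \<le> y" and sub: "a \<le> x" "y \<le> b"
  shows "(LINT t:{x..y}|lborel. B t)\<^sup>2 \<le> (y - x) * (LINT t:{a..b}|lborel. (B t)\<^sup>2)"
proof (cases "x = y")
  case True
  have "(LINT t:{x..y}|lborel. B t) = (LINT t|lborel. 0 * B t)"
    unfolding set_lebesgue_integral_def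
  proof (rule integral_cong_AE)
    show "AE t in lborel. indicat_real {x..y} t *\<^sub>R B t = 0 * B t"
      using AE_lborel_singleton[of x] by eventually_elim (auto simp: True indicator_def)
  qed (use B(1) in measurable)
  then show ?thesis using True by simp
next
  case False
  have Bsq: "set_integrable lborel {c..d} (\<lambda>t. (B t)\<^sup>2)" for c d
    by (rule bounded_set_integrable[where C="K\<^sup>2"]) (use B in \<open>auto intro!: abs_square_le\<close>)
  define J where "J = restrict_space lborel {x..y}"
  have LJ: "(LINT t|J. f t) = (LINT t:{x..y}|lborel. f t)" for f :: "real \<Rightarrow> real"
    by (simp add: J_def integral_restrict_space set_lebesgue_integral_def)
  have iJ: "integrable J f \<longleftrightarrow> set_integrable lborel {x..y} f" for f :: "real \<Rightarrow> real"
    by (simp add: J_def integrable_restrict_space set_integrable_def)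
  have "(LINT t|J. B t)\<^sup>2 \<le> (y - x) * (LINT t|J. (B t)\<^sup>2 / 1)"
  proof (rule weighted_cauchy_schwarz)
    show "integrable J (\<lambda>t. 1::real)"
      using bounded_set_integrable[of "\<lambda>_. 1" 1 x y] by (simp only: iJ) simp
    show "integrable J B" using bounded_set_integrable[OF B] by (simp only: iJ)
    show "integrable J (\<lambda>t. (B t)\<^sup>2 / 1)" using Bsq by (simp only: iJ div_by_1)
    show "(LINT t|J. 1) \<le> y - x" using xy unfolding LJ by (simp add: set_lebesgue_integral_def)
  qed (use xy False in auto)
  also have "(LINT t|J. (B t)\<^sup>2 / 1) \<le> (LINT t:{a..b}|lborel. (B t)\<^sup>2)"
    unfolding LJ set_lebesgue_integral_def using Bsq[of x y] Bsq[of a b] sub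
    by (intro integral_mono) (auto simp: set_integrable_def split: split_indicator)
  finally show ?thesis using xy by (simp add: LJ mult_left_mono)
qed

lemma continuous_of_increments:
  fixes u B :: "real \<Rightarrow> real"
  assumes B: "B \<in> borel_measurable borel" "\<And>t. \<bar>B t\<bar> \<le> K"
    and inc: "\<And>x y. a \<le> x \<Longrightarrow> x \<le> y \<Longrightarrow> y \<le> b \<Longrightarrow> u y - u x = (LINT t:{x..y}|lborel. B t)"
  shows "continuous_on {a..b} u"
proof -
  have *: "dist (u y) (u x) \<le> K * dist y x" if "a \<le> x" "x \<le> y" "y \<le> b" for x y
  proof -
    have "\<bar>LINT t:{x..y}|lborel. B t\<bar> \<le> (LINT t:{x..y}|lborel. K)"
      unfolding set_lebesgue_integral_def real_norm_def[symmetric]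
    proof (rule order_trans[OF integral_norm_bound integral_mono])
      show "integrable lborel (\<lambda>t. norm (indicat_real {x..y} t *\<^sub>R B t))"
        using bounded_set_integrable[OF B, of x y] unfolding set_integrable_def by (rule integrable_norm)
      show "integrable lborel (\<lambda>t. indicat_real {x..y} t *\<^sub>R K)"
        using bounded_set_integrable[of "\<lambda>_. K" "\<bar>K\<bar>" x y] by (simp add: set_integrable_def)
    qed (use B(2) in \<open>auto split: split_indicator\<close>)
    then show ?thesis using that inc[of x y] by (simp add: dist_real_def set_lebesgue_integral_def mult.commute)
  qed
  have K: "0 \<le> K" using B(2)[of 0] by linarith
  have "K-lipschitz_on {a..b} u"
    using K * by (intro lipschitz_onI) (metis atLeastAtMost_iff dist_commute linear)
  then show ?thesis by (rule lipschitz_on_continuous_on)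
qed

text \<open>A function on a circle of length 3 is split into its even and odd parts about the point 0. The even
part satisfies the Neumann inequality on half of the circle, with constant
\<open>23/216 (3/2)\<^sup>2 \<le> 9/32\<close>. The odd part vanishes at 0 and at the antipodal point \<open>3/2\<close>; integrating
\<open>d(x)\<^sup>2 \<le> x \<integral> B\<^sup>2\<close> over a quarter of the circle gives the constant \<open>(3/4)\<^sup>2 / 2 = 9/32\<close>.\<close>

lemma circle_inequality:
  fixes u B :: "real \<Rightarrow> real"
  assumes B[measurable]: "B \<in> borel_measurable borel" and BK: "\<And>t. \<bar>B t\<bar> \<le> K"
    and inc: "\<And>x y. 0 \<le> x \<Longrightarrow> x \<le> y \<Longrightarrow> y \<le> 3 \<Longrightarrow> u y - u x = (LINT t:{x..y}|lborel. B t)"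
    and periodic: "u 3 = u 0"
  shows "\<exists>m. (LINT x:{0..3}|lborel. (u x - m)\<^sup>2) \<le> 9/32 * (LINT t:{0..3}|lborel. (B t)\<^sup>2)"
proof -
  define e d where "e = (\<lambda>x. (u x + u (3 - x)) / 2)" and "d = (\<lambda>x. (u x - u (3 - x)) / 2)"
  (* B (3 - x) enters with the opposite sign in the derivative of the even part. *)
  define Be Bd where "Be = (\<lambda>x. (B x - B (3 - x)) / 2)" and "Bd = (\<lambda>x. (B x + B (3 - x)) / 2)"
  have BeK: "\<bar>Be t\<bar> \<le> K" and BdK: "\<bar>Bd t\<bar> \<le> K" for t
    using BK[of t] BK[of "3 - t"] by (auto simp: Be_def Bd_def)
  have [measurable]: "Be \<in> borel_measurable borel" "Bd \<in> borel_measurable borel"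
    by (simp_all add: Be_def Bd_def)
  have Bi: "set_integrable lborel {a..b} B" "set_integrable lborel {a..b} (\<lambda>t. B (3 - t))" for a b
    using BK by (auto intro!: bounded_set_integrable)
  have ince: "e y - e x = (LINT t:{x..y}|lborel. Be t)" and incd: "d y - d x = (LINT t:{x..y}|lborel. Bd t)"
    if "0 \<le> x" "x \<le> y" "y \<le> 3" for x y
  proof -
    have "u (3 - x) - u (3 - y) = (LINT t:{x..y}|lborel. B (3 - t))"
      using that by (simp add: inc set_integral_affine_real)
    moreover have "u y - u x = (LINT t:{x..y}|lborel. B t)" using that inc by simp
    ultimately show "e y - e x = (LINT t:{x..y}|lborel. Be t)" "d y - d x = (LINT t:{x..y}|lborel. Bd t)"
      unfolding Be_def Bd_def e_def d_def using Bi[of x y] by (simp_all add: field_simps)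
  qed
  have cu: "continuous_on {0..3} u" using continuous_of_increments[OF B BK inc] .
  have ce: "continuous_on {0..3/2} e" by (rule continuous_of_increments[of Be K]) (auto simp: BeK ince)
  have cd: "continuous_on {0..3/2} d" by (rule continuous_of_increments[of Bd K]) (auto simp: BdK incd)
  define m where "m = (LINT x:{0..3/2}|lborel. e x) / (3/2)"
  have even: "(LINT x:{0..3/2}|lborel. (e x - m)\<^sup>2) \<le> 9/32 * (LINT t:{0..3/2}|lborel. (Be t)\<^sup>2)"
  proof -
    have "(LINT x:{0..3/2}|lborel. (e x - m)\<^sup>2) \<le> 23/216 * (3/2)\<^sup>2 * (LINT t:{0..3/2}|lborel. (Be t)\<^sup>2)"
      unfolding m_def by (rule neumann_inequality[of "3/2" Be K]) (auto simp: BeK ince ce)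
    also have "\<dots> \<le> 9/32 * (LINT t:{0..3/2}|lborel. (Be t)\<^sup>2)"
      by (intro mult_right_mono) (auto simp: power2_eq_square set_lebesgue_integral_def)
    finally show ?thesis .
  qed
  have id: "(LINT x:{a..b}|lborel. x - c) = ((b - c)\<^sup>2 - (a - c)\<^sup>2) / 2" if "a \<le> b" for a b c :: real
    unfolding diff_divide_distrib using that
    by (intro integral_interval_FTC) (auto intro!: derivative_eq_intros continuous_intros)
  have d0: "d 0 = 0" "d (3/2) = 0" using periodic by (auto simp: d_def)
  have cd2: "set_integrable lborel {a..b} (\<lambda>x. (d x)\<^sup>2)" if "0 \<le> a" "b \<le> 3/2" for a b
    using cd that by (intro borel_integrable_atLeastAtMost' continuous_intros) (auto intro: continuous_on_subset)
  have odd1: "(LINT x:{0..3/4}|lborel. (d x)\<^sup>2) \<le> 9/32 * (LINT t:{0..3/4}|lborel. (Bd t)\<^sup>2)" (is "_ \<le> _ * ?R")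
  proof -
    have "(LINT x:{0..3/4}|lborel. (d x)\<^sup>2) \<le> (LINT x:{0..3/4}|lborel. (x - 0) * ?R)"
    proof (intro set_integral_mono cd2)
      show "set_integrable lborel {0..3/4} (\<lambda>x. (x - 0) * ?R)"
        by (intro borel_integrable_atLeastAtMost' continuous_intros)
      fix x :: real assume "x \<in> {0..3/4}"
      then show "(d x)\<^sup>2 \<le> (x - 0) * ?R"
        using increment_square_bound[of Bd K 0 x 0 "3/4"] incd[of 0 x] d0 BdK by simp
    qed auto
    also have "\<dots> = 9/32 * ?R"
      by (simp only: set_integral_mult_left id) (simp add: power2_eq_square)
    finally show ?thesis .
  qed
  have odd2: "(LINT x:{3/4..3/2}|lborel. (d x)\<^sup>2) \<le> 9/32 * (LINT t:{3/4..3/2}|lborel. (Bd t)\<^sup>2)" (is "_ \<le> _ * ?R")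
  proof -
    have "(LINT x:{3/4..3/2}|lborel. (d x)\<^sup>2) \<le> (LINT x:{3/4..3/2}|lborel. (x - 3/2) * (- ?R))"
    proof (intro set_integral_mono cd2)
      show "set_integrable lborel {3/4..3/2} (\<lambda>x. (x - 3/2) * (- ?R))"
        by (intro borel_integrable_atLeastAtMost' continuous_intros)
      fix x :: real assume "x \<in> {3/4..3/2}"
      moreover from this have "d x = - (LINT t:{x..3/2}|lborel. Bd t)"
        using incd[of x "3/2"] d0 by simp
      ultimately have "(d x)\<^sup>2 \<le> (3/2 - x) * ?R"
        using increment_square_bound[of Bd K x "3/2" "3/4" "3/2"] BdK by simp
      then show "(d x)\<^sup>2 \<le> (x - 3/2) * (- ?R)" by (simp add: algebra_simps)
    qed auto
    also have "\<dots> = 9/32 * ?R"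
      by (simp only: set_integral_mult_left id) (simp add: power2_eq_square)
    finally show ?thesis .
  qed
  have Bd2: "set_integrable lborel {a..b} (\<lambda>x. (Bd x)\<^sup>2)" "set_integrable lborel {a..b} (\<lambda>x. (Be x)\<^sup>2)"
    "set_integrable lborel {a..b} (\<lambda>x. (B x)\<^sup>2)" "set_integrable lborel {a..b} (\<lambda>x. (B (3 - x))\<^sup>2)" for a b
    using BdK BeK BK
    by (auto intro!: bounded_set_integrable[where C="K\<^sup>2"] abs_square_le)
  have odd: "(LINT x:{0..3/2}|lborel. (d x)\<^sup>2) \<le> 9/32 * (LINT t:{0..3/2}|lborel. (Bd t)\<^sup>2)"
    using odd1 odd2 set_integral_split[OF cd2[of 0 "3/2"], of "3/4"] set_integral_split[OF Bd2(1)[of 0 "3/2"], of "3/4"]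
    by simp
  have fold: "(LINT x:{0..3}|lborel. f x) = (LINT x:{0..3/2}|lborel. f x + f (3 - x))"
    if "set_integrable lborel {0..3} f" "set_integrable lborel {0..3/2} (\<lambda>x. f (3 - x))" for f :: "real \<Rightarrow> real"
  proof -
    have "(LINT x:{0..3/2}|lborel. f (3 - x)) = (LINT x:{3/2..3}|lborel. f x)"
      using set_integral_affine_real(2)[of 0 "3/2" f 3] by simp
    moreover have "set_integrable lborel {0..3/2} f" using that(1) by (rule set_integrable_subset) auto
    ultimately show ?thesis using set_integral_split[OF that(1), of "3/2"] that(2) by simp
  qed
  have ie: "set_integrable lborel {0..3/2} (\<lambda>x. (e x - m)\<^sup>2)"
    using ce by (intro borel_integrable_atLeastAtMost' continuous_intros) auto
  have "(LINT x:{0..3}|lborel. (u x - m)\<^sup>2) = (LINT x:{0..3/2}|lborel. (u x - m)\<^sup>2 + (u (3 - x) - m)\<^sup>2)"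
  proof (rule fold)
    show "set_integrable lborel {0..3} (\<lambda>x. (u x - m)\<^sup>2)"
      using cu by (intro borel_integrable_atLeastAtMost' continuous_intros)
    show "set_integrable lborel {0..3/2} (\<lambda>x. (u (3 - x) - m)\<^sup>2)"
      by (intro borel_integrable_atLeastAtMost' continuous_intros continuous_on_compose2[OF cu]) auto
  qed
  also have "\<dots> = (LINT x:{0..3/2}|lborel. 2 * ((e x - m)\<^sup>2 + (d x)\<^sup>2))"
    by (intro set_lebesgue_integral_cong) (auto simp: e_def d_def power2_eq_square field_simps)
  also have "\<dots> = 2 * ((LINT x:{0..3/2}|lborel. (e x - m)\<^sup>2) + (LINT x:{0..3/2}|lborel. (d x)\<^sup>2))"
    using ie cd2[of 0 "3/2"] by simp
  also have "\<dots> \<le> 9/32 * (2 * ((LINT x:{0..3/2}|lborel. (Be x)\<^sup>2) + (LINT x:{0..3/2}|lborel. (Bd x)\<^sup>2)))"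
    using even odd by (simp add: algebra_simps)
  also have "2 * ((LINT x:{0..3/2}|lborel. (Be x)\<^sup>2) + (LINT x:{0..3/2}|lborel. (Bd x)\<^sup>2)) =
     (LINT x:{0..3/2}|lborel. 2 * ((Be x)\<^sup>2 + (Bd x)\<^sup>2))"
    using Bd2[of 0 "3/2"] by simp
  also have "\<dots> = (LINT x:{0..3/2}|lborel. (B x)\<^sup>2 + (B (3 - x))\<^sup>2)"
    by (intro set_lebesgue_integral_cong) (auto simp: Be_def Bd_def power2_eq_square field_simps)
  also have "\<dots> = (LINT x:{0..3}|lborel. (B x)\<^sup>2)"
    by (rule fold[symmetric]) (rule Bd2)+
  finally show ?thesis by blast
qed

text \<open>Three functions on the unit interval whose end values match cyclically are one function on a circle
of length 3. The three rectangles of the unfolded triangle supply such functions.\<close>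

theorem three_arc_inequality:
  fixes A B :: "nat \<Rightarrow> real \<Rightarrow> real"
  assumes B[measurable]: "\<And>i. B i \<in> borel_measurable borel" and BK: "\<And>i t. \<bar>B i t\<bar> \<le> K"
    and inc: "\<And>i x y. i < 3 \<Longrightarrow> 0 \<le> x \<Longrightarrow> x \<le> y \<Longrightarrow> y \<le> 1 \<Longrightarrow> A i y - A i x = (LINT t:{x..y}|lborel. B i t)"
    and glue: "A 0 1 = A 1 0" "A 1 1 = A 2 0" "A 2 1 = A 0 0"
  shows "\<exists>m. (\<Sum>i<3. LINT x:{0..1}|lborel. (A i x - m)\<^sup>2) \<le> 9/32 * (\<Sum>i<3. LINT t:{0..1}|lborel. (B i t)\<^sup>2)"
proof -
  define C where "C = (\<lambda>x. if x < 1 then B 0 x else if x < 2 then B 1 (x - 1) else B 2 (x - 2))"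
  define u where "u = (\<lambda>x. A 0 0 + (LINT t:{0..x}|lborel. C t))"
  have [measurable]: "C \<in> borel_measurable borel" unfolding C_def by measurable
  have CK: "\<bar>C t\<bar> \<le> K" for t using BK by (simp add: C_def)
  have Ci: "set_integrable lborel {a..b} C" for a b using CK by (intro bounded_set_integrable) auto
  have piece: "(LINT t:{real i + x..real i + y}|lborel. f (C t)) = (LINT t:{x..y}|lborel. f (B i t))"
    if "i < 3" "0 \<le> x" "x \<le> y" "y \<le> 1" and [measurable]: "f \<in> borel_measurable borel" for i x y and f :: "real \<Rightarrow> real"
  proof -
    have "(LINT t:{x..y}|lborel. f (B i t)) = (LINT t:{x..y}|lborel. f (C (t + real i)))"
      unfolding set_lebesgue_integral_def
    proof (rule integral_cong_AE)
      have "AE t in lborel. t \<noteq> (1::real)" by (simp add: AE_lborel_singleton)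
      then show "AE t in lborel. indicat_real {x..y} t *\<^sub>R f (B i t) = indicat_real {x..y} t *\<^sub>R f (C (t + real i))"
      proof eventually_elim
        case (elim t)
        from \<open>i < 3\<close> have "i = 0 \<or> i = 1 \<or> i = 2" by linarith
        then show ?case using elim that by (elim disjE) (auto simp: C_def split: split_indicator)
      qed
    qed measurable
    then show ?thesis using set_integral_affine_real(1)[of x y "\<lambda>t. f (C t)" "real i"] by (simp add: add.commute)
  qed
  have incu: "u y - u x = (LINT t:{x..y}|lborel. C t)" if "0 \<le> x" "x \<le> y" for x y
    using set_integral_split[OF Ci[of 0 y], of x] that by (simp add: u_def)
  have u0: "u 0 = A 0 0" using increment_square_bound[of C K 0 0 0 0] CK by (simp add: u_def)
  (* u is the primitive of the concatenated derivative C; on the i-th arc it agrees with A i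
     as soon as it does so at the left end. *)
  have step: "u (real i + x) = A i x" if "i < 3" "0 \<le> x" "x \<le> 1" "u (real i) = A i 0" for i x
    using incu[of "real i" "real i + x"] piece[of i 0 x "\<lambda>x. x"] inc[of i 0 x] that by simp
  have u1: "u 1 = A 1 0" using step[of 0 1] u0 glue by simp
  have u2: "u 2 = A 2 0" using step[of 1 1] u1 glue by simp
  have u3: "u 3 = u 0" using step[of 2 1] u0 u2 glue by simp
  have ui: "u (real i) = A i 0" if "i < 3" for i
  proof -
    from \<open>i < 3\<close> have "i = 0 \<or> i = 1 \<or> i = 2" by linarith
    then show ?thesis using u0 u1 u2 by auto
  qed
  have cu: "continuous_on {0..3} u" by (rule continuous_of_increments[of C K]) (auto simp: CK incu)
  have split3: "(LINT x:{0..3}|lborel. f x) = (\<Sum>i<3. LINT x:{real i + 0..real i + 1}|lborel. f x)"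
    if "set_integrable lborel {0..3} f" for f :: "real \<Rightarrow> real"
    using set_integral_split[OF that, of 1] set_integral_split[OF set_integrable_subset[OF that], of 1 3 2]
    by (simp add: eval_nat_numeral)
  obtain m where m: "(LINT x:{0..3}|lborel. (u x - m)\<^sup>2) \<le> 9/32 * (LINT t:{0..3}|lborel. (C t)\<^sup>2)"
    using circle_inequality[of C K u] CK incu u3 by auto
  have "(LINT x:{0..3}|lborel. (u x - m)\<^sup>2) = (\<Sum>i<3. LINT x:{real i + 0..real i + 1}|lborel. (u x - m)\<^sup>2)"
    using cu by (intro split3 borel_integrable_atLeastAtMost' continuous_intros)
  also have "\<dots> = (\<Sum>i<3. LINT x:{0..1}|lborel. (A i x - m)\<^sup>2)"
  proof (intro sum.cong refl)
    fix i :: nat assume "i \<in> {..<3}"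
    then have "(LINT x:{0..1}|lborel. (u (x + real i) - m)\<^sup>2) = (LINT x:{0..1}|lborel. (A i x - m)\<^sup>2)"
      using step[of i] ui[of i] by (intro set_lebesgue_integral_cong) (auto simp: add.commute)
    then show "(LINT x:{real i + 0..real i + 1}|lborel. (u x - m)\<^sup>2) = (LINT x:{0..1}|lborel. (A i x - m)\<^sup>2)"
      using set_integral_affine_real(1)[of 0 1 "\<lambda>x. (u x - m)\<^sup>2" "real i"] by (simp add: add.commute)
  qed
  finally have "(LINT x:{0..3}|lborel. (u x - m)\<^sup>2) = \<dots>" .
  moreover have "(LINT x:{0..3}|lborel. (C x)\<^sup>2) = (\<Sum>i<3. LINT x:{real i + 0..real i + 1}|lborel. (C x)\<^sup>2)"
    using CK by (intro split3 bounded_set_integrable[where C="K\<^sup>2"]) (auto intro!: abs_square_le)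
  moreover have "\<dots> = (\<Sum>i<3. LINT x:{0..1}|lborel. (B i x)\<^sup>2)"
    using piece[of _ 0 1 "\<lambda>x. x\<^sup>2"] by (intro sum.cong refl) simp
  ultimately show ?thesis using m by auto
qed

section \<open>Unfolding a triangle into rectangles\<close>

definition cross2 :: "real^2 \<Rightarrow> real^2 \<Rightarrow> real" where
  "cross2 u v = u $ 1 * v $ 2 - u $ 2 * v $ 1"

text \<open>The change of variables as an identity of measures, which transfers integrals of arbitrary Borel
functions; it comes from the formula for the measure of
a linear image, applied to preimages of boxes.\<close>

lemma lborel_linear_plane:
  fixes L :: "real^2 \<Rightarrow> real^2"
  assumes L: "linear L" and d: "det (matrix L) \<noteq> 0"
  shows "lborel = density (distr lborel borel L) (\<lambda>_. ennreal \<bar>det (matrix L)\<bar>)"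
proof (rule lborel_eqI)
  have cL: "continuous_on UNIV L" using L by (simp add: linear_continuous_on linear_conv_bounded_linear)
  then have [measurable]: "L \<in> borel_measurable borel" by (rule borel_measurable_continuous_onI)
  obtain L' where L': "linear L'" "\<And>x. L' (L x) = x" "\<And>x. L (L' x) = x"
    using det_nz_iff_inj[OF L] d linear_injective_isomorphism[OF L] by auto
  fix l u :: "real^2" assume lu: "\<And>b. b \<in> Basis \<Longrightarrow> l \<bullet> b \<le> u \<bullet> b"
  let ?V = "L -` box l u"
  have V: "?V = L' ` box l u" using L' by (auto simp: image_iff) metis
  have bV: "bounded ?V" unfolding V
    by (intro bounded_linear_image bounded_box) (use L' in \<open>simp add: linear_conv_bounded_linear\<close>)
  have oV: "open ?V" by (rule open_vimage[OF open_box cL])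
  have lm: "?V \<in> lmeasurable" using bV oV by (simp add: lmeasurable_open)
  have "measure lebesgue (L ` ?V) = \<bar>det (matrix L)\<bar> * measure lebesgue ?V"
    by (rule measure_linear_image[OF L lm])
  moreover have "L ` ?V = box l u" using L' by (auto simp: image_iff) metis
  ultimately have m: "measure lborel (box l u) = \<bar>det (matrix L)\<bar> * measure lborel ?V"
    using oV by (simp add: measure_completion)
  have fV: "emeasure lborel ?V = measure lborel ?V"
    using emeasure_bounded_finite[OF bV] by (intro emeasure_eq_ennreal_measure) simp
  have "emeasure (density (distr lborel borel L) (\<lambda>_. ennreal \<bar>det (matrix L)\<bar>)) (box l u) =
      ennreal \<bar>det (matrix L)\<bar> * emeasure lborel ?V"
    by (simp add: emeasure_density_const emeasure_distr)
  also have "\<dots> = measure lborel (box l u)"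
    unfolding fV m by (simp add: ennreal_mult)
  also have "\<dots> = (\<Prod>b\<in>Basis. (u - l) \<bullet> b)"
    using lu by (simp add: measure_lborel_box_eq)
  finally show "emeasure (density (distr lborel borel L) (\<lambda>_. ennreal \<bar>det (matrix L)\<bar>)) (box l u) = (\<Prod>b\<in>Basis. (u - l) \<bullet> b)" .
qed simp

lemma lborel_plane_coordinates:
  "(lborel :: (real^2) measure) = distr (lborel \<Otimes>\<^sub>M lborel) borel (\<lambda>p. vector [fst p, snd p])"
proof (rule lborel_eqI)
  have vm: "(\<lambda>p. vector [fst p, snd p] :: real^2) = (\<lambda>p. fst p *\<^sub>R axis 1 1 + snd p *\<^sub>R axis 2 1)"
    by (auto simp: fun_eq_iff vec_eq_iff forall_2 axis_def)
  have [measurable]: "(\<lambda>p. vector [fst p, snd p] :: real^2) \<in> borel_measurable (lborel \<Otimes>\<^sub>M lborel)"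
    unfolding vm by measurable
  fix l u :: "real^2" assume lu: "\<And>b. b \<in> Basis \<Longrightarrow> l \<bullet> b \<le> u \<bullet> b"
  then have lu': "l $ 1 \<le> u $ 1" "l $ 2 \<le> u $ 2"
    using lu[of "axis 1 1"] lu[of "axis 2 1"] axis_in_Basis_iff by (auto simp: inner_axis)
  have pre: "(\<lambda>p. vector [fst p, snd p] :: real^2) -` box l u \<inter> space (lborel \<Otimes>\<^sub>M lborel)
      = {l$1<..<u$1} \<times> {l$2<..<u$2}"
    by (auto simp: box_def Basis_vec_def forall_2 inner_axis space_pair_measure)
  have B: "(Basis :: (real^2) set) = {axis 1 1, axis 2 1}"
    by (auto simp: Basis_vec_def UNIV_2)
  have ne: "axis 1 1 \<noteq> (axis 2 1 :: real^2)" by (simp add: axis_eq_axis)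
  have "emeasure (distr (lborel \<Otimes>\<^sub>M lborel) borel (\<lambda>p. vector [fst p, snd p])) (box l u) =
     emeasure (lborel \<Otimes>\<^sub>M lborel) ({l$1<..<u$1} \<times> {l$2<..<u$2})"
    by (simp add: emeasure_distr pre)
  also have "\<dots> = ennreal (u$1 - l$1) * ennreal (u$2 - l$2)"
    using lu' by (subst lborel.emeasure_pair_measure_Times) auto
  also have "\<dots> = (\<Prod>b\<in>Basis. (u - l) \<bullet> b)"
    unfolding B using lu' ne by (simp add: inner_axis ennreal_mult)
  finally show "emeasure (distr (lborel \<Otimes>\<^sub>M lborel) borel (\<lambda>p. vector [fst p, snd p])) (box l u)
      = (\<Prod>b\<in>Basis. (u - l) \<bullet> b)" .
qed simp

lemma integral_affine_plane:
  fixes k :: "real^2 \<Rightarrow> real"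
  assumes [measurable]: "k \<in> borel_measurable borel" and d: "cross2 u v \<noteq> 0"
  shows "(LINT x|lborel. k x) = \<bar>cross2 u v\<bar> * (LINT p|(lborel \<Otimes>\<^sub>M lborel). k (q + fst p *\<^sub>R u + snd p *\<^sub>R v))"
    and "integrable lborel k \<longleftrightarrow> integrable (lborel \<Otimes>\<^sub>M lborel) (\<lambda>p. k (q + fst p *\<^sub>R u + snd p *\<^sub>R v))"
proof -
  define L where "L = (\<lambda>x::real^2. x $ 1 *\<^sub>R u + x $ 2 *\<^sub>R v)"
  have linL: "linear L" unfolding L_def by (intro linearI) (auto simp: algebra_simps)
  have cL: "continuous_on UNIV L" using linL by (simp add: linear_continuous_on linear_conv_bounded_linear)
  then have [measurable]: "L \<in> borel_measurable borel" by (rule borel_measurable_continuous_onI)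
  have detL: "det (matrix L) = cross2 u v"
    by (simp add: det_2 matrix_def L_def cross2_def axis_def)
  have vm: "(\<lambda>p. vector [fst p, snd p] :: real^2) = (\<lambda>p. fst p *\<^sub>R axis 1 1 + snd p *\<^sub>R axis 2 1)"
    by (auto simp: fun_eq_iff vec_eq_iff forall_2 axis_def)
  have [measurable]: "(\<lambda>p. vector [fst p, snd p] :: real^2) \<in> borel_measurable (lborel \<Otimes>\<^sub>M lborel)"
    unfolding vm by measurable
  have tr: "(LINT x|lborel. k x) = (LINT x|lborel. k (q + x))" "integrable lborel k \<longleftrightarrow> integrable lborel (\<lambda>x. k (q + x))"
    by (subst lborel_distr_plus[symmetric, of q], subst integral_distr integrable_distr_eq; simp)+
  have li: "(LINT x|lborel. k (q + x)) = \<bar>cross2 u v\<bar> * (LINT x|lborel. k (q + L x))"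
    "integrable lborel (\<lambda>x. k (q + x)) \<longleftrightarrow> integrable lborel (\<lambda>x. k (q + L x))"
    using d unfolding detL[symmetric]
    by (subst lborel_linear_plane[OF linL], simp, subst integral_density integrable_density; simp add: integral_distr integrable_distr_eq)+
  have co: "(LINT x|lborel. k (q + L x)) = (LINT p|(lborel \<Otimes>\<^sub>M lborel). k (q + L (vector [fst p, snd p])))"
     "integrable lborel (\<lambda>x. k (q + L x)) \<longleftrightarrow> integrable (lborel \<Otimes>\<^sub>M lborel) (\<lambda>p. k (q + L (vector [fst p, snd p])))"
    by (subst lborel_plane_coordinates, subst integral_distr integrable_distr_eq; simp)+
  have L2: "L (vector [s, t]) = s *\<^sub>R u + t *\<^sub>R v" for s t by (simp add: L_def)
  show "(LINT x|lborel. k x) = \<bar>cross2 u v\<bar> * (LINT p|(lborel \<Otimes>\<^sub>M lborel). k (q + fst p *\<^sub>R u + snd p *\<^sub>R v))"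
    "integrable lborel k \<longleftrightarrow> integrable (lborel \<Otimes>\<^sub>M lborel) (\<lambda>p. k (q + fst p *\<^sub>R u + snd p *\<^sub>R v))"
    using tr li co by (simp_all add: L2 add.assoc)
qed

text \<open>The unit square stands for a rectangle with \<open>a\<close> and \<open>c\<close> at opposite corners, cut along this diagonal.
The part \<open>y \<le> s\<close> is mapped affinely to the half of the triangle \<open>a, b, c\<close> between \<open>a\<close>, the midpoint of
\<open>a b\<close> and \<open>c\<close>, and the part \<open>s \<le> y\<close> to the half between \<open>a\<close>, \<open>c\<close> and the midpoint of \<open>b c\<close>. On the
diagonal both maps run along the edge \<open>a c\<close>. For an equilateral triangle the square is one rectangle of
the strip, and the reflection across \<open>a c\<close> folds its second half back into the triangle.\<close>

definition lower_fold :: "real^2 \<Rightarrow> real^2 \<Rightarrow> real^2 \<Rightarrow> real \<Rightarrow> real \<Rightarrow> real^2" where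
  "lower_fold a b c s y = (1 - (s + y) / 2) *\<^sub>R a + ((s - y) / 2) *\<^sub>R b + y *\<^sub>R c"

definition upper_fold :: "real^2 \<Rightarrow> real^2 \<Rightarrow> real^2 \<Rightarrow> real \<Rightarrow> real \<Rightarrow> real^2" where
  "upper_fold a b c s y = (1 - y) *\<^sub>R a + ((y - s) / 2) *\<^sub>R b + ((y + s) / 2) *\<^sub>R c"

lemma fold_in_triangle:
  assumes "0 \<le> s" "s \<le> 1" "0 \<le> y" "y \<le> 1"
  shows "y \<le> s \<Longrightarrow> lower_fold a b c s y \<in> convex hull {a, b, c}"
    and "s \<le> y \<Longrightarrow> upper_fold a b c s y \<in> convex hull {a, b, c}"
proof -
  show "y \<le> s \<Longrightarrow> lower_fold a b c s y \<in> convex hull {a, b, c}"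
    unfolding convex_hull_3 lower_fold_def mem_Collect_eq using assms
    by (intro exI[of _ "1 - (s + y) / 2"] exI[of _ "(s - y) / 2"] exI[of _ y]) (auto simp: field_simps)
  show "s \<le> y \<Longrightarrow> upper_fold a b c s y \<in> convex hull {a, b, c}"
    unfolding convex_hull_3 upper_fold_def mem_Collect_eq using assms
    by (intro exI[of _ "1 - y"] exI[of _ "(y - s) / 2"] exI[of _ "(y + s) / 2"]) (auto simp: field_simps)
qed

text \<open>Coordinates with the origin at the midpoint of \<open>a b\<close>, along the edge and along the median to \<open>c\<close>.
The two halves of the triangle are \<open>t \<ge> 0\<close> and \<open>t \<le> 0\<close>.\<close>

lemma triangle_coordinates:
  assumes d: "cross2 (b - a) (c - a) \<noteq> 0"
  shows "(a + b) /\<^sub>R 2 + t *\<^sub>R ((a - b) /\<^sub>R 2) + y *\<^sub>R (c - (a + b) /\<^sub>R 2) \<in> convex hull {a, b, c} \<longleftrightarrow> \<bar>t\<bar> \<le> 1 - y \<and> 0 \<le> y"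
proof
  assume "\<bar>t\<bar> \<le> 1 - y \<and> 0 \<le> y"
  then show "(a + b) /\<^sub>R 2 + t *\<^sub>R ((a - b) /\<^sub>R 2) + y *\<^sub>R (c - (a + b) /\<^sub>R 2) \<in> convex hull {a, b, c}"
    unfolding convex_hull_3 mem_Collect_eq
    by (intro exI[of _ "(1 + t - y) / 2"] exI[of _ "(1 - t - y) / 2"] exI[of _ y])
       (auto simp: vec_eq_iff field_simps abs_le_iff)
next
  assume "(a + b) /\<^sub>R 2 + t *\<^sub>R ((a - b) /\<^sub>R 2) + y *\<^sub>R (c - (a + b) /\<^sub>R 2) \<in> convex hull {a, b, c}"
  then obtain p q r where pqr: "0 \<le> p" "0 \<le> q" "0 \<le> r" "p + q + r = 1"
    and e: "(a + b) /\<^sub>R 2 + t *\<^sub>R ((a - b) /\<^sub>R 2) + y *\<^sub>R (c - (a + b) /\<^sub>R 2) = p *\<^sub>R a + q *\<^sub>R b + r *\<^sub>R c"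
    unfolding convex_hull_3 by auto
  have p: "p = 1 - q - r" using pqr by simp
  define \<beta> where "\<beta> = (1 - t - y) / 2 - q"
  have e': "\<beta> *\<^sub>R (b - a) + (y - r) *\<^sub>R (c - a) = 0"
    using e unfolding p \<beta>_def by (simp add: vec_eq_iff field_simps)
  then have e1: "\<beta> * (b - a) $ 1 + (y - r) * (c - a) $ 1 = 0" and e2: "\<beta> * (b - a) $ 2 + (y - r) * (c - a) $ 2 = 0"
    by (metis vector_add_component vector_scaleR_component zero_index real_scaleR_def)+
  have "\<beta> * cross2 (b - a) (c - a) = (\<beta> * (b - a) $ 1 + (y - r) * (c - a) $ 1) * (c - a) $ 2 - (\<beta> * (b - a) $ 2 + (y - r) * (c - a) $ 2) * (c - a) $ 1"
    unfolding cross2_def by (simp add: algebra_simps)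
  then have "\<beta> = 0" using d unfolding e1 e2 by simp
  have "(y - r) * cross2 (b - a) (c - a) = (\<beta> * (b - a) $ 2 + (y - r) * (c - a) $ 2) * (b - a) $ 1 - (\<beta> * (b - a) $ 1 + (y - r) * (c - a) $ 1) * (b - a) $ 2"
    unfolding cross2_def by (simp add: algebra_simps)
  then have "y = r" using d unfolding e1 e2 by simp
  then show "\<bar>t\<bar> \<le> 1 - y \<and> 0 \<le> y" using \<open>\<beta> = 0\<close> pqr by (auto simp: \<beta>_def abs_le_iff)
qed

abbreviation UI :: "real measure" where "UI \<equiv> restrict_space lborel {0..1}"

lemma integral_UI: "(LINT s|UI. f s) = (LINT s:{0..1}|lborel. f s)" for f :: "real \<Rightarrow> real"
  by (simp add: integral_restrict_space set_lebesgue_integral_def)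

text \<open>The median from \<open>c\<close> cuts the triangle into two halves. One is the image of the lower part of the unit
square for the vertices in the order \<open>a, b, c\<close>, the other of the upper part for \<open>c, a, b\<close>. Both maps
have the area of the triangle as Jacobian. Applied to the three cyclic orders, this shows that the
three rectangles together contain almost every point of the triangle three times.\<close>

theorem integral_triangle_fold:
  fixes k :: "real^2 \<Rightarrow> real"
  assumes k[measurable]: "k \<in> borel_measurable borel" and kK: "\<And>x. x \<in> convex hull {a, b, c} \<Longrightarrow> \<bar>k x\<bar> \<le> K"
    and d: "cross2 (b - a) (c - a) \<noteq> 0"
  shows "(LINT x:convex hull {a, b, c}|lborel. k x) = \<bar>cross2 (b - a) (c - a)\<bar> / 2 *
     ((LINT s|UI. LINT y|UI. (if y \<le> s then k (lower_fold a b c s y) else 0)) +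
      (LINT s|UI. LINT y|UI. (if y \<le> s then 0 else k (upper_fold c a b s y))))"
proof -
  define T where "T = convex hull {a, b, c}"
  have cT: "compact T" unfolding T_def by (intro compact_convex_hull finite_imp_compact) simp
  then have [measurable]: "T \<in> sets borel" by (intro borel_closed compact_imp_closed)
  define kT where "kT = (\<lambda>x. indicator T x * k x)"
  have [measurable]: "kT \<in> borel_measurable borel" unfolding kT_def by measurable
  have ikT: "integrable lborel kT"
  proof -
    have "set_integrable lborel T k"
      unfolding set_integrable_def
      by (rule integrableI_bounded_set_indicator[where B=K])
         (use kK cT emeasure_bounded_finite[OF compact_imp_bounded[OF cT]] compact_imp_closed[OF cT]
           in \<open>auto simp: T_def intro!: AE_I2\<close>)
    then show ?thesis by (simp add: set_integrable_def kT_def)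
  qed
  define X where "X = (\<lambda>t y. (a + b) /\<^sub>R 2 + t *\<^sub>R ((a - b) /\<^sub>R 2) + y *\<^sub>R (c - (a + b) /\<^sub>R 2))"
  have XT: "X t y \<in> T \<longleftrightarrow> \<bar>t\<bar> \<le> 1 - y \<and> 0 \<le> y" for t y
    unfolding X_def T_def by (rule triangle_coordinates[OF d])
  have cr: "\<bar>cross2 ((a - b) /\<^sub>R 2) (c - (a + b) /\<^sub>R 2)\<bar> = \<bar>cross2 (b - a) (c - a)\<bar> / 2"
  proof -
    have "cross2 ((a - b) /\<^sub>R 2) (c - (a + b) /\<^sub>R 2) = - (cross2 (b - a) (c - a) / 2)"
      by (simp add: cross2_def field_simps)
    then show ?thesis by simp
  qed
  have d': "cross2 ((a - b) /\<^sub>R 2) (c - (a + b) /\<^sub>R 2) \<noteq> 0" using cr d by auto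
  have iX: "integrable (lborel \<Otimes>\<^sub>M lborel) (\<lambda>p. kT (X (fst p) (snd p)))"
    using integral_affine_plane(2)[OF _ d', of kT "(a + b) /\<^sub>R 2"] ikT by (simp add: X_def)
  define h where "h = (\<lambda>t. LINT y|lborel. kT (X t y))"
  have ih: "integrable lborel h"
    unfolding h_def using lborel_pair.integrable_fst[of "\<lambda>t y. kT (X t y)"] iX by (simp add: split_beta')
  have "(LINT x:T|lborel. k x) = (LINT x|lborel. kT x)" by (simp add: set_lebesgue_integral_def kT_def)
  also have "\<dots> = \<bar>cross2 (b - a) (c - a)\<bar> / 2 * (LINT p|(lborel \<Otimes>\<^sub>M lborel). kT (X (fst p) (snd p)))"
    unfolding X_def cr[symmetric] by (rule integral_affine_plane(1)[OF _ d']) measurable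
  also have "(LINT p|(lborel \<Otimes>\<^sub>M lborel). kT (X (fst p) (snd p))) = (LINT t|lborel. h t)"
    unfolding h_def using lborel_pair.integral_fst[of "\<lambda>t y. kT (X t y)"] iX by (simp add: split_beta')
  also have "(LINT t|lborel. h t) = (LINT t:{-1..1}|lborel. h t)"
    unfolding set_lebesgue_integral_def
  proof (intro Bochner_Integration.integral_cong refl)
    fix t :: real
    have "h t = 0" if "t \<notin> {-1..1}"
    proof -
      have "kT (X t y) = 0" for y using that XT[of t y] by (auto simp: kT_def indicator_def)
      then show ?thesis by (simp add: h_def)
    qed
    then show "h t = indicator {-1..1} t *\<^sub>R h t" by (auto simp: indicator_def)
  qed
  also have "\<dots> = (LINT t:{0..1}|lborel. h t) + (LINT t:{-1..0}|lborel. h t)"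
  proof -
    have "set_integrable lborel {-1..1} h"
      unfolding set_integrable_def using ih by (intro integrable_mult_indicator) auto
    then show ?thesis using set_integral_split[of "-1" 1 h 0] by simp
  qed
  also have "(LINT t:{0..1}|lborel. h t) = (LINT s|UI. h (1 - s))"
    using set_integral_affine_real(2)[of 0 1 h 1] by (simp add: integral_UI)
  also have "\<dots> = (LINT s|UI. LINT y|UI. (if y \<le> s then k (lower_fold a b c s y) else 0))"
  proof (intro Bochner_Integration.integral_cong refl)
    fix s assume "s \<in> space UI" then have s: "0 \<le> s" "s \<le> 1" by (auto simp: space_restrict_space)
    have eq: "X (1 - s) y = lower_fold a b c s y" for y
      by (simp add: X_def lower_fold_def vec_eq_iff field_simps)
    have in_T: "lower_fold a b c s y \<in> T \<longleftrightarrow> 0 \<le> y \<and> y \<le> s" for y using XT[of "1 - s" y] s by (auto simp: eq)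
    show "h (1 - s) = (LINT y|UI. (if y \<le> s then k (lower_fold a b c s y) else 0))"
      unfolding h_def eq integral_UI set_lebesgue_integral_def
      by (intro Bochner_Integration.integral_cong) (use in_T s in \<open>auto simp: kT_def indicator_def\<close>)
  qed
  also have "(LINT t:{-1..0}|lborel. h t) = (LINT s|UI. h (- s))"
    using set_integral_affine_real(2)[of 0 1 h 0] by (simp add: integral_UI)
  also have "\<dots> = (LINT s|UI. LINT y|UI. (if y \<le> s then 0 else k (upper_fold c a b s y)))"
  proof (intro Bochner_Integration.integral_cong refl)
    fix s assume "s \<in> space UI" then have s: "0 \<le> s" "s \<le> 1" by (auto simp: space_restrict_space)
    have eq: "X (- s) (1 - y) = upper_fold c a b s y" for y
      by (simp add: X_def upper_fold_def vec_eq_iff field_simps)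
    have in_T: "upper_fold c a b s y \<in> T \<longleftrightarrow> s \<le> y \<and> y \<le> 1" for y using XT[of "- s" "1 - y"] s by (auto simp: eq)
    have [measurable]: "(\<lambda>y. upper_fold c a b s y) \<in> borel_measurable borel"
      unfolding upper_fold_def by measurable
    have "h (- s) = (LINT y|lborel. kT (upper_fold c a b s y))"
      unfolding h_def eq[symmetric] using lborel_integral_real_affine[of "-1" "\<lambda>y. kT (X (- s) y)" 1] by simp
    also have "\<dots> = (LINT y|UI. (if y \<le> s then 0 else k (upper_fold c a b s y)))"
      unfolding integral_UI set_lebesgue_integral_def
    proof (rule integral_cong_AE)
      have "AE y in lborel. y \<noteq> s" by (simp add: AE_lborel_singleton)
      then show "AE y in lborel. kT (upper_fold c a b s y) = indicat_real {0..1} y *\<^sub>R (if y \<le> s then 0 else k (upper_fold c a b s y))"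
        by eventually_elim (use in_T s in \<open>auto simp: kT_def indicator_def\<close>)
    qed measurable
    finally show "h (- s) = (LINT y|UI. (if y \<le> s then 0 else k (upper_fold c a b s y)))" .
  qed
  finally show ?thesis by (simp add: T_def)
qed

section \<open>Poincare inequality for smooth functions on a triangle\<close>

lemma abs_diff_square_le: "\<bar>a\<bar> \<le> K \<Longrightarrow> (a - m)\<^sup>2 \<le> (K + \<bar>m\<bar>)\<^sup>2" for a K m :: real
  by (rule abs_square_le) linarith

lemma finite_measure_UI: "finite_measure UI"
  by (intro finite_measureI) (simp add: space_restrict_space emeasure_restrict_space)

lemma measure_UI: "measure UI (space UI) = 1" "measure UI {0..1} = 1"
  by (simp_all add: space_restrict_space measure_restrict_space)

lemma id_measurable_UI: "(\<lambda>x. x) \<in> UI \<rightarrow>\<^sub>M borel"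
  by (simp add: measurable_restrict_space1)

lemma measurable_UI_pair:
  fixes f :: "real \<Rightarrow> real \<Rightarrow> 'b::topological_space"
  assumes "(\<lambda>z. f (fst z) (snd z)) \<in> borel_measurable (borel \<Otimes>\<^sub>M borel)"
  shows "(\<lambda>z. f (fst z) (snd z)) \<in> borel_measurable (UI \<Otimes>\<^sub>M UI)"
proof -
  have "(\<lambda>z. z) \<in> UI \<Otimes>\<^sub>M UI \<rightarrow>\<^sub>M borel \<Otimes>\<^sub>M borel"
    using measurable_Pair[OF measurable_compose[OF measurable_fst id_measurable_UI] measurable_compose[OF measurable_snd id_measurable_UI]]
    by simp
  from measurable_compose[OF this assms] show ?thesis .
qed

text \<open>The exceptional point \<open>z\<close> is the place where a line through the square crosses the diagonal.\<close>

lemma increment_by_FTC: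
  fixes f f' :: "real \<Rightarrow> real"
  assumes "x \<le> y" "continuous_on {x..y} f"
    and "\<And>t. x < t \<Longrightarrow> t < y \<Longrightarrow> t \<noteq> z \<Longrightarrow> (f has_real_derivative f' t) (at t)"
    and "f' \<in> borel_measurable borel" and "\<And>t. \<bar>f' t\<bar> \<le> K"
  shows "f y - f x = (LINT t:{x..y}|lborel. f' t)"
proof -
  have "(f' has_integral (f y - f x)) {x..y}"
    by (rule fundamental_theorem_of_calculus_interior_strong[of "{z}"])
       (use assms in \<open>auto simp: has_real_derivative_iff_has_vector_derivative[symmetric]\<close>)
  moreover have "set_integrable lborel {x..y} f'" using assms by (intro bounded_set_integrable)
  ultimately show ?thesis using set_borel_integral_eq_integral(2) by (metis integral_unique)
qed

text \<open>A smooth function \<open>g\<close> with gradient \<open>P\<close>, pulled back to the unit square by the two folding maps. The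
pullback \<open>F\<close> is continuous with piecewise continuous partial derivatives: \<open>Dy\<close> differentiates \<open>g\<close>
along two medians of the triangle and \<open>Ds\<close> along two edges. The versions \<open>Dy0\<close> and \<open>Ds0\<close> are cut
off outside the square and therefore bounded on the whole plane. The average of \<open>F\<close> over a line
across the strip is \<open>A\<close>, and \<open>B\<close> is the derivative of \<open>A\<close>.\<close>

locale smooth_fold =
  fixes g :: "real^2 \<Rightarrow> real" and P :: "real^2 \<Rightarrow> real^2" and a b c :: "real^2"
  assumes dg: "\<And>x. (g has_derivative (\<lambda>v. P x \<bullet> v)) (at x)"
    and cP: "continuous_on UNIV P"
begin

definition "F s y = (if y \<le> s then g (lower_fold a b c s y) else g (upper_fold a b c s y))"
definition "Dy s y = (if y \<le> s then P (lower_fold a b c s y) \<bullet> (c - (a + b) /\<^sub>R 2)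
                      else P (upper_fold a b c s y) \<bullet> ((b + c) /\<^sub>R 2 - a))"
definition "Ds s y = (if y \<le> s then P (lower_fold a b c s y) \<bullet> ((b - a) /\<^sub>R 2)
                      else P (upper_fold a b c s y) \<bullet> ((c - b) /\<^sub>R 2))"
definition "unitsq s y \<longleftrightarrow> s \<in> {0..1::real} \<and> y \<in> {0..1::real}"
definition "Dy0 s y = (if unitsq s y then Dy s y else 0)"
definition "Ds0 s y = (if unitsq s y then Ds s y else 0)"
definition "A s = (LINT y|UI. F s y)"
definition "B s = (LINT y|UI. Ds0 s y)"

lemma cg: "continuous_on UNIV g"
  using dg has_derivative_continuous_on[of UNIV g "\<lambda>x v. P x \<bullet> v"] by simp

lemma fold_continuous: "continuous_on S (\<lambda>z. lower_fold a b c (f z) (h z))" "continuous_on S (\<lambda>z. upper_fold a b c (f z) (h z))"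
  if "continuous_on S f" "continuous_on S h" for S :: "'z::topological_space set"
  unfolding lower_fold_def upper_fold_def using that by (auto intro!: continuous_intros)

lemma lower_fold_affine:
  "lower_fold a b c s y = lower_fold a b c 0 y + s *\<^sub>R ((b - a) /\<^sub>R 2)"
  "lower_fold a b c s y = lower_fold a b c s 0 + y *\<^sub>R (c - (a + b) /\<^sub>R 2)"
  by (auto simp: lower_fold_def vec_eq_iff field_simps)

lemma upper_fold_affine:
  "upper_fold a b c s y = upper_fold a b c 0 y + s *\<^sub>R ((c - b) /\<^sub>R 2)"
  "upper_fold a b c s y = upper_fold a b c s 0 + y *\<^sub>R ((b + c) /\<^sub>R 2 - a)"
  by (auto simp: upper_fold_def vec_eq_iff field_simps)

lemma line_derivative: "((\<lambda>t. g (q + t *\<^sub>R v)) has_real_derivative P (q + t *\<^sub>R v) \<bullet> v) (at t)"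
proof -
  have "((\<lambda>t. q + t *\<^sub>R v) has_derivative (\<lambda>h. h *\<^sub>R v)) (at t)"
    by (auto intro!: derivative_eq_intros)
  from has_derivative_compose[OF this dg] show ?thesis
    by (simp add: has_field_derivative_def mult_commute_abs)
qed

lemma fold_derivative:
  "((\<lambda>s. g (lower_fold a b c s y)) has_real_derivative P (lower_fold a b c s y) \<bullet> ((b - a) /\<^sub>R 2)) (at s)"
  "((\<lambda>y. g (lower_fold a b c s y)) has_real_derivative P (lower_fold a b c s y) \<bullet> (c - (a + b) /\<^sub>R 2)) (at y)"
  "((\<lambda>s. g (upper_fold a b c s y)) has_real_derivative P (upper_fold a b c s y) \<bullet> ((c - b) /\<^sub>R 2)) (at s)"
  "((\<lambda>y. g (upper_fold a b c s y)) has_real_derivative P (upper_fold a b c s y) \<bullet> ((b + c) /\<^sub>R 2 - a)) (at y)"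
  using line_derivative[of "lower_fold a b c 0 y" "(b - a) /\<^sub>R 2" s] line_derivative[of "lower_fold a b c s 0" "c - (a + b) /\<^sub>R 2" y]
    line_derivative[of "upper_fold a b c 0 y" "(c - b) /\<^sub>R 2" s] line_derivative[of "upper_fold a b c s 0" "(b + c) /\<^sub>R 2 - a" y]
  by (simp_all only: lower_fold_affine[symmetric] upper_fold_affine[symmetric])

lemma folds_agree_on_diagonal: "lower_fold a b c s s = upper_fold a b c s s"
  by (simp add: lower_fold_def upper_fold_def)

lemma F_measurable[measurable]: "(\<lambda>z. F (fst z) (snd z)) \<in> borel_measurable (borel \<Otimes>\<^sub>M borel)"
  and Dy0_measurable[measurable]: "(\<lambda>z. Dy0 (fst z) (snd z)) \<in> borel_measurable (borel \<Otimes>\<^sub>M borel)"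
  and Ds0_measurable[measurable]: "(\<lambda>z. Ds0 (fst z) (snd z)) \<in> borel_measurable (borel \<Otimes>\<^sub>M borel)"
proof -
  have [measurable]: "g \<in> borel_measurable borel" "P \<in> borel_measurable borel"
    using cg cP by (auto intro: borel_measurable_continuous_onI)
  have [measurable]: "(\<lambda>z. lower_fold a b c (fst z) (snd z)) \<in> borel_measurable (borel \<Otimes>\<^sub>M borel)"
     "(\<lambda>z. upper_fold a b c (fst z) (snd z)) \<in> borel_measurable (borel \<Otimes>\<^sub>M borel)"
    unfolding lower_fold_def upper_fold_def by measurable
  show "(\<lambda>z. F (fst z) (snd z)) \<in> borel_measurable (borel \<Otimes>\<^sub>M borel)"
    "(\<lambda>z. Dy0 (fst z) (snd z)) \<in> borel_measurable (borel \<Otimes>\<^sub>M borel)"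
    "(\<lambda>z. Ds0 (fst z) (snd z)) \<in> borel_measurable (borel \<Otimes>\<^sub>M borel)"
    unfolding F_def Dy0_def Ds0_def Dy_def Ds_def unitsq_def by measurable
qed

lemma slices_measurable[measurable]: "F s \<in> borel_measurable borel" "Dy0 s \<in> borel_measurable borel" "Ds0 s \<in> borel_measurable borel"
  "(\<lambda>s. Ds0 s y) \<in> borel_measurable borel" "(\<lambda>s. F s y) \<in> borel_measurable borel"
  using measurable_compose[OF measurable_Pair1' F_measurable, of s] measurable_compose[OF measurable_Pair1' Dy0_measurable, of s]
    measurable_compose[OF measurable_Pair1' Ds0_measurable, of s] measurable_compose[OF measurable_Pair2' Ds0_measurable, of y]
    measurable_compose[OF measurable_Pair2' F_measurable, of y]
  by simp_all

lemma bounds: "\<exists>K. (\<forall>s y. unitsq s y \<longrightarrow> \<bar>F s y\<bar> \<le> K) \<and> (\<forall>s y. \<bar>Dy0 s y\<bar> \<le> K) \<and> (\<forall>s y. \<bar>Ds0 s y\<bar> \<le> K)"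
proof -
  define T where "T = convex hull {a, b, c}"
  have cT: "compact T" unfolding T_def by (intro compact_convex_hull finite_imp_compact) simp
  obtain Kg where Kg: "\<And>x. x \<in> T \<Longrightarrow> norm (g x) \<le> Kg"
    using compact_imp_bounded[OF compact_continuous_image[OF continuous_on_subset[OF cg] cT]] by (fastforce simp: bounded_iff)
  obtain KP where KP: "\<And>x. x \<in> T \<Longrightarrow> norm (P x) \<le> KP"
    using compact_imp_bounded[OF compact_continuous_image[OF continuous_on_subset[OF cP] cT]] by (fastforce simp: bounded_iff)
  have aT: "a \<in> T" unfolding T_def by (simp add: hull_inc)
  have KP0: "0 \<le> KP" using KP[OF aT] norm_ge_zero order_trans by blast
  have Kg0: "0 \<le> Kg" using Kg[OF aT] norm_ge_zero order_trans by blast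
  define n where "n = norm (c - (a + b) /\<^sub>R 2) + norm ((b + c) /\<^sub>R 2 - a) + norm ((b - a) /\<^sub>R 2) + norm ((c - b) /\<^sub>R 2)"
  have n: "norm (c - (a + b) /\<^sub>R 2) \<le> n" "norm ((b + c) /\<^sub>R 2 - a) \<le> n" "norm ((b - a) /\<^sub>R 2) \<le> n" "norm ((c - b) /\<^sub>R 2) \<le> n" "0 \<le> n"
    unfolding n_def using norm_ge_zero by (smt (verit))+
  have ip: "\<bar>P x \<bullet> v\<bar> \<le> KP * n" if "x \<in> T" "norm v \<le> n" for x v
    using order_trans[OF Cauchy_Schwarz_ineq2 mult_mono[OF KP[OF that(1)] that(2)]] KP0 by simp
  have low: "y \<le> s \<Longrightarrow> lower_fold a b c s y \<in> T" and up: "s \<le> y \<Longrightarrow> upper_fold a b c s y \<in> T" if "unitsq s y" for s y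
    using fold_in_triangle[of s y a b c] that by (auto simp: unitsq_def T_def)
  have "\<bar>F s y\<bar> \<le> Kg" if "unitsq s y" for s y
    using low[OF that] up[OF that] Kg by (auto simp: F_def)
  moreover have "\<bar>Dy0 s y\<bar> \<le> KP * n" "\<bar>Ds0 s y\<bar> \<le> KP * n" for s y
    using low[of s y] up[of s y] ip n(1-4) KP0 n(5) by (auto simp: Dy0_def Ds0_def Dy_def Ds_def simp del: inner_scaleR_right norm_scaleR scaleR_right_diff_distrib)
  moreover have "0 \<le> KP * n" using KP0 n(5) by simp
  ultimately show ?thesis using Kg0 by (intro exI[of _ "Kg + KP * n"]) (smt (verit))
qed

lemma F_Ds: "F s' y - F s y = (LINT t:{s..s'}|lborel. Ds0 t y)" if "0 \<le> s" "s \<le> s'" "s' \<le> 1" "y \<in> {0..1}"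
proof -
  obtain K where K: "\<And>s y. \<bar>Ds0 s y\<bar> \<le> K" using bounds by auto
  show ?thesis
  proof (rule increment_by_FTC[of _ _ _ y _ K])
    have "continuous_on ({s..s'} \<inter> {y..} \<union> {s..s'} \<inter> {..y}) (\<lambda>t. if y \<le> t then g (lower_fold a b c t y) else g (upper_fold a b c t y))"
    proof (rule continuous_on_If)
      show "continuous_on ({s..s'} \<inter> {y..}) (\<lambda>t. g (lower_fold a b c t y))" "continuous_on ({s..s'} \<inter> {..y}) (\<lambda>t. g (upper_fold a b c t y))"
        by (intro continuous_on_compose2[OF cg] fold_continuous continuous_intros; simp)+
      fix t assume "t \<in> {s..s'} \<inter> {y..}" "\<not> y \<le> t" then show "g (lower_fold a b c t y) = g (upper_fold a b c t y)" by simp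
    next
      fix t assume "t \<in> {s..s'} \<inter> {..y}" "y \<le> t"
      then have "t = y" by simp
      then show "g (lower_fold a b c t y) = g (upper_fold a b c t y)" by (simp add: folds_agree_on_diagonal)
    qed auto
    moreover have "{s..s'} \<inter> {y..} \<union> {s..s'} \<inter> {..y} = {s..s'}" by auto
    ultimately show "continuous_on {s..s'} (\<lambda>t. F t y)" unfolding F_def by simp
    fix t assume t: "s < t" "t < s'" "t \<noteq> y"
    show "((\<lambda>t. F t y) has_real_derivative Ds0 t y) (at t)"
    proof (cases "y < t")
      case True
      have "((\<lambda>t. g (lower_fold a b c t y)) has_real_derivative Ds t y) (at t)"
        using True fold_derivative by (simp add: Ds_def del: inner_scaleR_right scaleR_right_diff_distrib)
      then have "((\<lambda>t. F t y) has_real_derivative Ds t y) (at t)"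
        by (rule has_field_derivative_transform_within_open[of _ _ _ "{y<..}"]) (use True in \<open>auto simp: F_def\<close>)
      then show ?thesis using that t by (simp add: Ds0_def unitsq_def)
    next
      case False
      then have ty: "t < y" using t by simp
      have "((\<lambda>t. g (upper_fold a b c t y)) has_real_derivative Ds t y) (at t)"
        using ty fold_derivative by (simp add: Ds_def del: inner_scaleR_right scaleR_right_diff_distrib)
      then have "((\<lambda>t. F t y) has_real_derivative Ds t y) (at t)"
        by (rule has_field_derivative_transform_within_open[of _ _ _ "{..<y}"]) (use ty in \<open>auto simp: F_def\<close>)
      then show ?thesis using that t by (simp add: Ds0_def unitsq_def)
    qed
  qed (use that K in auto)
qed

lemma F_Dy: "F s y' - F s y = (LINT t:{y..y'}|lborel. Dy0 s t)" and cF: "continuous_on {y..y'} (F s)"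
  if "0 \<le> y" "y \<le> y'" "y' \<le> 1" "s \<in> {0..1}" for y y'
proof -
  have "continuous_on ({y..y'} \<inter> {..s} \<union> {y..y'} \<inter> {s..}) (\<lambda>t. if t \<le> s then g (lower_fold a b c s t) else g (upper_fold a b c s t))"
  proof (rule continuous_on_If)
    show "continuous_on ({y..y'} \<inter> {..s}) (\<lambda>t. g (lower_fold a b c s t))" "continuous_on ({y..y'} \<inter> {s..}) (\<lambda>t. g (upper_fold a b c s t))"
      by (intro continuous_on_compose2[OF cg] fold_continuous continuous_intros; simp)+
    fix t assume "t \<in> {y..y'} \<inter> {..s}" "\<not> t \<le> s" then show "g (lower_fold a b c s t) = g (upper_fold a b c s t)" by simp
  next
    fix t assume "t \<in> {y..y'} \<inter> {s..}" "t \<le> s"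
    then have "t = s" by simp
    then show "g (lower_fold a b c s t) = g (upper_fold a b c s t)" by (simp add: folds_agree_on_diagonal)
  qed auto
  moreover have "{y..y'} \<inter> {..s} \<union> {y..y'} \<inter> {s..} = {y..y'}" by auto
  ultimately show cF: "continuous_on {y..y'} (F s)" unfolding F_def[abs_def] by simp
  obtain K where K: "\<And>s y. \<bar>Dy0 s y\<bar> \<le> K" using bounds by auto
  show "F s y' - F s y = (LINT t:{y..y'}|lborel. Dy0 s t)"
  proof (rule increment_by_FTC[of _ _ _ s _ K])
    fix t assume t: "y < t" "t < y'" "t \<noteq> s"
    show "(F s has_real_derivative Dy0 s t) (at t)"
    proof (cases "t < s")
      case True
      have "((\<lambda>t. g (lower_fold a b c s t)) has_real_derivative Dy s t) (at t)"
        using True fold_derivative by (simp add: Dy_def del: inner_scaleR_right scaleR_right_diff_distrib)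
      then have "(F s has_real_derivative Dy s t) (at t)"
        by (rule has_field_derivative_transform_within_open[of _ _ _ "{..<s}"]) (use True in \<open>auto simp: F_def\<close>)
      then show ?thesis using that t by (simp add: Dy0_def unitsq_def)
    next
      case False
      then have ts: "s < t" using t by simp
      have "((\<lambda>t. g (upper_fold a b c s t)) has_real_derivative Dy s t) (at t)"
        using ts fold_derivative by (simp add: Dy_def del: inner_scaleR_right scaleR_right_diff_distrib)
      then have "(F s has_real_derivative Dy s t) (at t)"
        by (rule has_field_derivative_transform_within_open[of _ _ _ "{s<..}"]) (use ts in \<open>auto simp: F_def\<close>)
      then show ?thesis using that t by (simp add: Dy0_def unitsq_def)
    qed
  qed (use that K cF in auto)
qed

lemma bounded_integrable_UI_pair: "integrable (UI \<Otimes>\<^sub>M UI) (\<lambda>z. f (fst z) (snd z))"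
  if "(\<lambda>z. f (fst z) (snd z)) \<in> borel_measurable (borel \<Otimes>\<^sub>M borel)" "\<And>s y. unitsq s y \<Longrightarrow> \<bar>f s y\<bar> \<le> K" for f :: "real \<Rightarrow> real \<Rightarrow> real" and K
proof -
  interpret UI: finite_measure UI by (rule finite_measure_UI)
  interpret P: pair_sigma_finite UI UI ..
  interpret PP: finite_measure "UI \<Otimes>\<^sub>M UI" by (rule finite_measure_pair_measure) unfold_locales
  show ?thesis
    by (rule PP.integrable_const_bound[where B=K])
       (use that measurable_UI_pair in \<open>auto simp: unitsq_def space_pair_measure space_restrict_space intro!: AE_I2\<close>)
qed

lemma bounded_integrable_UI: "integrable UI f"
  if "f \<in> borel_measurable borel" "\<And>s. s \<in> {0..1} \<Longrightarrow> \<bar>f s\<bar> \<le> K" for f :: "real \<Rightarrow> real" and K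
proof -
  interpret UI: finite_measure UI by (rule finite_measure_UI)
  show ?thesis
    by (rule UI.integrable_const_bound[where B=K])
       (use that in \<open>auto simp: space_restrict_space intro!: AE_I2 measurable_restrict_space1\<close>)
qed

lemma A_measurable[measurable]: "A \<in> borel_measurable borel" and B_measurable[measurable]: "B \<in> borel_measurable borel"
proof -
  interpret UI: finite_measure UI by (rule finite_measure_UI)
  have *: "(\<lambda>z. z) \<in> borel \<Otimes>\<^sub>M UI \<rightarrow>\<^sub>M (borel :: real measure) \<Otimes>\<^sub>M borel"
    using measurable_Pair[OF measurable_fst measurable_compose[OF measurable_snd id_measurable_UI]]
    by simp
  show "A \<in> borel_measurable borel" unfolding A_def[abs_def]
    by (rule UI.borel_measurable_lebesgue_integral) (use measurable_compose[OF * F_measurable] in \<open>simp add: split_beta'\<close>)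
  show "B \<in> borel_measurable borel" unfolding B_def[abs_def]
    by (rule UI.borel_measurable_lebesgue_integral) (use measurable_compose[OF * Ds0_measurable] in \<open>simp add: split_beta'\<close>)
qed

text \<open>Across the strip, \<open>F s\<close> differs from its mean \<open>A s\<close> by at most what the Neumann inequality on the unit
interval allows; the mean is orthogonal to the deviation.\<close>

theorem transverse_estimate: "(LINT s|UI. LINT y|UI. (F s y - m)\<^sup>2) \<le>
   23/216 * (LINT s|UI. LINT y|UI. (Dy0 s y)\<^sup>2) + (LINT s:{0..1}|lborel. (A s - m)\<^sup>2)"
proof -
  interpret UI: finite_measure UI by (rule finite_measure_UI)
  interpret P: pair_sigma_finite UI UI ..
  obtain K where KF: "\<And>s y. unitsq s y \<Longrightarrow> \<bar>F s y\<bar> \<le> K" and KD: "\<And>s y. \<bar>Dy0 s y\<bar> \<le> K"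
    using bounds by auto
  have AK: "\<bar>A s\<bar> \<le> K" if s: "s \<in> {0..1}" for s
  proof -
    have "\<bar>A s\<bar> \<le> (LINT y|UI. K)" unfolding A_def real_norm_def[symmetric]
    proof (rule order_trans[OF integral_norm_bound integral_mono])
      show "integrable UI (\<lambda>y. norm (F s y))" by (rule bounded_integrable_UI[of _ K]) (use KF s in \<open>auto simp: unitsq_def\<close>)
    qed (use KF s in \<open>auto simp: unitsq_def space_restrict_space\<close>)
    then show ?thesis by (simp add: measure_UI)
  qed
  have pointwise: "(LINT y|UI. (F s y - m)\<^sup>2) \<le> 23/216 * (LINT y|UI. (Dy0 s y)\<^sup>2) + (A s - m)\<^sup>2" if s: "s \<in> {0..1}" for s
  proof -
    have iF: "integrable UI (F s)" by (rule bounded_integrable_UI[of _ K]) (use KF s in \<open>auto simp: unitsq_def\<close>)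
    have iF2: "integrable UI (\<lambda>y. (F s y - A s)\<^sup>2)"
    proof (rule bounded_integrable_UI[of _ "(2*K)\<^sup>2"])
      fix y :: real assume "y \<in> {0..1}"
      then show "\<bar>(F s y - A s)\<^sup>2\<bar> \<le> (2*K)\<^sup>2" using KF[of s y] AK[OF s] s
        unfolding abs_power2 by (intro abs_square_le) (auto simp: unitsq_def)
    qed measurable
    have "(LINT y|UI. (F s y - m)\<^sup>2) = (LINT y|UI. (F s y - A s)\<^sup>2 + 2 * (A s - m) * F s y + (m\<^sup>2 - (A s)\<^sup>2))"
      by (simp add: power2_eq_square algebra_simps)
    also have "\<dots> = (LINT y|UI. (F s y - A s)\<^sup>2) + 2 * (A s - m) * A s + (m\<^sup>2 - (A s)\<^sup>2)"
      using iF iF2 by (simp add: A_def measure_UI)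
    also have "\<dots> = (LINT y|UI. (F s y - A s)\<^sup>2) + (A s - m)\<^sup>2"
      by (simp add: power2_eq_square algebra_simps)
    also have "(LINT y|UI. (F s y - A s)\<^sup>2) \<le> 23/216 * (LINT y|UI. (Dy0 s y)\<^sup>2)"
      using neumann_inequality[of 1 "Dy0 s" K "F s"] KD cF[of 0 1 s] F_Dy[of _ _ s] s by (simp add: integral_UI A_def)
    finally show ?thesis by simp
  qed
  have intA: "integrable UI (\<lambda>s. (A s - m)\<^sup>2)"
    by (rule bounded_integrable_UI[of _ "(K + \<bar>m\<bar>)\<^sup>2"]) (simp_all add: AK abs_diff_square_le)
  have intD: "integrable UI (\<lambda>s. LINT y|UI. (Dy0 s y)\<^sup>2)"
  proof -
    have "integrable (UI \<Otimes>\<^sub>M UI) (\<lambda>z. (Dy0 (fst z) (snd z))\<^sup>2)"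
      by (rule bounded_integrable_UI_pair[of "\<lambda>s y. (Dy0 s y)\<^sup>2" "K\<^sup>2"]) (simp_all add: KD abs_square_le)
    then show ?thesis using P.integrable_fst[of "\<lambda>s y. (Dy0 s y)\<^sup>2"] by (simp add: split_beta')
  qed
  have intF: "integrable UI (\<lambda>s. LINT y|UI. (F s y - m)\<^sup>2)"
  proof -
    have "integrable (UI \<Otimes>\<^sub>M UI) (\<lambda>z. (F (fst z) (snd z) - m)\<^sup>2)"
      by (rule bounded_integrable_UI_pair[of "\<lambda>s y. (F s y - m)\<^sup>2" "(K + \<bar>m\<bar>)\<^sup>2"])
         (simp_all add: KF abs_diff_square_le)
    then show ?thesis using P.integrable_fst[of "\<lambda>s y. (F s y - m)\<^sup>2"] by (simp add: split_beta')
  qed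
  have "(LINT s|UI. LINT y|UI. (F s y - m)\<^sup>2) \<le> (LINT s|UI. 23/216 * (LINT y|UI. (Dy0 s y)\<^sup>2) + (A s - m)\<^sup>2)"
    using intA intD intF pointwise by (intro integral_mono) (auto simp: space_restrict_space)
  also have "\<dots> = 23/216 * (LINT s|UI. LINT y|UI. (Dy0 s y)\<^sup>2) + (LINT s|UI. (A s - m)\<^sup>2)"
    using intA intD by simp
  finally show ?thesis by (simp add: integral_UI)
qed

text \<open>Averaging commutes with differentiation in \<open>s\<close> by Fubini, and does not increase the energy by
Cauchy-Schwarz. The bound on \<open>B\<close> is what the inequality on the circle asks for.\<close>

theorem longitudinal_estimate:
  shows "0 \<le> s \<Longrightarrow> s \<le> s' \<Longrightarrow> s' \<le> 1 \<Longrightarrow> A s' - A s = (LINT t:{s..s'}|lborel. B t)"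
    and "(LINT s:{0..1}|lborel. (B s)\<^sup>2) \<le> (LINT s|UI. LINT y|UI. (Ds0 s y)\<^sup>2)"
    and "\<exists>K. \<forall>s. \<bar>B s\<bar> \<le> K"
proof -
  interpret UI: finite_measure UI by (rule finite_measure_UI)
  interpret P: pair_sigma_finite UI UI ..
  obtain K where KF: "\<And>s y. unitsq s y \<Longrightarrow> \<bar>F s y\<bar> \<le> K" and KD: "\<And>s y. \<bar>Ds0 s y\<bar> \<le> K"
    using bounds by auto
  have iDs: "integrable UI (Ds0 s)" "integrable UI (\<lambda>y. (Ds0 s y)\<^sup>2)" for s
    using KD bounded_integrable_UI[of "Ds0 s" K] bounded_integrable_UI[of "\<lambda>y. (Ds0 s y)\<^sup>2" "K\<^sup>2"] by (simp_all add: abs_square_le)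
  have BK: "\<bar>B s\<bar> \<le> K" for s
  proof -
    have "\<bar>B s\<bar> \<le> (LINT y|UI. K)" unfolding B_def real_norm_def[symmetric]
      by (rule order_trans[OF integral_norm_bound integral_mono]) (use KD iDs in auto)
    then show ?thesis by (simp add: measure_UI)
  qed
  then show "\<exists>K. \<forall>s. \<bar>B s\<bar> \<le> K" by blast
  show "A s' - A s = (LINT t:{s..s'}|lborel. B t)" if "0 \<le> s" "s \<le> s'" "s' \<le> 1"
  proof -
    have iF: "integrable UI (F t)" if "t \<in> {0..1}" for t
      by (rule bounded_integrable_UI[of _ K]) (use KF that in \<open>auto simp: unitsq_def\<close>)
    have restr: "(LINT t:{s..s'}|lborel. f t) = (LINT t|UI. indicator {s..s'} t * f t)" for f :: "real \<Rightarrow> real"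
      unfolding integral_UI set_lebesgue_integral_def
      by (intro Bochner_Integration.integral_cong) (use that in \<open>auto simp: indicator_def\<close>)
    have [measurable]: "(\<lambda>z. indicat_real {s..s'} (fst z) * Ds0 (fst z) (snd z)) \<in> borel_measurable (borel \<Otimes>\<^sub>M borel)"
      by measurable
    have int: "integrable (UI \<Otimes>\<^sub>M UI) (\<lambda>z. indicat_real {s..s'} (fst z) * Ds0 (fst z) (snd z))"
      by (rule bounded_integrable_UI_pair[of "\<lambda>t y. indicat_real {s..s'} t * Ds0 t y" "\<bar>K\<bar>"])
         (use KD in \<open>auto simp: indicator_def intro: order_trans[OF _ abs_ge_self]\<close>)
    have "A s' - A s = (LINT y|UI. F s' y - F s y)" unfolding A_def using iF that by simp
    also have "\<dots> = (LINT y|UI. LINT t|UI. indicator {s..s'} t * Ds0 t y)"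
      using F_Ds[OF that] by (intro Bochner_Integration.integral_cong) (auto simp: space_restrict_space restr)
    also have "\<dots> = (LINT t|UI. LINT y|UI. indicator {s..s'} t * Ds0 t y)"
      using P.Fubini_integral[of "\<lambda>t y. indicat_real {s..s'} t * Ds0 t y"] int by (simp add: split_beta')
    also have "\<dots> = (LINT t:{s..s'}|lborel. B t)" unfolding restr B_def by simp
    finally show ?thesis .
  qed
  have "(B s)\<^sup>2 \<le> (LINT y|UI. (Ds0 s y)\<^sup>2)" for s
    using weighted_cauchy_schwarz[of UI "Ds0 s" "\<lambda>_. 1" 1] iDs[of s] by (simp add: B_def measure_UI)
  moreover have "integrable UI (\<lambda>s. (B s)\<^sup>2)"
    by (rule bounded_integrable_UI[of _ "K\<^sup>2"]) (use BK in \<open>auto intro!: abs_square_le\<close>)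
  moreover have "integrable UI (\<lambda>s. LINT y|UI. (Ds0 s y)\<^sup>2)"
  proof -
    have "integrable (UI \<Otimes>\<^sub>M UI) (\<lambda>z. (Ds0 (fst z) (snd z))\<^sup>2)"
      by (rule bounded_integrable_UI_pair[of "\<lambda>s y. (Ds0 s y)\<^sup>2" "K\<^sup>2"]) (simp_all add: KD abs_square_le)
    then show ?thesis using P.integrable_fst[of "\<lambda>s y. (Ds0 s y)\<^sup>2"] by (simp add: split_beta')
  qed
  ultimately show "(LINT s:{0..1}|lborel. (B s)\<^sup>2) \<le> (LINT s|UI. LINT y|UI. (Ds0 s y)\<^sup>2)"
    unfolding integral_UI[symmetric] by (intro integral_mono)
qed

end

text \<open>Here \<open>x, y, z\<close> are the products of a gradient with the three edge vectors, which add up to zero, and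
\<open>H\<close> is the diameter times the length of the gradient. Two of the three numbers have the same sign, so
the sum of their squares is at most the square of the third; hence all three squares sum to at most
\<open>2 H\<^sup>2\<close>. The median vectors are half the differences of the edge vectors, and the differences of
\<open>x, y, z\<close> have three times that sum of squares. This accounts for
\<open>173/576 = 2 (3 \<cdot> 23/864 + 9/128)\<close>.\<close>

lemma edge_gradient_bound:
  fixes x y z H :: real
  assumes "x + y + z = 0" "\<bar>x\<bar> \<le> H" "\<bar>y\<bar> \<le> H" "\<bar>z\<bar> \<le> H"
  shows "((x - y)\<^sup>2 + (y - z)\<^sup>2 + (z - x)\<^sup>2) * (23/864) + (x\<^sup>2 + y\<^sup>2 + z\<^sup>2) * (9/128) \<le> 173/576 * H\<^sup>2"
proof -
  have z: "z = - x - y" using assms by simp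
  have sq: "x\<^sup>2 \<le> H\<^sup>2" "y\<^sup>2 \<le> H\<^sup>2" "z\<^sup>2 \<le> H\<^sup>2" using assms by (auto intro: abs_square_le)
  have "x\<^sup>2 + y\<^sup>2 + z\<^sup>2 \<le> 2 * H\<^sup>2"
  proof -
    have e: "z\<^sup>2 = x\<^sup>2 + y\<^sup>2 + 2 * (x * y)" "x\<^sup>2 = y\<^sup>2 + z\<^sup>2 + 2 * (y * z)" "y\<^sup>2 = x\<^sup>2 + z\<^sup>2 + 2 * (x * z)"
      unfolding z by (simp_all add: power2_eq_square algebra_simps)
    have "0 \<le> x * y \<or> 0 \<le> y * z \<or> 0 \<le> x * z"
      by (smt (verit) mult_nonneg_nonneg mult_nonpos_nonpos)
    then show ?thesis using e sq by (elim disjE) linarith+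
  qed
  moreover have "(x - y)\<^sup>2 + (y - z)\<^sup>2 + (z - x)\<^sup>2 = 3 * (x\<^sup>2 + y\<^sup>2 + z\<^sup>2)"
    unfolding z by (simp add: power2_eq_square algebra_simps)
  moreover obtain S where "x\<^sup>2 + y\<^sup>2 + z\<^sup>2 = S" by blast
  ultimately show ?thesis by simp
qed

lemma fold_split:
  fixes k k' :: "real^2 \<Rightarrow> real"
  assumes ck: "continuous_on UNIV k" and ck': "continuous_on UNIV k'"
  shows "(LINT s|UI. LINT y|UI. (if y \<le> s then k (lower_fold a b c s y) else k' (upper_fold a b c s y))) =
     (LINT s|UI. LINT y|UI. (if y \<le> s then k (lower_fold a b c s y) else 0)) +
     (LINT s|UI. LINT y|UI. (if y \<le> s then 0 else k' (upper_fold a b c s y)))"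
proof -
  interpret UI: finite_measure UI by (rule finite_measure_UI)
  interpret P: pair_sigma_finite UI UI ..
  interpret PP: finite_measure "UI \<Otimes>\<^sub>M UI" by (rule finite_measure_pair_measure) unfold_locales
  have [measurable]: "k \<in> borel_measurable borel" "k' \<in> borel_measurable borel"
    using ck ck' by (auto intro: borel_measurable_continuous_onI)
  have [measurable]: "(\<lambda>z. lower_fold a b c (fst z) (snd z)) \<in> borel_measurable (borel \<Otimes>\<^sub>M borel)"
     "(\<lambda>z. upper_fold a b c (fst z) (snd z)) \<in> borel_measurable (borel \<Otimes>\<^sub>M borel)"
    unfolding lower_fold_def upper_fold_def by measurable
  define T where "T = convex hull {a, b, c}"
  have cT: "compact T" unfolding T_def by (intro compact_convex_hull finite_imp_compact) simp
  obtain K where K: "\<And>x. x \<in> T \<Longrightarrow> norm (k x) \<le> K"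
    using compact_imp_bounded[OF compact_continuous_image[OF continuous_on_subset[OF ck] cT]] by (fastforce simp: bounded_iff)
  obtain K' where K': "\<And>x. x \<in> T \<Longrightarrow> norm (k' x) \<le> K'"
    using compact_imp_bounded[OF compact_continuous_image[OF continuous_on_subset[OF ck'] cT]] by (fastforce simp: bounded_iff)
  define f1 where "f1 = (\<lambda>s y. if y \<le> s then k (lower_fold a b c s y) else 0)"
  define f2 where "f2 = (\<lambda>s y. if y \<le> s then 0 else k' (upper_fold a b c s y))"
  have [measurable]: "(\<lambda>z. f1 (fst z) (snd z)) \<in> borel_measurable (borel \<Otimes>\<^sub>M borel)"
     "(\<lambda>z. f2 (fst z) (snd z)) \<in> borel_measurable (borel \<Otimes>\<^sub>M borel)"
    unfolding f1_def f2_def by measurable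
  have "a \<in> T" by (simp add: T_def hull_inc)
  then have K0: "0 \<le> K" "0 \<le> K'" using K K' norm_ge_zero order_trans by blast+
  have b1: "\<bar>f1 s y\<bar> \<le> K" and b2: "\<bar>f2 s y\<bar> \<le> K'" if "s \<in> {0..1}" "y \<in> {0..1}" for s y
    using fold_in_triangle[of s y a b c] that K K' K0 by (auto simp: f1_def f2_def T_def)
  have i1: "integrable (UI \<Otimes>\<^sub>M UI) (\<lambda>z. f1 (fst z) (snd z))" and i2: "integrable (UI \<Otimes>\<^sub>M UI) (\<lambda>z. f2 (fst z) (snd z))"
    by (rule PP.integrable_const_bound[where B=K] PP.integrable_const_bound[where B=K'];
        use b1 b2 in \<open>auto simp: space_pair_measure space_restrict_space intro!: AE_I2 measurable_UI_pair\<close>)+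
  have "(LINT s|UI. LINT y|UI. (if y \<le> s then k (lower_fold a b c s y) else k' (upper_fold a b c s y)))
     = (LINT s|UI. LINT y|UI. f1 s y + f2 s y)"
    unfolding f1_def f2_def by (intro Bochner_Integration.integral_cong refl) auto
  also have "\<dots> = (LINT z|(UI \<Otimes>\<^sub>M UI). f1 (fst z) (snd z) + f2 (fst z) (snd z))"
    using P.integral_fst[of "\<lambda>s y. f1 s y + f2 s y"] i1 i2 by (simp add: split_beta')
  also have "\<dots> = (LINT s|UI. LINT y|UI. f1 s y) + (LINT s|UI. LINT y|UI. f2 s y)"
    using P.integral_fst[of f1] P.integral_fst[of f2] i1 i2 by (simp add: split_beta')
  finally show ?thesis unfolding f1_def f2_def .
qed

context smooth_fold begin

text \<open>The side \<open>s = 1\<close> of the square for \<open>a, b, c\<close> and the side \<open>s = 0\<close> of the square for \<open>c, a, b\<close> are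
mapped to the same median, in opposite directions. The averages over these two sides agree.\<close>

lemma arc_glue: "A 1 = smooth_fold.A g c a b 0"
proof -
  interpret S: smooth_fold g P c a b using smooth_fold_axioms by (simp add: smooth_fold_def)
  have "F 1 (1 - y) = S.F 0 y" if "y \<in> {0..1}" for y
  proof -
    have "F 1 (1 - y) = g (lower_fold a b c 1 (1 - y))" using that by (simp add: F_def)
    also have "lower_fold a b c 1 (1 - y) = upper_fold c a b 0 y"
      by (simp add: lower_fold_def upper_fold_def vec_eq_iff field_simps)
    also have "g (upper_fold c a b 0 y) = S.F 0 y"
      using that S.folds_agree_on_diagonal[of 0] by (cases "y = 0") (auto simp: S.F_def)
    finally show ?thesis .
  qed
  then have "(LINT y:{0..1}|lborel. F 1 (1 - y)) = (LINT y:{0..1}|lborel. S.F 0 y)"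
    by (intro set_lebesgue_integral_cong) auto
  then show ?thesis
    using set_integral_affine_real(2)[of 0 1 "F 1" 1] by (simp add: A_def S.A_def integral_UI)
qed

lemma square_integrals:
  "(LINT s|UI. LINT y|UI. (F s y - m)\<^sup>2) =
     (LINT s|UI. LINT y|UI. (if y \<le> s then (g (lower_fold a b c s y) - m)\<^sup>2 else 0)) +
     (LINT s|UI. LINT y|UI. (if y \<le> s then 0 else (g (upper_fold a b c s y) - m)\<^sup>2))"
  "(LINT s|UI. LINT y|UI. (Dy0 s y)\<^sup>2) =
     (LINT s|UI. LINT y|UI. (if y \<le> s then (P (lower_fold a b c s y) \<bullet> (c - (a + b) /\<^sub>R 2))\<^sup>2 else 0)) +
     (LINT s|UI. LINT y|UI. (if y \<le> s then 0 else (P (upper_fold a b c s y) \<bullet> ((b + c) /\<^sub>R 2 - a))\<^sup>2))"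
  "(LINT s|UI. LINT y|UI. (Ds0 s y)\<^sup>2) =
     (LINT s|UI. LINT y|UI. (if y \<le> s then (P (lower_fold a b c s y) \<bullet> ((b - a) /\<^sub>R 2))\<^sup>2 else 0)) +
     (LINT s|UI. LINT y|UI. (if y \<le> s then 0 else (P (upper_fold a b c s y) \<bullet> ((c - b) /\<^sub>R 2))\<^sup>2))"
proof -
  have c: "continuous_on UNIV (\<lambda>x. (g x - m)\<^sup>2)" "continuous_on UNIV (\<lambda>x. (P x \<bullet> v)\<^sup>2)" for v
    using cg cP by (auto intro!: continuous_intros)
  show "(LINT s|UI. LINT y|UI. (F s y - m)\<^sup>2) =
     (LINT s|UI. LINT y|UI. (if y \<le> s then (g (lower_fold a b c s y) - m)\<^sup>2 else 0)) +
     (LINT s|UI. LINT y|UI. (if y \<le> s then 0 else (g (upper_fold a b c s y) - m)\<^sup>2))"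
    unfolding fold_split[OF c(1) c(1), symmetric]
    by (intro Bochner_Integration.integral_cong refl) (auto simp: F_def)
  show "(LINT s|UI. LINT y|UI. (Dy0 s y)\<^sup>2) =
     (LINT s|UI. LINT y|UI. (if y \<le> s then (P (lower_fold a b c s y) \<bullet> (c - (a + b) /\<^sub>R 2))\<^sup>2 else 0)) +
     (LINT s|UI. LINT y|UI. (if y \<le> s then 0 else (P (upper_fold a b c s y) \<bullet> ((b + c) /\<^sub>R 2 - a))\<^sup>2))"
    unfolding fold_split[OF c(2) c(2), symmetric]
    by (intro Bochner_Integration.integral_cong refl) (auto simp: Dy0_def Dy_def unitsq_def space_restrict_space)
  show "(LINT s|UI. LINT y|UI. (Ds0 s y)\<^sup>2) =
     (LINT s|UI. LINT y|UI. (if y \<le> s then (P (lower_fold a b c s y) \<bullet> ((b - a) /\<^sub>R 2))\<^sup>2 else 0)) +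
     (LINT s|UI. LINT y|UI. (if y \<le> s then 0 else (P (upper_fold a b c s y) \<bullet> ((c - b) /\<^sub>R 2))\<^sup>2))"
    unfolding fold_split[OF c(2) c(2), symmetric]
    by (intro Bochner_Integration.integral_cong refl) (auto simp: Ds0_def Ds_def unitsq_def space_restrict_space)
qed

text \<open>The transverse and longitudinal estimates are added over the three cyclic orders of the vertices. By
\<open>integral_triangle_fold\<close> the sum of the lower and upper parts of the three squares is three times an
integral over the triangle, while each of the three medians and each of the three edges occurs on one
lower and one matching upper part, which together make up the triangle once.\<close>

theorem poincare_smooth:
  assumes d: "cross2 (b - a) (c - a) \<noteq> 0"
  defines "T \<equiv> convex hull {a, b, c}"
  shows "\<exists>m. (LINT x:T|lborel. (g x - m)\<^sup>2) \<le> 173/1728 * (diameter T)\<^sup>2 * (LINT x:T|lborel. (norm (P x))\<^sup>2)"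
proof -
  interpret S1: smooth_fold g P c a b using smooth_fold_axioms by (simp add: smooth_fold_def)
  interpret S2: smooth_fold g P b c a using smooth_fold_axioms by (simp add: smooth_fold_def)
  have cT: "compact T" unfolding T_def by (intro compact_convex_hull finite_imp_compact) simp
  have d1: "cross2 (a - c) (b - c) = cross2 (b - a) (c - a)" and d2: "cross2 (c - b) (a - b) = cross2 (b - a) (c - a)"
    by (simp_all add: cross2_def algebra_simps)
  have T1: "convex hull {c, a, b} = T" and T2: "convex hull {b, c, a} = T"
    unfolding T_def by (simp_all add: insert_commute)
  define E where "E = \<bar>cross2 (b - a) (c - a)\<bar> / 2"
  have E0: "0 < E" using d by (simp add: E_def)
  define lo where "lo = (\<lambda>k a b c. LINT s|UI. LINT y|UI. (if y \<le> s then k (lower_fold a b c s y) else (0::real)))"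
  define up where "up = (\<lambda>k a b c. LINT s|UI. LINT y|UI. (if y \<le> s then (0::real) else k (upper_fold a b c s y)))"
  define J where "J = (\<lambda>k. LINT x:T|lborel. k x :: real)"
  have J: "J k = E * (lo k a b c + up k c a b)" "J k = E * (lo k c a b + up k b c a)" "J k = E * (lo k b c a + up k a b c)"
    if ck: "continuous_on UNIV k" for k
  proof -
    have m: "k \<in> borel_measurable borel" using ck by (rule borel_measurable_continuous_onI)
    obtain K where K: "\<And>x. x \<in> T \<Longrightarrow> \<bar>k x\<bar> \<le> K"
      using compact_imp_bounded[OF compact_continuous_image[OF continuous_on_subset[OF ck] cT]] by (fastforce simp: bounded_iff)
    show "J k = E * (lo k a b c + up k c a b)"
      unfolding J_def lo_def up_def E_def T_def by (rule integral_triangle_fold[OF m _ d]) (use K T_def in auto)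
    show "J k = E * (lo k c a b + up k b c a)"
      using integral_triangle_fold[OF m, of c a b K] K d unfolding T1 d1 by (simp add: J_def lo_def up_def E_def)
    show "J k = E * (lo k b c a + up k a b c)"
      using integral_triangle_fold[OF m, of b c a K] K d unfolding T2 d2 by (simp add: J_def lo_def up_def E_def)
  qed
  (* For the three cyclic orders (a, b, c), (c, a, b), (b, c, a) the side s = 1 of one square is
     glued to the side s = 0 of the next. *)
  define Ai where "Ai = (\<lambda>i::nat. if i = 0 then A else if i = 1 then S1.A else S2.A)"
  define Bi where "Bi = (\<lambda>i::nat. if i = 0 then B else if i = 1 then S1.B else S2.B)"
  obtain K0 K1 K2 where "\<And>t. \<bar>B t\<bar> \<le> K0" "\<And>t. \<bar>S1.B t\<bar> \<le> K1" "\<And>t. \<bar>S2.B t\<bar> \<le> K2"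
    using longitudinal_estimate(3) S1.longitudinal_estimate(3) S2.longitudinal_estimate(3) by metis
  then have BK: "\<bar>Bi i t\<bar> \<le> max K0 (max K1 K2)" for i t by (auto simp: Bi_def le_max_iff_disj)
  have three: "(\<Sum>i<3. f i) = f 0 + f 1 + f 2" for f :: "nat \<Rightarrow> real" by (simp add: eval_nat_numeral)
  obtain m where m: "(\<Sum>i<3. LINT x:{0..1}|lborel. (Ai i x - m)\<^sup>2) \<le> 9/32 * (\<Sum>i<3. LINT t:{0..1}|lborel. (Bi i t)\<^sup>2)"
  proof -
    have "\<exists>m. (\<Sum>i<3. LINT x:{0..1}|lborel. (Ai i x - m)\<^sup>2) \<le> 9/32 * (\<Sum>i<3. LINT t:{0..1}|lborel. (Bi i t)\<^sup>2)"
    proof (rule three_arc_inequality[OF _ BK])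
      show "Bi i \<in> borel_measurable borel" for i by (simp add: Bi_def)
      show "Ai i y - Ai i x = (LINT t:{x..y}|lborel. Bi i t)" if "0 \<le> x" "x \<le> y" "y \<le> 1" for i x y
        using longitudinal_estimate(1)[OF that] S1.longitudinal_estimate(1)[OF that] S2.longitudinal_estimate(1)[OF that] by (simp add: Ai_def Bi_def)
    qed (use arc_glue S1.arc_glue S2.arc_glue in \<open>simp_all add: Ai_def\<close>)
    then show ?thesis using that by blast
  qed
  define kg where "kg = (\<lambda>x. (g x - m)\<^sup>2)"
  define kv where "kv = (\<lambda>v x. (P x \<bullet> v)\<^sup>2)"
  have ckg: "continuous_on UNIV kg" and ckv: "continuous_on UNIV (kv v)" for v
    using cg cP unfolding kg_def kv_def by (auto intro!: continuous_intros)
  have sym: "kv (u - v) = kv (v - u)" for u v unfolding kv_def fun_eq_iff by (simp add: inner_diff_right power2_commute)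
  let ?mab = "c - (a + b) /\<^sub>R 2" and ?mbc = "a - (b + c) /\<^sub>R 2" and ?mca = "b - (c + a) /\<^sub>R 2"
  (* The median from a occurs as (b+c)/2 - a in one square and as a - (b+c)/2 in another; the
     squares of the directional derivatives do not see the sign. *)
  have t0: "lo kg a b c + up kg a b c \<le> 23/216 * (lo (kv ?mab) a b c + up (kv ?mbc) a b c) + (LINT s:{0..1}|lborel. (A s - m)\<^sup>2)"
    using transverse_estimate[of m, unfolded square_integrals] unfolding sym[of a "(b + c) /\<^sub>R 2"] unfolding lo_def up_def kg_def kv_def by assumption
  have t1: "lo kg c a b + up kg c a b \<le> 23/216 * (lo (kv ?mca) c a b + up (kv ?mab) c a b) + (LINT s:{0..1}|lborel. (S1.A s - m)\<^sup>2)"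
    using S1.transverse_estimate[of m, unfolded S1.square_integrals] unfolding sym[of c "(a + b) /\<^sub>R 2"] unfolding lo_def up_def kg_def kv_def by assumption
  have t2: "lo kg b c a + up kg b c a \<le> 23/216 * (lo (kv ?mbc) b c a + up (kv ?mca) b c a) + (LINT s:{0..1}|lborel. (S2.A s - m)\<^sup>2)"
    using S2.transverse_estimate[of m, unfolded S2.square_integrals] unfolding sym[of b "(c + a) /\<^sub>R 2"] unfolding lo_def up_def kg_def kv_def by assumption
  let ?eab = "(b - a) /\<^sub>R 2" and ?ebc = "(c - b) /\<^sub>R 2" and ?eca = "(a - c) /\<^sub>R 2"
  have l0: "(LINT t:{0..1}|lborel. (B t)\<^sup>2) \<le> lo (kv ?eab) a b c + up (kv ?ebc) a b c"
    using longitudinal_estimate(2)[unfolded square_integrals] unfolding lo_def up_def kv_def by assumption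
  have l1: "(LINT t:{0..1}|lborel. (S1.B t)\<^sup>2) \<le> lo (kv ?eca) c a b + up (kv ?eab) c a b"
    using S1.longitudinal_estimate(2)[unfolded S1.square_integrals] unfolding lo_def up_def kv_def by assumption
  have l2: "(LINT t:{0..1}|lborel. (S2.B t)\<^sup>2) \<le> lo (kv ?ebc) b c a + up (kv ?eca) b c a"
    using S2.longitudinal_estimate(2)[unfolded S2.square_integrals] unfolding lo_def up_def kv_def by assumption
  define X where "X = lo kg a b c + up kg a b c + (lo kg c a b + up kg c a b) + (lo kg b c a + up kg b c a)"
  have X: "E * X = 3 * J kg" unfolding X_def using J[OF ckg] by (simp add: algebra_simps)
  define Y where "Y = lo (kv ?mab) a b c + up (kv ?mbc) a b c + (lo (kv ?mca) c a b + up (kv ?mab) c a b) + (lo (kv ?mbc) b c a + up (kv ?mca) b c a)"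
  have Y: "E * Y = J (kv ?mab) + J (kv ?mbc) + J (kv ?mca)"
    unfolding Y_def J(1)[OF ckv[of ?mab]] J(2)[OF ckv[of ?mca]] J(3)[OF ckv[of ?mbc]] by (simp add: algebra_simps)
  define Z where "Z = lo (kv ?eab) a b c + up (kv ?ebc) a b c + (lo (kv ?eca) c a b + up (kv ?eab) c a b) + (lo (kv ?ebc) b c a + up (kv ?eca) b c a)"
  have Z: "E * Z = J (kv ?eab) + J (kv ?ebc) + J (kv ?eca)"
    unfolding Z_def J(1)[OF ckv[of ?eab]] J(2)[OF ckv[of ?eca]] J(3)[OF ckv[of ?ebc]] by (simp add: algebra_simps)
  have "X \<le> 23/216 * Y + 9/32 * Z"
    using t0 t1 t2 l0 l1 l2 m unfolding X_def Y_def Z_def three Ai_def Bi_def by (simp add: algebra_simps)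
  then have "E * X \<le> E * (23/216 * Y + 9/32 * Z)" using E0 by simp
  then have "3 * J kg \<le> 23/216 * (E * Y) + 9/32 * (E * Z)"
    unfolding X by (simp add: algebra_simps)
  then have "3 * J kg \<le> 23/216 * (J (kv ?mab) + J (kv ?mbc) + J (kv ?mca)) + 9/32 * (J (kv ?eab) + J (kv ?ebc) + J (kv ?eca))"
    unfolding Y Z by assumption
  also have "\<dots> = J (\<lambda>x. 23/216 * (kv ?mab x + kv ?mbc x + kv ?mca x) + 9/32 * (kv ?eab x + kv ?ebc x + kv ?eca x))"
  proof -
    have i: "set_integrable lborel T (kv v)" for v
      by (rule borel_integrable_compact[OF cT, folded set_integrable_def]) (use ckv continuous_on_subset in blast)
    show ?thesis unfolding J_def using i by simp
  qed
  also have "\<dots> \<le> J (\<lambda>x. 173/576 * (diameter T)\<^sup>2 * (norm (P x))\<^sup>2)"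
    unfolding J_def
  proof (rule set_integral_mono)
    fix x assume "x \<in> T"
    define p q r where "p = P x \<bullet> (b - a)" and "q = P x \<bullet> (c - b)" and "r = P x \<bullet> (a - c)"
    have sum: "p + q + r = 0" by (simp add: p_def q_def r_def inner_diff_right)
    have edge: "\<bar>P x \<bullet> (u - v)\<bar> \<le> diameter T * norm (P x)" if "u \<in> {a, b, c}" "v \<in> {a, b, c}" for u v
    proof -
      have "u \<in> T" "v \<in> T" using that hull_subset[of "{a, b, c}" convex] by (auto simp: T_def)
      then have "norm (u - v) \<le> diameter T"
        using diameter_bounded_bound[OF compact_imp_bounded[OF cT]] by (simp add: dist_norm)
      then have "norm (P x) * norm (u - v) \<le> norm (P x) * diameter T" by (intro mult_left_mono) auto
      then show ?thesis using Cauchy_Schwarz_ineq2[of "P x" "u - v"] by (simp add: mult.commute)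
    qed
    have "23/216 * (kv ?mab x + kv ?mbc x + kv ?mca x) + 9/32 * (kv ?eab x + kv ?ebc x + kv ?eca x)
      = ((p - q)\<^sup>2 + (q - r)\<^sup>2 + (r - p)\<^sup>2) * (23/864) + (p\<^sup>2 + q\<^sup>2 + r\<^sup>2) * (9/128)"
      unfolding kv_def p_def q_def r_def
      by (simp add: inner_diff_right inner_add_right power2_eq_square field_simps)
    also have "\<dots> \<le> 173/576 * (diameter T * norm (P x))\<^sup>2"
      using edge_gradient_bound[OF sum] edge unfolding p_def q_def r_def by simp
    finally show "23/216 * (kv ?mab x + kv ?mbc x + kv ?mca x) + 9/32 * (kv ?eab x + kv ?ebc x + kv ?eca x)
       \<le> 173/576 * (diameter T)\<^sup>2 * (norm (P x))\<^sup>2"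
      by (simp add: power_mult_distrib)
  next
    show "set_integrable lborel T (\<lambda>x. 23/216 * (kv ?mab x + kv ?mbc x + kv ?mca x) + 9/32 * (kv ?eab x + kv ?ebc x + kv ?eca x))"
      by (rule borel_integrable_compact[OF cT, folded set_integrable_def])
         (intro continuous_intros continuous_on_subset[OF ckv], auto)
    show "set_integrable lborel T (\<lambda>x. 173/576 * (diameter T)\<^sup>2 * (norm (P x))\<^sup>2)"
      by (rule borel_integrable_compact[OF cT, folded set_integrable_def])
         (intro continuous_intros continuous_on_subset[OF cP], auto)
  qed
  also have "\<dots> = 3 * (173/1728 * (diameter T)\<^sup>2 * (LINT x:T|lborel. (norm (P x))\<^sup>2))"
    unfolding J_def by simp
  finally show ?thesis unfolding J_def kg_def by (intro exI[of _ m]) linarith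
qed

end

section \<open>Smooth bumps supported on squares\<close>

text \<open>The classical smooth function with a flat zero at 0, together with its multiples by negative powers.
Derivatives are linear combinations of members of this family, so smoothness follows by induction.\<close>

definition flat_exp :: "real \<Rightarrow> nat \<Rightarrow> real \<Rightarrow> real" where
  "flat_exp c m t = (if 0 < t then exp (- c / t) / t ^ m else 0)"

text \<open>The quadratic bound makes the one-sided formula differentiable at 0 with derivative 0. It comes from
\<open>(1 + x / n)\<^sup>n \<le> exp x\<close> for \<open>n = m + 2\<close> and \<open>x = c / t\<close>.\<close>

lemma flat_exp_bound:
  assumes "0 < c"
  shows "\<bar>flat_exp c m t\<bar> \<le> real (m + 2) ^ (m + 2) / c ^ (m + 2) * t\<^sup>2"
proof (cases "0 < t")
  case True
  define n where "n = m + 2"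
  have ct: "0 < c / t" using assms True by simp
  have "(c / t / real n) ^ n \<le> (1 + c / t / real n) ^ n"
    using divide_nonneg_nonneg[of "c / t" "real n"] ct by (intro power_mono) auto
  also have "\<dots> \<le> exp (c / t)"
    using ct by (intro exp_ge_one_plus_x_over_n_power_n) (auto simp: n_def)
  finally have "(c / t) ^ n / real n ^ n \<le> exp (c / t)"
    by (simp only: power_divide[of "c / t"])
  moreover have "0 < real n ^ n" by (simp add: n_def)
  ultimately have "(c / t) ^ n \<le> real n ^ n * exp (c / t)"
    by (simp add: pos_divide_le_eq mult.commute)
  then have "exp (- (c / t)) \<le> real n ^ n / (c / t) ^ n"
    using zero_less_power[OF ct, of n] unfolding exp_minus
    by (simp only: pos_le_divide_eq inverse_eq_divide) (simp add: pos_divide_le_eq mult.commute)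
  then have "flat_exp c m t \<le> real n ^ n / (c / t) ^ n / t ^ m"
    using True by (simp add: flat_exp_def divide_right_mono del: divide_divide_eq_left)
  also have "\<dots> = real n ^ n / c ^ n * t\<^sup>2"
    using True by (simp add: n_def power_divide power_add power2_eq_square)
  finally show ?thesis using True by (simp add: flat_exp_def n_def)
qed (use assms in \<open>simp add: flat_exp_def\<close>)

lemma flat_exp_derivative:
  assumes c: "0 < c"
  shows "(flat_exp c m has_real_derivative (- real m * flat_exp c (m + 1) t + c * flat_exp c (m + 2) t)) (at t)"
proof -
  consider "0 < t" | "t < 0" | "t = 0" by linarith
  then show ?thesis
  proof cases
    case 1
    have "((\<lambda>t. inverse t ^ m) has_real_derivative - real m * inverse t ^ (m + 1)) (at t)"
    proof (cases m)
      case (Suc k)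
      have "((\<lambda>t. inverse t ^ Suc k) has_real_derivative (1 + real k) * (- (inverse t ^ Suc (Suc 0)) * inverse t ^ k)) (at t)"
        by (rule DERIV_power_Suc) (use 1 in \<open>auto intro!: DERIV_inverse[THEN DERIV_cong]\<close>)
      then show ?thesis by (simp add: Suc algebra_simps)
    qed simp
    moreover have "((\<lambda>t. exp (- c * inverse t)) has_real_derivative exp (- c * inverse t) * (c * inverse t ^ 2)) (at t)"
      using 1 by (auto intro!: derivative_eq_intros simp: power2_eq_square field_simps)
    ultimately have der: "((\<lambda>t. exp (- c * inverse t) * inverse t ^ m) has_real_derivative
        exp (- c * inverse t) * (- real m * inverse t ^ (m + 1)) + exp (- c * inverse t) * (c * inverse t ^ 2) * inverse t ^ m) (at t)"
      by (rule DERIV_mult'[rotated])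
    have fe: "flat_exp c k t = exp (- c * inverse t) * inverse t ^ k" for k
      using 1 by (simp add: flat_exp_def divide_inverse power_inverse)
    have "exp (- c * inverse t) * (- real m * inverse t ^ (m + 1)) + exp (- c * inverse t) * (c * inverse t ^ 2) * inverse t ^ m
        = - real m * flat_exp c (m + 1) t + c * flat_exp c (m + 2) t"
      unfolding fe by (simp only: power_add power_one_right power2_eq_square) algebra
    with der have "((\<lambda>t. exp (- c * inverse t) * inverse t ^ m) has_real_derivative (- real m * flat_exp c (m + 1) t + c * flat_exp c (m + 2) t)) (at t)"
      by (simp only:)
    then show ?thesis
      by (rule has_field_derivative_transform_within_open[of _ _ _ "{0<..}"])
         (use 1 in \<open>auto simp: flat_exp_def divide_inverse power_inverse\<close>)
  next
    case 2
    have "((\<lambda>t. 0) has_real_derivative 0) (at t)" by simp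
    then have "(flat_exp c m has_real_derivative 0) (at t)"
      by (rule has_field_derivative_transform_within_open[of _ _ _ "{..<0}"]) (use 2 in \<open>auto simp: flat_exp_def\<close>)
    then show ?thesis using 2 by (simp add: flat_exp_def)
  next
    case 3
    define K where "K = real (m + 2) ^ (m + 2) / c ^ (m + 2)"
    have "(\<lambda>h. flat_exp c m h / h) \<midarrow>0\<rightarrow> 0"
    proof (rule Lim_null_comparison)
      have "norm (flat_exp c m h / h) \<le> K * \<bar>h\<bar>" for h
      proof (cases "h = 0")
        case False
        have "\<bar>flat_exp c m h\<bar> \<le> K * \<bar>h\<bar> * \<bar>h\<bar>" using flat_exp_bound[OF c, of m h] by (simp add: K_def power2_eq_square mult.assoc)
        then show ?thesis using False by (simp add: field_simps)
      qed simp
      then show "\<forall>\<^sub>F h in at 0. norm (flat_exp c m h / h) \<le> K * \<bar>h\<bar>" by simp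
      show "(\<lambda>h. K * \<bar>h\<bar>) \<midarrow>0\<rightarrow> 0" by (auto intro!: tendsto_eq_intros)
    qed
    then have "(flat_exp c m has_real_derivative 0) (at 0)"
      by (simp add: has_field_derivative_iff flat_exp_def)
    then show ?thesis using 3 by (simp add: flat_exp_def)
  qed
qed

lemma partial_eq:
  assumes "(\<phi> has_derivative D) (at x)"
  shows "partial i \<phi> x = D (axis i 1)"
  unfolding partial_def using frechet_derivative_at[OF assms] by simp

lemma Ck_Suc_imp: "Ck (Suc k) \<phi> \<Longrightarrow> Ck k \<phi>"
proof (induction k arbitrary: \<phi>)
  case 0
  then show ?case by (auto simp: continuous_on_eq_continuous_at differentiable_imp_continuous_within)
next
  case (Suc k)
  have "\<forall>x. \<phi> differentiable (at x)" "\<And>i. Ck (Suc k) (partial i \<phi>)"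
    using Suc.prems unfolding Ck.simps(2)[of "Suc k" \<phi>] by blast+
  then show ?case unfolding Ck.simps(2)[of k \<phi>] using Suc.IH by blast
qed

lemma Ck_const: "Ck k (\<lambda>x. a)"
proof (induction k arbitrary: a)
  case (Suc k)
  have "partial i (\<lambda>x. a) = (\<lambda>x. 0)" for i
    by (rule ext, rule partial_eq[where D="\<lambda>v. 0"]) simp
  then show ?case using Suc by simp
qed simp

lemma Ck_add: "Ck k f \<Longrightarrow> Ck k g \<Longrightarrow> Ck k (\<lambda>x. f x + g x)"
proof (induction k arbitrary: f g)
  case (Suc k)
  have "partial i (\<lambda>x. f x + g x) = (\<lambda>x. partial i f x + partial i g x)" for i
  proof
    fix x
    have "(f has_derivative frechet_derivative f (at x)) (at x)" "(g has_derivative frechet_derivative g (at x)) (at x)"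
      using Suc.prems by (auto simp: frechet_derivative_works)
    then show "partial i (\<lambda>x. f x + g x) x = partial i f x + partial i g x"
      by (subst partial_eq[OF has_derivative_add]) (auto simp: partial_def)
  qed
  then show ?case using Suc by auto
qed (auto intro: continuous_on_add)

lemma Ck_mult: "Ck k f \<Longrightarrow> Ck k g \<Longrightarrow> Ck k (\<lambda>x. f x * g x)"
proof (induction k arbitrary: f g)
  case (Suc k)
  have "partial i (\<lambda>x. f x * g x) = (\<lambda>x. f x * partial i g x + partial i f x * g x)" for i
  proof
    fix x
    have "(f has_derivative frechet_derivative f (at x)) (at x)" "(g has_derivative frechet_derivative g (at x)) (at x)"
      using Suc.prems by (auto simp: frechet_derivative_works)
    then show "partial i (\<lambda>x. f x * g x) x = f x * partial i g x + partial i f x * g x"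
      by (subst partial_eq[OF has_derivative_mult]) (auto simp: partial_def)
  qed
  moreover have "Ck k f" "Ck k g" using Suc.prems Ck_Suc_imp by blast+
  ultimately show ?case using Suc by (auto intro!: Ck_add)
qed (auto intro: continuous_on_mult)

lemma Ck_flat_exp:
  assumes c: "0 < c"
  shows "Ck k (\<lambda>x. flat_exp c m (p + q * x $ i))"
proof (induction k arbitrary: m)
  case 0
  have "continuous_on UNIV (flat_exp c m)"
    by (intro continuous_at_imp_continuous_on ballI DERIV_isCont[OF flat_exp_derivative[OF c]])
  then show ?case
    unfolding Ck.simps by (rule continuous_on_compose2) (auto intro!: continuous_intros)
next
  case (Suc k)
  define D where "D = (\<lambda>x::point. - real m * flat_exp c (m + 1) (p + q * x $ i) + c * flat_exp c (m + 2) (p + q * x $ i))"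
  have der: "((\<lambda>x. flat_exp c m (p + q * x $ i)) has_derivative (\<lambda>v. (q * v $ i) * D x)) (at x)" for x :: point
  proof -
    have "((\<lambda>x::point. p + q * x $ i) has_derivative (\<lambda>v. q * v $ i)) (at x)"
      by (auto intro!: derivative_eq_intros bounded_linear.has_derivative[OF bounded_linear_vec_nth])
    from has_derivative_compose[OF this flat_exp_derivative[OF c, of m, unfolded has_field_derivative_def]]
    show ?thesis by (simp add: D_def mult.commute)
  qed
  have "Ck k D" unfolding D_def using Suc by (intro Ck_add Ck_mult Ck_const)
  moreover have "partial j (\<lambda>x. flat_exp c m (p + q * x $ i)) = (\<lambda>x. (if j = i then q else 0) * D x)" for j
    by (rule ext, subst partial_eq[OF der]) (auto simp: axis_def)
  ultimately show ?case using der by (auto simp: differentiable_def intro!: Ck_mult Ck_const)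
qed

lemma smooth_has_derivative:
  assumes "smooth \<phi>"
  shows "(\<phi> has_derivative (\<lambda>v. classical_grad \<phi> x \<bullet> v)) (at x)"
proof -
  have "Ck (Suc 0) \<phi>" using assms unfolding smooth_def by blast
  then have "\<phi> differentiable (at x)" by simp
  then have d: "(\<phi> has_derivative frechet_derivative \<phi> (at x)) (at x)" by (simp add: frechet_derivative_works)
  then have lin: "linear (frechet_derivative \<phi> (at x))" by (rule has_derivative_linear)
  have "frechet_derivative \<phi> (at x) v = classical_grad \<phi> x \<bullet> v" for v
  proof -
    have v: "(\<Sum>i\<in>UNIV. v $ i *\<^sub>R axis i 1) = v" using basis_expansion[of v] by (simp add: scalar_mult_eq_scaleR)
    have "frechet_derivative \<phi> (at x) (\<Sum>i\<in>UNIV. v $ i *\<^sub>R axis i 1) = (\<Sum>i\<in>UNIV. v $ i *\<^sub>R frechet_derivative \<phi> (at x) (axis i 1))"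
      by (simp add: linear_sum[OF lin] linear_scale[OF lin])
    then show ?thesis unfolding v by (simp add: classical_grad_def partial_def inner_vec_def mult.commute)
  qed
  then show ?thesis using d by presburger
qed

lemma smooth_continuous_grad:
  assumes "smooth \<phi>"
  shows "continuous_on UNIV (classical_grad \<phi>)" "continuous_on UNIV \<phi>"
proof -
  have "Ck (Suc 0) \<phi>" "Ck 0 \<phi>" using assms unfolding smooth_def by blast+
  then have "\<And>i. Ck 0 (partial i \<phi>)" and 0: "continuous_on UNIV \<phi>" by simp_all
  then show "continuous_on UNIV (classical_grad \<phi>)"
    unfolding classical_grad_def by (auto intro!: continuous_on_vec_lambda)
  show "continuous_on UNIV \<phi>" by (rule 0)
qed

lemma classical_grad_eq:
  assumes "(\<phi> has_derivative (\<lambda>v. G \<bullet> v)) (at x)"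
  shows "classical_grad \<phi> x = G"
  by (simp add: vec_eq_iff classical_grad_def partial_eq[OF assms] inner_axis)

lemma grad_outside_support:
  assumes "x \<notin> closure {x. \<phi> x \<noteq> 0}"
  shows "classical_grad \<phi> x = 0" "\<phi> x = 0"
proof -
  show "\<phi> x = 0" using assms closure_subset[of "{x. \<phi> x \<noteq> 0}"] by auto
  have "((\<lambda>x. 0) has_derivative (\<lambda>v. 0 \<bullet> v)) (at x)" by simp
  then have "(\<phi> has_derivative (\<lambda>v. 0 \<bullet> v)) (at x)"
  proof (rule has_derivative_transform_within_open[where s="- closure {x. \<phi> x \<noteq> 0}"])
    fix y assume "y \<in> - closure {x. \<phi> x \<noteq> 0}"
    then show "0 = \<phi> y" using closure_subset[of "{x. \<phi> x \<noteq> 0}"] by auto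
  qed (use assms in auto)
  then show "classical_grad \<phi> x = 0" by (rule classical_grad_eq)
qed

text \<open>A test function on the square with corner 0 and side \<open>h\<close>. As \<open>n\<close> grows it increases to the indicator
function of the open square, so that averages over squares are limits of mollifications.\<close>

definition bump :: "nat \<Rightarrow> real \<Rightarrow> point \<Rightarrow> real" where
  "bump n h z = (\<Prod>i\<in>UNIV. flat_exp (1 / real (Suc n)) 0 (z $ i) * flat_exp (1 / real (Suc n)) 0 (h - z $ i))"

lemma mem_square:
  "y \<in> box x (x + h *\<^sub>R One) \<longleftrightarrow> (\<forall>i. x $ i < y $ i \<and> y $ i < x $ i + h)"
  "y \<in> cbox x (x + h *\<^sub>R One) \<longleftrightarrow> (\<forall>i. x $ i \<le> y $ i \<and> y $ i \<le> x $ i + h)" for x y :: point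
proof -
  have "(x + h *\<^sub>R One) $ i = x $ i + h" for i
    unfolding Cart_1[symmetric] by simp
  then show "y \<in> box x (x + h *\<^sub>R One) \<longleftrightarrow> (\<forall>i. x $ i < y $ i \<and> y $ i < x $ i + h)"
    "y \<in> cbox x (x + h *\<^sub>R One) \<longleftrightarrow> (\<forall>i. x $ i \<le> y $ i \<and> y $ i \<le> x $ i + h)"
    unfolding mem_box_cart by (simp_all only:)
qed

lemma flat_exp_0_bounds:
  assumes "0 < c"
  shows "0 \<le> flat_exp c 0 t" "flat_exp c 0 t \<le> 1"
  using assms by (simp_all add: flat_exp_def)

lemma flat_exp_eq_0: "flat_exp c 0 t = 0 \<longleftrightarrow> t \<le> 0"
  by (simp add: flat_exp_def)

lemma bump_bounds: "0 \<le> bump n h z" "bump n h z \<le> 1"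
proof -
  have f: "0 \<le> flat_exp (1 / real (Suc n)) 0 t" "flat_exp (1 / real (Suc n)) 0 t \<le> 1" for t
    by (rule flat_exp_0_bounds, simp)+
  show "0 \<le> bump n h z" unfolding bump_def by (rule prod_nonneg) (intro ballI mult_nonneg_nonneg f)
  show "bump n h z \<le> 1" unfolding bump_def by (rule prod_le_1) (intro conjI mult_nonneg_nonneg mult_le_one f)
qed

lemma bump_eq_0_iff: "bump n h (y - x) = 0 \<longleftrightarrow> y \<notin> box x (x + h *\<^sub>R One)"
proof -
  have "(y $ i - x $ i \<le> 0 \<or> h - (y $ i - x $ i) \<le> 0) \<longleftrightarrow> \<not> (x $ i < y $ i \<and> y $ i < x $ i + h)" for i
    by linarith
  then show ?thesis by (simp add: bump_def flat_exp_eq_0 mem_square(1))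
qed

lemma smooth_bump: "smooth (\<lambda>y. bump n h (y - x))"
proof -
  have "Ck k (\<lambda>y. bump n h (y - x))" for k
  proof -
    have 1: "Ck k (\<lambda>y. flat_exp (1 / real (Suc n)) 0 (y $ i - x $ i))" for i
      using Ck_flat_exp[of "1 / real (Suc n)" k 0 "- x $ i" 1 i] by simp
    have 2: "Ck k (\<lambda>y. flat_exp (1 / real (Suc n)) 0 (h - (y $ i - x $ i)))" for i
      using Ck_flat_exp[of "1 / real (Suc n)" k 0 "h + x $ i" "-1" i] by (simp add: algebra_simps)
    show ?thesis unfolding bump_def UNIV_2 using 1 2 by (simp add: Ck_mult)
  qed
  then show ?thesis by (simp add: smooth_def)
qed

lemma bump_test_function:
  assumes "0 < h" "cbox x (x + h *\<^sub>R One) \<subseteq> S"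
  shows "(\<lambda>y. bump n h (y - x)) \<in> test_functions S"
proof -
  have "{y. bump n h (y - x) \<noteq> 0} = box x (x + h *\<^sub>R One)" by (simp add: bump_eq_0_iff)
  moreover have "box x (x + h *\<^sub>R One) \<noteq> {}" using assms mem_square(1)[of "x + (h/2) *\<^sub>R One" x h] by (auto simp: Cart_1[symmetric] simp del: sum_component)
  ultimately have "closure {y. bump n h (y - x) \<noteq> 0} = cbox x (x + h *\<^sub>R One)" by (simp add: closure_box)
  then show ?thesis using assms(2) smooth_bump[of n h x] unfolding test_functions_def
    by (simp only: mem_Collect_eq compact_cbox simp_thms)
qed

lemma bump_limit: "(\<lambda>n. bump n h (y - x)) \<longlonglongrightarrow> indicator (box x (x + h *\<^sub>R One)) y"
proof -
  have 0: "(\<lambda>n. flat_exp (1 / real (Suc n)) 0 t) \<longlonglongrightarrow> indicator {0<..} t" for t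
  proof (cases "0 < t")
    case True
    have "(\<lambda>n. exp (- (1 / real (Suc n)) / t)) \<longlonglongrightarrow> exp (- 0 / t)"
      by (intro tendsto_intros LIMSEQ_Suc[OF lim_1_over_n]) (use True in auto)
    then show ?thesis using True by (simp add: flat_exp_def)
  qed (simp add: flat_exp_def)
  have "(\<lambda>n. bump n h (y - x)) \<longlonglongrightarrow> (\<Prod>i\<in>UNIV. indicator {0<..} ((y - x) $ i) * indicator {0<..} (h - (y - x) $ i))"
    unfolding bump_def by (intro tendsto_prod tendsto_mult 0)
  also have "(\<Prod>i\<in>UNIV. indicator {0<..} ((y - x) $ i) * indicator {0<..} (h - (y - x) $ i)) = indicat_real (box x (x + h *\<^sub>R One)) y"
  proof -
    have "indicator {0<..} ((y - x) $ i) * indicator {0<..} (h - (y - x) $ i) = (if x $ i < y $ i \<and> y $ i < x $ i + h then 1 else (0::real))" for i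
      by (auto simp: indicator_def)
    then show ?thesis by (simp add: indicator_def mem_square(1) UNIV_2 forall_2)
  qed
  finally show ?thesis .
qed

section \<open>Weak derivatives\<close>

lemma integral_subset_support:
  fixes F :: "point \<Rightarrow> 'b::euclidean_space"
  assumes "U \<subseteq> S" "U \<in> sets lebesgue" "S \<in> sets lebesgue" "\<And>x. x \<in> S - U \<Longrightarrow> F x = 0"
  shows "(LINT x|lebesgue_on S. F x) = (LINT x|lebesgue_on U. F x)"
proof -
  have "(LINT x|lebesgue_on S. F x) = (LINT x|lebesgue. indicator S x *\<^sub>R F x)"
    using assms by (simp add: integral_restrict_space)
  also have "\<dots> = (LINT x|lebesgue. indicator U x *\<^sub>R F x)"
    by (intro Bochner_Integration.integral_cong refl) (use assms in \<open>auto simp: indicator_def\<close>)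
  also have "\<dots> = (LINT x|lebesgue_on U. F x)" using assms by (simp add: integral_restrict_space)
  finally show ?thesis .
qed

lemma integrable_subset_lebesgue:
  fixes F :: "point \<Rightarrow> 'b::euclidean_space"
  assumes "integrable (lebesgue_on S) F" "U \<subseteq> S" "U \<in> sets lebesgue" "S \<in> sets lebesgue"
  shows "integrable (lebesgue_on U) F"
proof -
  have "integrable lebesgue (\<lambda>x. indicator S x *\<^sub>R F x)" using assms by (simp add: integrable_restrict_space)
  then have "integrable lebesgue (\<lambda>x. indicator U x *\<^sub>R (indicator S x *\<^sub>R F x))"
    by (rule integrable_mult_indicator[OF assms(3)])
  also have "(\<lambda>x. indicator U x *\<^sub>R (indicator S x *\<^sub>R F x)) = (\<lambda>x. indicator U x *\<^sub>R F x)"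
    using assms(2) by (auto simp: indicator_def fun_eq_iff)
  finally show ?thesis using assms by (simp add: integrable_restrict_space)
qed

lemma L2_subset:
  assumes "f \<in> L2_on S" "U \<subseteq> S" "U \<in> sets lebesgue" "S \<in> sets lebesgue"
  shows "f \<in> L2_on U"
proof -
  have "f \<in> borel_measurable (lebesgue_on S)" "integrable (lebesgue_on S) (\<lambda>x. (norm (f x))\<^sup>2)"
    using assms(1) by (simp_all add: L2_space_def)
  then have "f \<in> borel_measurable (lebesgue_on U)" "integrable (lebesgue_on U) (\<lambda>x. (norm (f x))\<^sup>2)"
    using measurable_restrict_mono[OF _ assms(2)] integrable_subset_lebesgue[OF _ assms(2-4)] by blast+
  then show ?thesis by (simp add: L2_space_def)
qed

lemma norm_L2_mono:
  assumes f: "f \<in> L2_on S" and U: "U \<subseteq> S" "U \<in> sets lebesgue" and S: "S \<in> sets lebesgue"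
  shows "norm_L2 U f \<le> norm_L2 S f"
proof -
  have i: "integrable (lebesgue_on S) (\<lambda>x. (norm (f x))\<^sup>2)" using f by (simp add: L2_space_def)
  have "(LINT x|lebesgue. indicator U x *\<^sub>R (norm (f x))\<^sup>2) \<le> (LINT x|lebesgue. indicator S x *\<^sub>R (norm (f x))\<^sup>2)"
    using i integrable_subset_lebesgue[OF i U S] U S
    by (intro integral_mono) (auto simp: integrable_restrict_space indicator_def)
  then show ?thesis using U S by (simp add: L2_norm_def integral_restrict_space)
qed

lemma L2_integrable:
  fixes f :: "point \<Rightarrow> 'b::euclidean_space"
  assumes f: "f \<in> L2_on S" and S: "S \<in> lmeasurable"
  shows "integrable (lebesgue_on S) f"
proof (rule Bochner_Integration.integrable_bound)
  interpret finite_measure "lebesgue_on S" using S by (rule finite_measure_lebesgue_on)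
  show "integrable (lebesgue_on S) (\<lambda>x. 1 + (norm (f x))\<^sup>2)" using f by (auto simp: L2_space_def)
  show "f \<in> borel_measurable (lebesgue_on S)" using f by (simp add: L2_space_def)
  have "t \<le> 1 + t\<^sup>2" for t :: real
    using zero_le_power2[of "t - 1/2"] by (simp add: power2_eq_square algebra_simps)
  then show "AE x in lebesgue_on S. norm (f x) \<le> norm (1 + (norm (f x))\<^sup>2)" by simp
qed

lemma L2_diff:
  assumes "f \<in> L2_on S" "g \<in> L2_on S"
  shows "(\<lambda>x. f x - g x) \<in> L2_on S"
proof -
  have [measurable]: "f \<in> borel_measurable (lebesgue_on S)" "g \<in> borel_measurable (lebesgue_on S)"
    using assms by (auto simp: L2_space_def)
  have "integrable (lebesgue_on S) (\<lambda>x. (norm (f x - g x))\<^sup>2)"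
  proof (rule Bochner_Integration.integrable_bound)
    show "integrable (lebesgue_on S) (\<lambda>x. 2 * (norm (f x))\<^sup>2 + 2 * (norm (g x))\<^sup>2)"
      using assms by (auto simp: L2_space_def)
    have "(norm (f x - g x))\<^sup>2 \<le> 2 * (norm (f x))\<^sup>2 + 2 * (norm (g x))\<^sup>2" for x
    proof -
      have "(norm (f x - g x))\<^sup>2 \<le> (norm (f x) + norm (g x))\<^sup>2" by (intro power_mono norm_triangle_ineq4) simp
      also have "\<dots> \<le> 2 * (norm (f x))\<^sup>2 + 2 * (norm (g x))\<^sup>2"
        using zero_le_power2[of "norm (f x) - norm (g x)"] by (simp add: power2_eq_square algebra_simps)
      finally show ?thesis .
    qed
    then show "AE x in lebesgue_on S. norm ((norm (f x - g x))\<^sup>2) \<le> norm (2 * (norm (f x))\<^sup>2 + 2 * (norm (g x))\<^sup>2)"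
      by simp
  qed measurable
  then show ?thesis by (simp add: L2_space_def)
qed

lemma L2_component:
  fixes p :: "point \<Rightarrow> point"
  assumes "p \<in> L2_on S"
  shows "(\<lambda>x. p x $ i) \<in> L2_on S"
proof -
  have pm[measurable]: "p \<in> borel_measurable (lebesgue_on S)" using assms by (auto simp: L2_space_def)
  have m: "(\<lambda>x. p x $ i) \<in> borel_measurable (lebesgue_on S)"
    using measurable_compose[OF pm borel_measurable_continuous_onI[of "\<lambda>v::point. v $ i"]]
    by (simp add: continuous_on_component)
  have "integrable (lebesgue_on S) (\<lambda>x. (norm (p x $ i))\<^sup>2)"
  proof (rule Bochner_Integration.integrable_bound)
    show "integrable (lebesgue_on S) (\<lambda>x. (norm (p x))\<^sup>2)" using assms by (auto simp: L2_space_def)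
    show "AE x in lebesgue_on S. norm ((norm (p x $ i))\<^sup>2) \<le> norm ((norm (p x))\<^sup>2)"
    proof (intro AE_I2)
      fix x
      have "\<bar>p x $ i\<bar> \<le> norm (p x)" by (rule component_le_norm_cart)
      then show "norm ((norm (p x $ i))\<^sup>2) \<le> norm ((norm (p x))\<^sup>2)" using abs_square_le[of "p x $ i" "norm (p x)"] by simp
    qed
  qed (use m in measurable)
  then show ?thesis using m by (simp add: L2_space_def)
qed

lemma L2_const:
  assumes "S \<in> lmeasurable"
  shows "(\<lambda>_. c) \<in> L2_on S"
proof -
  interpret finite_measure "lebesgue_on S" using assms by (rule finite_measure_lebesgue_on)
  show ?thesis by (simp add: L2_space_def)
qed

lemma integrable_bounded_scale:
  fixes f :: "'a \<Rightarrow> 'b::{banach, second_countable_topology}" and k :: "'a \<Rightarrow> real"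
  assumes "integrable M f" "k \<in> borel_measurable M" "\<And>x. x \<in> space M \<Longrightarrow> \<bar>k x\<bar> \<le> K"
  shows "integrable M (\<lambda>x. k x *\<^sub>R f x)"
proof (rule Bochner_Integration.integrable_bound)
  show "integrable M (\<lambda>x. K *\<^sub>R f x)" using assms by simp
  show "AE x in M. norm (k x *\<^sub>R f x) \<le> norm (K *\<^sub>R f x)"
    using assms(3) by (auto intro!: AE_I2 mult_right_mono order_trans[OF _ abs_ge_self])
qed (use assms in measurable)

lemma compact_support_bound:
  fixes \<phi> :: "point \<Rightarrow> 'b::real_normed_vector"
  assumes "continuous_on UNIV \<phi>" "compact C" "\<And>x. x \<notin> C \<Longrightarrow> \<phi> x = 0"
  obtains K where "0 \<le> K" "\<And>x. norm (\<phi> x) \<le> K"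
proof -
  obtain K where "\<And>x. x \<in> C \<Longrightarrow> norm (\<phi> x) \<le> K"
    using compact_imp_bounded[OF compact_continuous_image[OF continuous_on_subset[OF assms(1)] assms(2)]]
    by (fastforce simp: bounded_iff)
  then have "norm (\<phi> x) \<le> max 0 K" for x using assms(3)[of x] by (cases "x \<in> C") (auto simp: le_max_iff_disj)
  then show ?thesis using that[of "max 0 K"] by simp
qed

lemma test_function_facts:
  assumes "\<phi> \<in> test_functions S"
  shows "smooth \<phi>" "\<exists>K\<ge>0. \<forall>x. \<bar>\<phi> x\<bar> \<le> K \<and> norm (classical_grad \<phi> x) \<le> K"
    "\<And>x. x \<notin> S \<Longrightarrow> \<phi> x = 0" "\<And>x. x \<notin> S \<Longrightarrow> classical_grad \<phi> x = 0"
    "\<phi> \<in> borel_measurable borel" "classical_grad \<phi> \<in> borel_measurable borel"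
proof -
  let ?C = "closure {x. \<phi> x \<noteq> 0}"
  have C: "compact ?C" "?C \<subseteq> S" and s: "smooth \<phi>" using assms by (auto simp: test_functions_def simp del: compact_closure)
  show "smooth \<phi>" by (rule s)
  obtain K where K: "0 \<le> K" "\<And>x. norm (\<phi> x) \<le> K"
    using compact_support_bound[OF smooth_continuous_grad(2)[OF s] C(1)] grad_outside_support(2)[of _ \<phi>] by blast
  obtain L where L: "0 \<le> L" "\<And>x. norm (classical_grad \<phi> x) \<le> L"
    using compact_support_bound[OF smooth_continuous_grad(1)[OF s] C(1)] grad_outside_support(1)[of _ \<phi>] by blast
  show "\<exists>K\<ge>0. \<forall>x. \<bar>\<phi> x\<bar> \<le> K \<and> norm (classical_grad \<phi> x) \<le> K"
    using K L by (intro exI[of _ "max K L"]) (auto simp: le_max_iff_disj)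
  show "\<phi> x = 0" "classical_grad \<phi> x = 0" if "x \<notin> S" for x
    using grad_outside_support[of x \<phi>] C(2) that by blast+
  show "\<phi> \<in> borel_measurable borel" "classical_grad \<phi> \<in> borel_measurable borel"
    using smooth_continuous_grad[OF s] by (auto intro: borel_measurable_continuous_onI)
qed

lemma borel_lebesgue_on: "f \<in> borel_measurable borel \<Longrightarrow> f \<in> borel_measurable (lebesgue_on S)"
  for f :: "point \<Rightarrow> 'b::euclidean_space"
  by (intro measurable_restrict_space1 measurable_completion) simp

lemma test_functions_mono: "U \<subseteq> S \<Longrightarrow> test_functions U \<subseteq> test_functions S"
  unfolding test_functions_def by blast

lemma has_weak_grad_subset:
  assumes "has_weak_grad S u p" "U \<subseteq> S" "U \<in> sets lebesgue" "S \<in> sets lebesgue"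
  shows "has_weak_grad U u p"
  unfolding has_weak_grad_def
proof (intro conjI ballI)
  show "p \<in> L2_on U" using L2_subset assms by (auto simp: has_weak_grad_def)
  fix \<phi> assume U: "\<phi> \<in> test_functions U"
  then have "\<phi> \<in> test_functions S" using test_functions_mono[OF assms(2)] by blast
  then have "(LINT x|lebesgue_on S. u x *\<^sub>R classical_grad \<phi> x) = - (LINT x|lebesgue_on S. \<phi> x *\<^sub>R p x)"
    using assms(1) by (simp add: has_weak_grad_def)
  moreover have "(LINT x|lebesgue_on S. u x *\<^sub>R classical_grad \<phi> x) = (LINT x|lebesgue_on U. u x *\<^sub>R classical_grad \<phi> x)"
    "(LINT x|lebesgue_on S. \<phi> x *\<^sub>R p x) = (LINT x|lebesgue_on U. \<phi> x *\<^sub>R p x)"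
    by (rule integral_subset_support[OF assms(2-4)]; use test_function_facts(3,4)[OF U] in auto)+
  ultimately show "(LINT x|lebesgue_on U. u x *\<^sub>R classical_grad \<phi> x) = - (LINT x|lebesgue_on U. \<phi> x *\<^sub>R p x)" by simp
qed

lemma has_weak_div_subset:
  assumes "has_weak_div S \<tau> d" "U \<subseteq> S" "U \<in> sets lebesgue" "S \<in> sets lebesgue"
  shows "has_weak_div U \<tau> d"
  unfolding has_weak_div_def
proof (intro conjI ballI)
  show "d \<in> L2_on U" using L2_subset assms by (auto simp: has_weak_div_def)
  fix \<phi> assume U: "\<phi> \<in> test_functions U"
  then have "\<phi> \<in> test_functions S" using test_functions_mono[OF assms(2)] by blast
  then have "(LINT x|lebesgue_on S. \<tau> x \<bullet> classical_grad \<phi> x) = - (LINT x|lebesgue_on S. \<phi> x * d x)"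
    using assms(1) by (simp add: has_weak_div_def)
  moreover have "(LINT x|lebesgue_on S. \<tau> x \<bullet> classical_grad \<phi> x) = (LINT x|lebesgue_on U. \<tau> x \<bullet> classical_grad \<phi> x)"
    "(LINT x|lebesgue_on S. \<phi> x * d x) = (LINT x|lebesgue_on U. \<phi> x * d x)"
    by (rule integral_subset_support[OF assms(2-4)]; use test_function_facts(3,4)[OF U] in auto)+
  ultimately show "(LINT x|lebesgue_on U. \<tau> x \<bullet> classical_grad \<phi> x) = - (LINT x|lebesgue_on U. \<phi> x * d x)" by simp
qed

text \<open>The Lebesgue differentiation theorem for squares with a corner at \<open>x\<close>, along arbitrary null sequences
of side lengths.\<close>

lemma steklov_limit:
  fixes f :: "point \<Rightarrow> real"
  assumes "integrable lebesgue f"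
  shows "AE x in lebesgue. \<forall>h. (\<forall>n. 0 < h n) \<longrightarrow> h \<longlonglongrightarrow> 0 \<longrightarrow>
       (\<lambda>n. (LINT y:cbox x (x + h n *\<^sub>R One)|lebesgue. f y) / (h n)\<^sup>2) \<longlonglongrightarrow> f x"
proof -
  have ai: "set_integrable lebesgue (cbox a b) f" for a b
    unfolding set_integrable_def using assms by (intro integrable_mult_indicator) auto
  then have "f integrable_on cbox a b" for a b by (rule set_lebesgue_integral_eq_integral(1))
  then obtain N where N: "negligible N" and
    *: "\<And>x e. x \<notin> N \<Longrightarrow> 0 < e \<Longrightarrow> \<exists>d>0. \<forall>h. 0 < h \<and> h < d \<longrightarrow>
       norm (integral (cbox x (x + h *\<^sub>R One)) f /\<^sub>R h ^ DIM(point) - f x) < e"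
    using integrable_ccontinuous_explicit[of f] by blast
  have lim: "(\<lambda>n. (LINT y:cbox x (x + h n *\<^sub>R One)|lebesgue. f y) / (h n)\<^sup>2) \<longlonglongrightarrow> f x"
    if x: "x \<notin> N" and h: "\<And>n. 0 < h n" "h \<longlonglongrightarrow> 0" for x and h :: "nat \<Rightarrow> real"
  proof (rule LIMSEQ_I)
    fix e :: real assume e: "0 < e"
    obtain d where d: "0 < d" "\<And>h. 0 < h \<Longrightarrow> h < d \<Longrightarrow> norm (integral (cbox x (x + h *\<^sub>R One)) f /\<^sub>R h ^ DIM(point) - f x) < e"
      using *[OF x e] by blast
    obtain n0 where "\<And>n. n \<ge> n0 \<Longrightarrow> h n < d"
      using order_tendstoD(2)[OF h(2) d(1)] by (auto simp: eventually_sequentially)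
    then have "norm (integral (cbox x (x + h n *\<^sub>R One)) f /\<^sub>R h n ^ 2 - f x) < e" if "n \<ge> n0" for n
      using d(2)[of "h n"] h(1) that by simp
    then show "\<exists>n0. \<forall>n\<ge>n0. norm ((LINT y:cbox x (x + h n *\<^sub>R One)|lebesgue. f y) / (h n)\<^sup>2 - f x) < e"
      using set_lebesgue_integral_eq_integral(2)[OF ai] by (auto simp: divide_inverse mult.commute)
  qed
  have "AE x in lebesgue. x \<notin> N" using N by (simp add: negligible_iff_null_sets AE_not_in)
  then show ?thesis by eventually_elim (use lim in auto)
qed

lemma bump_integral_limit:
  fixes f :: "point \<Rightarrow> real"
  assumes f: "integrable lebesgue f"
  shows "(\<lambda>n. LINT y|lebesgue. bump n h (y - x) * f y) \<longlonglongrightarrow> (LINT y:cbox x (x + h *\<^sub>R One)|lebesgue. f y)"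
proof -
  have bm: "(\<lambda>y. bump n h (y - x)) \<in> borel_measurable lebesgue" for n
    using borel_measurable_continuous_onI[OF smooth_continuous_grad(2)[OF smooth_bump, of n h x]] by (simp add: measurable_completion)
  have fm[measurable]: "f \<in> borel_measurable lebesgue" using f by simp
  have "(\<lambda>n. LINT y|lebesgue. bump n h (y - x) * f y) \<longlonglongrightarrow> (LINT y|lebesgue. indicator (box x (x + h *\<^sub>R One)) y * f y)"
  proof (rule integral_dominated_convergence[where w="\<lambda>y. norm (f y)"])
    show "AE y in lebesgue. (\<lambda>n. bump n h (y - x) * f y) \<longlonglongrightarrow> indicator (box x (x + h *\<^sub>R One)) y * f y"
      by (intro AE_I2 tendsto_mult bump_limit tendsto_const)
    show "AE y in lebesgue. norm (bump n h (y - x) * f y) \<le> norm (f y)" for n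
      using bump_bounds[of n h] by (intro AE_I2) (simp add: abs_mult mult_left_le_one_le)
    show "(\<lambda>y. bump n h (y - x) * f y) \<in> borel_measurable lebesgue" for n
      by (rule borel_measurable_times[OF bm fm])
    show "integrable lebesgue (\<lambda>y. norm (f y))" using f by (rule integrable_norm)
    show "(\<lambda>y. indicator (box x (x + h *\<^sub>R One)) y * f y) \<in> borel_measurable lebesgue"
      by (intro borel_measurable_times fm borel_measurable_indicator) simp
  qed
  also have "(LINT y|lebesgue. indicator (box x (x + h *\<^sub>R One)) y * f y) = (LINT y:cbox x (x + h *\<^sub>R One)|lebesgue. f y)"
    unfolding set_lebesgue_integral_def
  proof (rule integral_cong_AE)
    have "negligible (cbox x (x + h *\<^sub>R One) - box x (x + h *\<^sub>R One))" by (rule negligible_frontier_interval)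
    then have "AE y in lebesgue. y \<notin> cbox x (x + h *\<^sub>R One) - box x (x + h *\<^sub>R One)"
      unfolding negligible_iff_null_sets by (rule AE_not_in)
    then show "AE y in lebesgue. indicat_real (box x (x + h *\<^sub>R One)) y * f y = indicat_real (cbox x (x + h *\<^sub>R One)) y *\<^sub>R f y"
      by eventually_elim (use box_subset_cbox[of x "x + h *\<^sub>R One"] in \<open>auto simp: indicator_def\<close>)
    show "(\<lambda>y. indicat_real (box x (x + h *\<^sub>R One)) y * f y) \<in> borel_measurable lebesgue"
      by (intro borel_measurable_times fm borel_measurable_indicator) simp
    show "(\<lambda>y. indicat_real (cbox x (x + h *\<^sub>R One)) y *\<^sub>R f y) \<in> borel_measurable lebesgue"
      by (intro borel_measurable_scaleR fm borel_measurable_indicator) simp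
  qed
  finally show ?thesis .
qed

text \<open>Testing with bumps and letting them increase to the indicator function of a square shows that the
integral of \<open>d\<close> over every square in \<open>S\<close> vanishes. Almost everywhere, \<open>d\<close> is the limit of its averages
over such squares.\<close>

theorem fundamental_lemma:
  fixes d :: "point \<Rightarrow> real"
  assumes S: "open S" "bounded S" and d: "d \<in> L2_on S"
    and 0: "\<And>\<phi>. \<phi> \<in> test_functions S \<Longrightarrow> (LINT x|lebesgue_on S. \<phi> x * d x) = 0"
  shows "AE x in lebesgue_on S. d x = 0"
proof -
  have Sl: "S \<in> lmeasurable" using S by (simp add: lmeasurable_open)
  then have Sm: "S \<in> sets lebesgue" by auto
  define f where "f = (\<lambda>x. indicator S x * d x)"
  have f: "integrable lebesgue f"
    using L2_integrable[OF d Sl] Sm by (simp add: f_def integrable_restrict_space)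
  have box0: "(LINT y:cbox x (x + h *\<^sub>R One)|lebesgue. f y) = 0" if "0 < h" "cbox x (x + h *\<^sub>R One) \<subseteq> S" for x h
  proof -
    have "(LINT y|lebesgue. bump n h (y - x) * f y) = 0" for n
    proof -
      have "(LINT y|lebesgue. bump n h (y - x) * f y) = (LINT y|lebesgue_on S. bump n h (y - x) * d y)"
        using Sm by (simp add: integral_restrict_space f_def mult.left_commute)
      then show ?thesis using 0[OF bump_test_function[OF that]] by simp
    qed
    then show ?thesis using bump_integral_limit[OF f, of h x] by (simp add: LIMSEQ_const_iff)
  qed
  have zero: "d x = 0" if "x \<in> S" and
    lim: "\<forall>h. (\<forall>n. 0 < h n) \<longrightarrow> h \<longlonglongrightarrow> 0 \<longrightarrow>
       (\<lambda>n. (LINT y:cbox x (x + h n *\<^sub>R One)|lebesgue. f y) / (h n)\<^sup>2) \<longlonglongrightarrow> f x" for x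
  proof -
    obtain e where e: "0 < e" "cball x e \<subseteq> S" using S(1) \<open>x \<in> S\<close> open_contains_cball by blast
    define h where "h = (\<lambda>n::nat. (e / 2) / real (Suc n))"
    have h0: "0 < h n" for n using e by (simp add: h_def)
    have hl: "h \<longlonglongrightarrow> 0" unfolding h_def using LIMSEQ_Suc[OF lim_const_over_n[of "e/2"]] by simp
    have "cbox x (x + h n *\<^sub>R One) \<subseteq> S" for n
    proof
      fix y assume y: "y \<in> cbox x (x + h n *\<^sub>R One)"
      have "h n \<le> e / 2" using e by (simp add: h_def divide_le_eq mult_le_cancel_left1)
      moreover have "x $ i \<le> y $ i" "y $ i \<le> x $ i + h n" for i using y by (simp_all add: mem_square)
      ultimately have "\<bar>(y - x) $ i\<bar> \<le> e / 2" for i by (smt (verit) vector_minus_component)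
      from this[of 1] this[of 2] have "(\<Sum>i\<in>UNIV. \<bar>(y - x) $ i\<bar>) \<le> e" by (simp add: UNIV_2)
      then have "norm (y - x) \<le> e" using norm_le_l1_cart[of "y - x"] by linarith
      then show "y \<in> S" using e by (auto simp: dist_norm norm_minus_commute)
    qed
    then have "(\<lambda>n. (LINT y:cbox x (x + h n *\<^sub>R One)|lebesgue. f y) / (h n)\<^sup>2) = (\<lambda>n. 0)" using box0 h0 by simp
    then have "f x = 0" using lim[rule_format, OF h0 hl] by (simp only: LIMSEQ_const_iff)
    then show ?thesis using that by (simp add: f_def)
  qed
  have "AE x in lebesgue. x \<in> S \<longrightarrow> d x = 0" using steklov_limit[OF f] by eventually_elim (use zero in blast)
  then show ?thesis using Sm by (simp add: AE_restrict_space_iff)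
qed

lemma weak_div_unique:
  assumes S: "open S" "bounded S" and d: "has_weak_div S \<tau> d" "has_weak_div S \<tau> d'"
  shows "AE x in lebesgue_on S. d x = d' x"
proof -
  have Sl: "S \<in> lmeasurable" using S by (simp add: lmeasurable_open)
  have L2: "d \<in> L2_on S" "d' \<in> L2_on S" using d by (auto simp: has_weak_div_def)
  have "AE x in lebesgue_on S. d x - d' x = 0"
  proof (rule fundamental_lemma[OF S L2_diff[OF L2]])
    fix \<phi> assume \<phi>: "\<phi> \<in> test_functions S"
    obtain K where K: "\<And>x. \<bar>\<phi> x\<bar> \<le> K" using test_function_facts(2)[OF \<phi>] by blast
    have "integrable (lebesgue_on S) (\<lambda>x. \<phi> x *\<^sub>R e x)" if "e \<in> L2_on S" for e :: "point \<Rightarrow> real"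
      by (rule integrable_bounded_scale[OF L2_integrable[OF that Sl] borel_lebesgue_on[OF test_function_facts(5)[OF \<phi>]] K])
    then show "(LINT x|lebesgue_on S. \<phi> x * (d x - d' x)) = 0"
      using d \<phi> L2 unfolding has_weak_div_def by (simp add: right_diff_distrib)
  qed
  then show ?thesis by simp
qed

lemma weak_grad_unique:
  assumes S: "open S" "bounded S" and d: "has_weak_grad S u p" "has_weak_grad S u p'"
  shows "AE x in lebesgue_on S. p x = p' x"
proof -
  have Sl: "S \<in> lmeasurable" using S by (simp add: lmeasurable_open)
  have L2: "p \<in> L2_on S" "p' \<in> L2_on S" using d by (auto simp: has_weak_grad_def)
  have "AE x in lebesgue_on S. (p x - p' x) $ i = 0" for i
  proof (rule fundamental_lemma[OF S L2_component[OF L2_diff[OF L2]]])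
    fix \<phi> assume \<phi>: "\<phi> \<in> test_functions S"
    obtain K where K: "\<And>x. \<bar>\<phi> x\<bar> \<le> K" using test_function_facts(2)[OF \<phi>] by blast
    have int: "integrable (lebesgue_on S) (\<lambda>x. \<phi> x *\<^sub>R e x)" if "e \<in> L2_on S" for e :: "point \<Rightarrow> point"
      by (rule integrable_bounded_scale[OF L2_integrable[OF that Sl] borel_lebesgue_on[OF test_function_facts(5)[OF \<phi>]] K])
    have "(LINT x|lebesgue_on S. \<phi> x *\<^sub>R (p x - p' x)) = 0"
      using d \<phi> int[OF L2(1)] int[OF L2(2)] unfolding has_weak_grad_def by (simp add: scaleR_right_diff_distrib)
    then show "(LINT x|lebesgue_on S. \<phi> x * (p x - p' x) $ i) = 0"
      using integral_bounded_linear[OF bounded_linear_vec_nth[of i] int[OF L2_diff[OF L2]]] by simp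
  qed
  then have "AE x in lebesgue_on S. \<forall>i\<in>UNIV. (p x - p' x) $ i = 0" by (simp add: AE_all_countable)
  then show ?thesis by eventually_elim (simp add: vec_eq_iff)
qed

text \<open>The integral of \<open>\<psi>\<close> is translation invariant, so the integrals of all difference quotients vanish, and
the quotients converge dominatedly because \<open>\<psi>\<close> is Lipschitz.\<close>

lemma integral_derivative_compact_support:
  fixes \<psi> :: "point \<Rightarrow> real"
  assumes der: "\<And>x. (\<psi> has_derivative (\<lambda>v. G x \<bullet> v)) (at x)" and cG: "continuous_on UNIV G"
    and C: "compact C" "\<And>x. x \<notin> C \<Longrightarrow> \<psi> x = 0" "\<And>x. x \<notin> C \<Longrightarrow> G x = 0"
  shows "(LINT x|lborel. G x \<bullet> v) = 0"
proof -
  obtain K where K: "0 \<le> K" "\<And>x. norm (G x) \<le> K" using compact_support_bound[OF cG C(1,3)] by blast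
  obtain R where R: "\<And>x. x \<in> C \<Longrightarrow> norm x \<le> R" using compact_imp_bounded[OF C(1)] unfolding bounded_iff by blast
  have c\<psi>: "continuous_on UNIV \<psi>" using der by (meson differentiableI differentiable_imp_continuous_on differentiable_on_def differentiable_at_imp_differentiable_on)
  have [measurable]: "\<psi> \<in> borel_measurable borel" "G \<in> borel_measurable borel"
    using c\<psi> cG by (auto intro: borel_measurable_continuous_onI)
  define s where "s = (\<lambda>n x. real (Suc n) * (\<psi> (x + (1 / real (Suc n)) *\<^sub>R v) - \<psi> x))"
  have i\<psi>: "integrable lborel \<psi>"
  proof -
    have "integrable lborel (\<lambda>x. indicator C x *\<^sub>R \<psi> x)"
      by (rule borel_integrable_compact[OF C(1)]) (use c\<psi> continuous_on_subset in blast)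
    moreover have "(\<lambda>x. indicator C x *\<^sub>R \<psi> x) = \<psi>" using C(2) by (auto simp: indicator_def fun_eq_iff)
    ultimately show ?thesis by simp
  qed
  have tr: "integrable lborel (\<lambda>x. \<psi> (x + w))" "(LINT x|lborel. \<psi> (x + w)) = (LINT x|lborel. \<psi> x)" for w
  proof -
    have "integrable (distr lborel borel ((+) w)) \<psi>" using i\<psi> by (simp add: lborel_distr_plus)
    then show "integrable lborel (\<lambda>x. \<psi> (x + w))" by (simp add: integrable_distr_eq add.commute)
    have "(LINT x|lborel. \<psi> x) = (LINT x|distr lborel borel ((+) w). \<psi> x)" by (simp add: lborel_distr_plus)
    then show "(LINT x|lborel. \<psi> (x + w)) = (LINT x|lborel. \<psi> x)" by (simp add: integral_distr add.commute)
  qed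
  have s0: "(LINT x|lborel. s n x) = 0" for n unfolding s_def using tr i\<psi> by simp
  have lip: "\<bar>\<psi> y - \<psi> x\<bar> \<le> K * norm (y - x)" for x y
  proof -
    have "norm (\<psi> y - \<psi> x) \<le> K * norm (y - x)"
    proof (rule differentiable_bound[of UNIV \<psi> "\<lambda>x v. G x \<bullet> v" K])
      show "onorm (\<lambda>v. G x \<bullet> v) \<le> K" for x
        by (rule onorm_le) (use K(2) Cauchy_Schwarz_ineq2 mult_right_mono norm_ge_zero order_trans in \<open>metis real_norm_def\<close>)
    qed (use der in auto)
    then show ?thesis by simp
  qed
  have "(\<lambda>n. LINT x|lborel. s n x) \<longlonglongrightarrow> (LINT x|lborel. G x \<bullet> v)"
  proof (rule integral_dominated_convergence[where w="\<lambda>x. indicator (cball 0 (R + norm v)) x * (K * norm v)"])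
    show "integrable lborel (\<lambda>x::point. indicator (cball 0 (R + norm v)) x * (K * norm v))"
      using emeasure_bounded_finite[OF bounded_cball, of 0 "R + norm v"] by (intro integrable_mult_left) (simp add: integrable_indicator_iff)
    show "AE x in lborel. (\<lambda>n. s n x) \<longlonglongrightarrow> G x \<bullet> v"
    proof (rule AE_I2)
      fix x
      have "((\<lambda>t. \<psi> (x + t *\<^sub>R v)) has_real_derivative G x \<bullet> v) (at 0)"
      proof -
        have "((\<lambda>t. x + t *\<^sub>R v) has_derivative (\<lambda>h. h *\<^sub>R v)) (at 0)" by (auto intro!: derivative_eq_intros)
        from has_derivative_compose[OF this, of \<psi> "\<lambda>v. G x \<bullet> v"] der[of x]
        show ?thesis by (simp add: has_field_derivative_def mult_commute_abs)
      qed
      then have "(\<lambda>h. (\<psi> (x + h *\<^sub>R v) - \<psi> x) / h) \<midarrow>0\<rightarrow> G x \<bullet> v" by (simp add: DERIV_def)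
      moreover have "filterlim (\<lambda>n. 1 / real (Suc n)) (at 0) sequentially"
        using LIMSEQ_Suc[OF lim_1_over_n] by (auto simp: filterlim_at)
      ultimately have "((\<lambda>n. (\<psi> (x + (1 / real (Suc n)) *\<^sub>R v) - \<psi> x) / (1 / real (Suc n))) \<longlongrightarrow> G x \<bullet> v) sequentially"
        by (rule filterlim_compose)
      then show "(\<lambda>n. s n x) \<longlonglongrightarrow> G x \<bullet> v" by (simp add: s_def mult.commute)
    qed
    show "AE x in lborel. norm (s n x) \<le> indicator (cball 0 (R + norm v)) x * (K * norm v)" for n
    proof (rule AE_I2)
      fix x
      define w where "w = (1 / real (Suc n)) *\<^sub>R v"
      have w: "norm w \<le> norm v" by (simp add: w_def divide_le_eq mult_le_cancel_left1)
      have nw: "real (Suc n) * norm w = norm v" by (simp add: w_def)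
      show "norm (s n x) \<le> indicator (cball 0 (R + norm v)) x * (K * norm v)"
      proof (cases "norm x \<le> R + norm v")
        case True
        have "\<bar>s n x\<bar> = real (Suc n) * \<bar>\<psi> (x + w) - \<psi> x\<bar>"
          by (simp add: s_def w_def abs_mult del: of_nat_Suc)
        also have "\<dots> \<le> real (Suc n) * (K * norm w)"
          using lip[of "x + w" x] by (intro mult_left_mono) auto
        also have "\<dots> = K * norm v" using nw by (simp add: mult.left_commute del: of_nat_Suc)
        finally show ?thesis using True by simp
      next
        case False
        then have "\<not> norm x \<le> R" "\<not> norm (x + w) \<le> R"
          using w norm_triangle_ineq4[of "x + w" w] norm_ge_zero[of v] unfolding add_diff_cancel_right' by linarith+
        then have "\<psi> x = 0" "\<psi> (x + w) = 0" using R C(2) by blast+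
        then show ?thesis using False by (simp add: s_def w_def)
      qed
    qed
  qed (simp_all add: s_def)
  then show ?thesis unfolding s0 LIMSEQ_const_iff by simp
qed

text \<open>For each component the product rule splits the derivative of \<open>\<phi> \<tau>\<^sub>i\<close>, whose integral vanishes because
\<open>\<phi>\<close> has compact support, into the two terms of the definition of the weak divergence. The affine
expression is used on the whole plane, where \<open>\<tau>\<close> itself may be arbitrary outside \<open>U\<close>.\<close>

theorem affine_weak_div:
  fixes \<tau> :: "point \<Rightarrow> point" and A :: "2 \<Rightarrow> point"
  assumes U: "open U" "bounded U" and \<tau>: "\<And>x i. x \<in> U \<Longrightarrow> \<tau> x $ i = c i + A i \<bullet> x"
  shows "has_weak_div U \<tau> (\<lambda>_. \<Sum>i\<in>UNIV. A i $ i)"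
  unfolding has_weak_div_def
proof (intro conjI ballI)
  have Ul: "U \<in> lmeasurable" using U by (simp add: lmeasurable_open)
  then have Um: "U \<in> sets lebesgue" by auto
  show "(\<lambda>_. \<Sum>i\<in>UNIV. A i $ i) \<in> L2_on U" by (rule L2_const[OF Ul])
  fix \<phi> assume \<phi>: "\<phi> \<in> test_functions U"
  let ?C = "closure {x. \<phi> x \<noteq> 0}"
  have C: "compact ?C" "?C \<subseteq> U" and s: "smooth \<phi>" using \<phi> by (auto simp: test_functions_def simp del: compact_closure)
  define G where "G = (\<lambda>i x. (c i + A i \<bullet> x) *\<^sub>R classical_grad \<phi> x + \<phi> x *\<^sub>R A i)"
  have gz: "classical_grad \<phi> x = 0" "\<phi> x = 0" "G i x = 0" if "x \<notin> ?C" for x i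
    using grad_outside_support[OF that] by (simp_all add: G_def)
  have gU: "G i x = 0" if "x \<notin> U" for x i using gz(3)[of x i] C(2) that by blast
  have cG: "continuous_on UNIV (G i)" for i
    unfolding G_def using smooth_continuous_grad[OF s] by (auto intro!: continuous_intros)
  have G0: "(LINT x|lborel. G i x \<bullet> axis i 1) = 0" for i
  proof (rule integral_derivative_compact_support[OF _ cG C(1)])
    show "((\<lambda>x. (c i + A i \<bullet> x) * \<phi> x) has_derivative (\<lambda>v. G i x \<bullet> v)) (at x)" for x
    proof (rule has_derivative_eq_rhs[OF has_derivative_mult[OF _ smooth_has_derivative[OF s]]])
      show "((\<lambda>x. c i + A i \<bullet> x) has_derivative (\<lambda>v. A i \<bullet> v)) (at x)"
        by (auto intro!: derivative_eq_intros)
    qed (simp add: G_def inner_add_left fun_eq_iff mult.commute)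
  next
    fix x assume x: "x \<notin> ?C"
    show "(c i + A i \<bullet> x) * \<phi> x = 0" by (simp only: gz(2)[OF x] mult_zero_right)
    show "G i x = 0" by (rule gz(3)[OF x])
  qed
  have iG: "integrable lborel (\<lambda>x. G i x \<bullet> axis i 1)" for i
  proof -
    have "integrable lborel (\<lambda>x. indicator ?C x *\<^sub>R (G i x \<bullet> axis i 1))"
      by (rule borel_integrable_compact[OF C(1)]) (intro continuous_intros continuous_on_subset[OF cG], auto)
    moreover have "(\<lambda>x. indicator ?C x *\<^sub>R (G i x \<bullet> axis i 1)) = (\<lambda>x. G i x \<bullet> axis i 1)"
    proof
      fix x show "indicator ?C x *\<^sub>R (G i x \<bullet> axis i 1) = G i x \<bullet> axis i 1"
        by (cases "x \<in> ?C") (simp_all only: indicator_simps gz(3) scaleR_one scaleR_zero_left inner_zero_left not_False_eq_True)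
    qed
    ultimately show ?thesis by (simp only:)
  qed
  have [measurable]: "G i \<in> borel_measurable borel" for i using cG by (auto intro: borel_measurable_continuous_onI)
  have "(LINT x|lebesgue_on U. \<tau> x \<bullet> classical_grad \<phi> x) + (LINT x|lebesgue_on U. \<phi> x * (\<Sum>i\<in>UNIV. A i $ i)) = 0"
  proof -
    have [measurable]: "\<phi> \<in> borel_measurable borel" by (rule test_function_facts(5)[OF \<phi>])
    have i\<phi>: "integrable (lebesgue_on U) (\<lambda>x. \<phi> x * (\<Sum>i\<in>UNIV. A i $ i))"
    proof -
      obtain K where K: "\<And>x. \<bar>\<phi> x\<bar> \<le> K" using test_function_facts(2)[OF \<phi>] by blast
      show ?thesis
        using integrable_bounded_scale[OF L2_integrable[OF L2_const[OF Ul, of "\<Sum>i\<in>UNIV. A i $ i"] Ul] borel_lebesgue_on[OF test_function_facts(5)[OF \<phi>]] K]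
        by (simp only: real_scaleR_def)
    qed
    have sum: "\<tau> x \<bullet> classical_grad \<phi> x = (\<Sum>i\<in>UNIV. G i x \<bullet> axis i 1) - \<phi> x * (\<Sum>i\<in>UNIV. A i $ i)" if "x \<in> U" for x
      using \<tau>[OF that] by (simp add: inner_vec_def[of "\<tau> x"] G_def inner_axis sum.distrib sum_distrib_left)
    have iU: "integrable (lebesgue_on U) (\<lambda>x. \<Sum>i\<in>UNIV. G i x \<bullet> axis i 1)"
    proof -
      have "integrable lebesgue (\<lambda>x. \<Sum>i\<in>UNIV. G i x \<bullet> axis i 1)" using iG by (simp add: integrable_completion)
      then show ?thesis using Um by (simp add: integrable_restrict_space integrable_mult_indicator del: real_scaleR_def)
    qed
    have "(LINT x|lebesgue_on U. \<tau> x \<bullet> classical_grad \<phi> x) = (LINT x|lebesgue_on U. (\<Sum>i\<in>UNIV. G i x \<bullet> axis i 1) - \<phi> x * (\<Sum>i\<in>UNIV. A i $ i))"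
      by (intro Bochner_Integration.integral_cong refl) (simp add: sum)
    also have "\<dots> = (LINT x|lebesgue_on U. (\<Sum>i\<in>UNIV. G i x \<bullet> axis i 1)) - (LINT x|lebesgue_on U. \<phi> x * (\<Sum>i\<in>UNIV. A i $ i))"
      using iU i\<phi> by (rule Bochner_Integration.integral_diff)
    also have "(LINT x|lebesgue_on U. (\<Sum>i\<in>UNIV. G i x \<bullet> axis i 1)) = (LINT x|lebesgue_on UNIV. (\<Sum>i\<in>UNIV. G i x \<bullet> axis i 1))"
      by (intro integral_subset_support[symmetric] Um) (simp_all add: gU)
    also have "\<dots> = (LINT x|lborel. (\<Sum>i\<in>UNIV. G i x \<bullet> axis i 1))"
      by (simp add: integral_completion integral_restrict_space)
    also have "\<dots> = 0" using iG by (simp add: G0)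
    finally show ?thesis by simp
  qed
  then show "(LINT x|lebesgue_on U. \<tau> x \<bullet> classical_grad \<phi> x) = - (LINT x|lebesgue_on U. \<phi> x * (\<Sum>i\<in>UNIV. A i $ i))" by linarith
qed

lemma norm_L2_interior:
  fixes F :: "point \<Rightarrow> 'b::euclidean_space"
  assumes "convex T" "compact T" and F: "F \<in> borel_measurable (lebesgue_on (interior T))"
  shows "norm_L2 T F = norm_L2 (interior T) F"
proof -
  let ?U = "interior T"
  have Um: "?U \<in> sets lebesgue" by simp
  have Tm: "T \<in> sets lebesgue" using assms(2) by (simp add: lmeasurable_compact fmeasurableD)
  have "negligible (T - ?U)"
    using negligible_convex_frontier[OF assms(1)] assms(2) by (simp add: frontier_def compact_imp_closed)
  then have ae: "AE x in lebesgue. x \<notin> T - ?U" unfolding negligible_iff_null_sets by (rule AE_not_in)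
  have m1: "(\<lambda>x. indicator ?U x *\<^sub>R (norm (F x))\<^sup>2) \<in> borel_measurable lebesgue"
    using borel_measurable_restrict_space_iff[of ?U lebesgue "\<lambda>x. (norm (F x))\<^sup>2"] F Um by simp
  have ae': "AE x in lebesgue. indicator ?U x *\<^sub>R (norm (F x))\<^sup>2 = indicator T x *\<^sub>R (norm (F x))\<^sup>2"
    using ae by eventually_elim (use interior_subset[of T] in \<open>auto simp: indicator_def\<close>)
  have m2: "(\<lambda>x. indicator T x *\<^sub>R (norm (F x))\<^sup>2) \<in> borel_measurable lebesgue"
    by (rule borel_measurable_AE[OF m1 ae'])
  have "(LINT x|lebesgue. indicator ?U x *\<^sub>R (norm (F x))\<^sup>2) = (LINT x|lebesgue. indicator T x *\<^sub>R (norm (F x))\<^sup>2)"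
    by (rule integral_cong_AE[OF m1 m2 ae'])
  then show ?thesis using Um Tm by (simp add: L2_norm_def integral_restrict_space)
qed

lemma norm_L2_cong_AE:
  assumes "AE x in lebesgue_on S. F x = G x" "F \<in> borel_measurable (lebesgue_on S)" "G \<in> borel_measurable (lebesgue_on S)"
  shows "norm_L2 S F = norm_L2 S G"
proof -
  note [measurable] = assms(2,3)
  have "(LINT x|lebesgue_on S. (norm (F x))\<^sup>2) = (LINT x|lebesgue_on S. (norm (G x))\<^sup>2)"
    by (rule integral_cong_AE) (use assms(1) in \<open>measurable, eventually_elim, simp\<close>)
  then show ?thesis by (simp add: L2_norm_def)
qed

text \<open>The chosen representative \<open>weak_div\<close> is as good as any known weak divergence.\<close>

lemma weak_div_eq_AE:
  assumes U: "open U" "bounded U" and d: "has_weak_div U \<tau> d"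
  shows "has_weak_div U \<tau> (weak_div U \<tau>)" "AE x in lebesgue_on U. weak_div U \<tau> x = d x"
proof -
  show w: "has_weak_div U \<tau> (weak_div U \<tau>)" unfolding weak_div_def by (rule someI[of "has_weak_div U \<tau>", OF d])
  show "AE x in lebesgue_on U. weak_div U \<tau> x = d x" by (rule weak_div_unique[OF U w d])
qed

lemma has_weak_div_diff:
  assumes U: "open U" "bounded U" and \<sigma>: "\<sigma> \<in> L2_on U" "has_weak_div U \<sigma> d" and \<tau>: "\<tau> \<in> L2_on U" "has_weak_div U \<tau> e"
  shows "has_weak_div U (\<lambda>x. \<sigma> x - \<tau> x) (\<lambda>x. d x - e x)"
  unfolding has_weak_div_def
proof (intro conjI ballI)
  have Ul: "U \<in> lmeasurable" using U by (simp add: lmeasurable_open)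
  have d: "d \<in> L2_on U" and e: "e \<in> L2_on U" using \<sigma> \<tau> by (auto simp: has_weak_div_def)
  then show "(\<lambda>x. d x - e x) \<in> L2_on U" by (rule L2_diff)
  fix \<phi> assume \<phi>: "\<phi> \<in> test_functions U"
  obtain K where K: "\<And>x. \<bar>\<phi> x\<bar> \<le> K" "\<And>x. norm (classical_grad \<phi> x) \<le> K" using test_function_facts(2)[OF \<phi>] by blast
  have 1: "integrable (lebesgue_on U) (\<lambda>x. \<phi> x * k x)" if "k \<in> L2_on U" for k :: "point \<Rightarrow> real"
    using integrable_bounded_scale[OF L2_integrable[OF that Ul] borel_lebesgue_on[OF test_function_facts(5)[OF \<phi>]] K(1)]
    by (simp only: real_scaleR_def)
  have 2: "integrable (lebesgue_on U) (\<lambda>x. s x \<bullet> classical_grad \<phi> x)" if "s \<in> L2_on U" for s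
  proof (rule Bochner_Integration.integrable_bound)
    show "integrable (lebesgue_on U) (\<lambda>x. K * norm (s x))" using L2_integrable[OF that Ul] by simp
    have "s \<in> borel_measurable (lebesgue_on U)" using that by (simp add: L2_space_def)
    then show "(\<lambda>x. s x \<bullet> classical_grad \<phi> x) \<in> borel_measurable (lebesgue_on U)"
      using borel_lebesgue_on[OF test_function_facts(6)[OF \<phi>]] by (rule borel_measurable_inner)
    show "AE x in lebesgue_on U. norm (s x \<bullet> classical_grad \<phi> x) \<le> norm (K * norm (s x))"
    proof (rule AE_I2)
      fix x
      have "\<bar>s x \<bullet> classical_grad \<phi> x\<bar> \<le> norm (s x) * norm (classical_grad \<phi> x)" by (rule Cauchy_Schwarz_ineq2)
      also have "\<dots> \<le> norm (s x) * K" by (intro mult_left_mono K) simp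
      also have "\<dots> \<le> \<bar>K * norm (s x)\<bar>" by (simp add: mult.commute)
      finally show "norm (s x \<bullet> classical_grad \<phi> x) \<le> norm (K * norm (s x))" by simp
    qed
  qed
  have "(LINT x|lebesgue_on U. (\<sigma> x - \<tau> x) \<bullet> classical_grad \<phi> x) =
     (LINT x|lebesgue_on U. \<sigma> x \<bullet> classical_grad \<phi> x) - (LINT x|lebesgue_on U. \<tau> x \<bullet> classical_grad \<phi> x)"
    unfolding inner_diff_left by (rule Bochner_Integration.integral_diff[OF 2[OF \<sigma>(1)] 2[OF \<tau>(1)]])
  also have "\<dots> = - (LINT x|lebesgue_on U. \<phi> x * d x) - - (LINT x|lebesgue_on U. \<phi> x * e x)"
    using conjunct2[OF \<sigma>(2)[unfolded has_weak_div_def], rule_format, OF \<phi>] conjunct2[OF \<tau>(2)[unfolded has_weak_div_def], rule_format, OF \<phi>] by simp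
  also have "\<dots> = - (LINT x|lebesgue_on U. \<phi> x * (d x - e x))"
    unfolding right_diff_distrib using 1[OF d] 1[OF e] by simp
  finally show "(LINT x|lebesgue_on U. (\<sigma> x - \<tau> x) \<bullet> classical_grad \<phi> x) = - (LINT x|lebesgue_on U. \<phi> x * (d x - e x))" .
qed

lemma affine_L2:
  fixes \<tau> :: "point \<Rightarrow> point"
  assumes U: "open U" "bounded U" and \<tau>: "\<And>x i. x \<in> U \<Longrightarrow> \<tau> x $ i = c i + A i \<bullet> x"
  shows "\<tau> \<in> L2_on U"
proof -
  have Ul: "U \<in> lmeasurable" using U by (simp add: lmeasurable_open)
  interpret finite_measure "lebesgue_on U" by (rule finite_measure_lebesgue_on[OF Ul])
  define \<tau>' :: "point \<Rightarrow> point" where "\<tau>' = (\<lambda>x. \<chi> i. c i + A i \<bullet> x)"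
  have eq: "\<tau> x = \<tau>' x" if "x \<in> U" for x using \<tau>[OF that] by (simp add: \<tau>'_def vec_eq_iff)
  have c: "continuous_on S \<tau>'" for S unfolding \<tau>'_def by (intro continuous_intros)
  obtain K where K: "\<And>x. x \<in> closure U \<Longrightarrow> norm (\<tau>' x) \<le> K"
    using compact_imp_bounded[OF compact_continuous_image[OF c, of "closure U"]] U(2) by (fastforce simp: bounded_iff compact_closure)
  have m: "\<tau>' \<in> borel_measurable (lebesgue_on U)" using c by (intro borel_lebesgue_on borel_measurable_continuous_onI)
  have "(\<lambda>x. (norm (\<tau>' x))\<^sup>2) \<in> borel_measurable (lebesgue_on U)" using m by measurable
  then have "integrable (lebesgue_on U) (\<lambda>x. (norm (\<tau>' x))\<^sup>2)"
    using K closure_subset by (intro integrable_const_bound[where B="K\<^sup>2"] AE_I2) (auto intro!: power_mono simp: space_restrict_space)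
  then have L: "\<tau>' \<in> L2_on U" using m by (simp add: L2_space_def)
  have "\<tau> \<in> borel_measurable (lebesgue_on U) \<longleftrightarrow> \<tau>' \<in> borel_measurable (lebesgue_on U)"
    by (rule measurable_cong) (simp add: eq)
  moreover have "integrable (lebesgue_on U) (\<lambda>x. (norm (\<tau> x))\<^sup>2) \<longleftrightarrow> integrable (lebesgue_on U) (\<lambda>x. (norm (\<tau>' x))\<^sup>2)"
    by (rule Bochner_Integration.integrable_cong) (simp_all add: eq)
  ultimately show ?thesis using L by (simp add: L2_space_def)
qed

lemma L2_norm_nonneg: "0 \<le> L2_norm M f"
  by (simp add: L2_norm_def)

text \<open>The discriminant of the nonnegative quadratic polynomial \<open>k \<mapsto> \<integral> (f + k g)\<^sup>2\<close> gives the
Cauchy-Schwarz inequality for \<open>\<integral> f g\<close>.\<close>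

lemma L2_norm_triangle:
  fixes f g :: "point \<Rightarrow> real"
  assumes f: "f \<in> L2_on S" and g: "g \<in> L2_on S"
  shows "norm_L2 S (\<lambda>x. f x + g x) \<le> norm_L2 S f + norm_L2 S g"
proof -
  define X Y Z where "X = (LINT x|lebesgue_on S. (f x)\<^sup>2)" and "Y = (LINT x|lebesgue_on S. f x * g x)" and "Z = (LINT x|lebesgue_on S. (g x)\<^sup>2)"
  have [measurable]: "f \<in> borel_measurable (lebesgue_on S)" "g \<in> borel_measurable (lebesgue_on S)"
    using f g by (auto simp: L2_space_def)
  have if2: "integrable (lebesgue_on S) (\<lambda>x. (f x)\<^sup>2)" and ig2: "integrable (lebesgue_on S) (\<lambda>x. (g x)\<^sup>2)"
    using f g by (auto simp: L2_space_def)
  have ifg: "integrable (lebesgue_on S) (\<lambda>x. f x * g x)"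
  proof (rule Bochner_Integration.integrable_bound)
    show "integrable (lebesgue_on S) (\<lambda>x. (f x)\<^sup>2 + (g x)\<^sup>2)" using if2 ig2 by simp
    have "\<bar>s * t\<bar> \<le> s\<^sup>2 + t\<^sup>2" for s t :: real
      proof -
      have "0 \<le> (\<bar>s\<bar> - \<bar>t\<bar>)\<^sup>2" by simp
      then have "2 * \<bar>s * t\<bar> \<le> s\<^sup>2 + t\<^sup>2" by (simp add: power2_diff abs_mult)
      then show ?thesis using abs_ge_zero[of "s * t"] by linarith
    qed
    then show "AE x in lebesgue_on S. norm (f x * g x) \<le> norm ((f x)\<^sup>2 + (g x)\<^sup>2)" by simp
  qed measurable
  have quad: "0 \<le> X + 2 * k * Y + k\<^sup>2 * Z" for k
  proof -
    have "0 \<le> (LINT x|lebesgue_on S. (f x + k * g x)\<^sup>2)" by (rule Bochner_Integration.integral_nonneg) simp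
    also have "\<dots> = (LINT x|lebesgue_on S. (f x)\<^sup>2 + 2 * k * (f x * g x) + k\<^sup>2 * (g x)\<^sup>2)"
      by (intro Bochner_Integration.integral_cong refl) (simp add: power2_eq_square algebra_simps)
    also have "\<dots> = X + 2 * k * Y + k\<^sup>2 * Z" using if2 ig2 ifg by (simp add: X_def Y_def Z_def)
    finally show ?thesis .
  qed
  have XZ: "0 \<le> X" "0 \<le> Z" unfolding X_def Z_def by (rule Bochner_Integration.integral_nonneg, simp)+
  have "Y\<^sup>2 \<le> X * Z"
  proof (cases "Z = 0")
    case True
    have "Y = 0"
    proof (rule ccontr)
      assume "Y \<noteq> 0"
      then have "2 * (- (X + 1) / (2 * Y)) * Y = - (X + 1)" by simp
      then show False using quad[of "- (X + 1) / (2 * Y)"] True by simp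
    qed
    then show ?thesis using True by simp
  next
    case False
    then have "(X + 2 * (- Y / Z) * Y + (- Y / Z)\<^sup>2 * Z) * Z = X * Z - Y\<^sup>2" by (simp add: power2_eq_square field_simps)
    then have "0 \<le> X * Z - Y\<^sup>2" using mult_nonneg_nonneg[OF quad[of "- Y / Z"] XZ(2)] by metis
    then show ?thesis by simp
  qed
  then have Y: "Y \<le> sqrt X * sqrt Z" using XZ by (metis real_le_rsqrt real_sqrt_mult)
  have "(LINT x|lebesgue_on S. (f x + g x)\<^sup>2) = X + 2 * Y + Z"
  proof -
    have "(LINT x|lebesgue_on S. (f x + g x)\<^sup>2) = (LINT x|lebesgue_on S. (f x)\<^sup>2 + 2 * (f x * g x) + (g x)\<^sup>2)"
      by (intro Bochner_Integration.integral_cong refl) (simp add: power2_eq_square algebra_simps)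
    then show ?thesis using if2 ig2 ifg by (simp add: X_def Y_def Z_def)
  qed
  also have "\<dots> \<le> (sqrt X + sqrt Z)\<^sup>2" using Y XZ by (simp add: power2_sum)
  finally have "sqrt (LINT x|lebesgue_on S. (f x + g x)\<^sup>2) \<le> sqrt X + sqrt Z"
    using XZ by (intro real_le_lsqrt) auto
  then show ?thesis by (simp add: L2_norm_def X_def Z_def)
qed

section \<open>Poincare inequality for weakly differentiable functions\<close>

lemma grad_lipschitz:
  assumes s: "smooth \<phi>" and C: "compact (closure {x. \<phi> x \<noteq> 0})"
  obtains L where "0 \<le> L" "\<And>x y. norm (classical_grad \<phi> x - classical_grad \<phi> y) \<le> L * norm (x - y)"
proof -
  let ?C = "closure {x. \<phi> x \<noteq> 0}"
  have sp: "smooth (partial i \<phi>)" for i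
  proof -
    have "Ck k (partial i \<phi>)" for k
    proof -
      have "Ck (Suc k) \<phi>" using s unfolding smooth_def by blast
      then show ?thesis by simp
    qed
    then show ?thesis by (simp add: smooth_def)
  qed
  have z: "classical_grad (partial i \<phi>) x = 0" if "x \<notin> ?C" for i x
  proof (rule grad_outside_support(1))
    have "{x. partial i \<phi> x \<noteq> 0} \<subseteq> ?C"
    proof
      fix y assume "y \<in> {x. partial i \<phi> x \<noteq> 0}"
      then have "classical_grad \<phi> y \<noteq> 0" by (auto simp: classical_grad_def vec_eq_iff)
      then show "y \<in> ?C" using grad_outside_support(1) by blast
    qed
    then have "closure {x. partial i \<phi> x \<noteq> 0} \<subseteq> ?C" by (simp add: closure_minimal)
    then show "x \<notin> closure {x. partial i \<phi> x \<noteq> 0}" using that by blast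
  qed
  have "\<exists>K\<ge>0. \<forall>x y. \<bar>partial i \<phi> x - partial i \<phi> y\<bar> \<le> K * norm (x - y)" for i
  proof -
    obtain K where K: "0 \<le> K" "\<And>x. norm (classical_grad (partial i \<phi>) x) \<le> K"
      using compact_support_bound[OF smooth_continuous_grad(1)[OF sp] C z] by blast
    have "norm (partial i \<phi> x - partial i \<phi> y) \<le> K * norm (x - y)" for x y
    proof (rule differentiable_bound[of UNIV _ "\<lambda>x v. classical_grad (partial i \<phi>) x \<bullet> v" K])
      show "onorm (\<lambda>v. classical_grad (partial i \<phi>) x \<bullet> v) \<le> K" for x
      proof (rule onorm_le)
        fix v :: point
        have "norm (classical_grad (partial i \<phi>) x \<bullet> v) \<le> norm (classical_grad (partial i \<phi>) x) * norm v"
          using Cauchy_Schwarz_ineq2 by simp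
        also have "\<dots> \<le> K * norm v" using K(2) by (intro mult_right_mono) auto
        finally show "norm (classical_grad (partial i \<phi>) x \<bullet> v) \<le> K * norm v" .
      qed
    qed (use smooth_has_derivative[OF sp] in auto)
    then show ?thesis using K(1) by auto
  qed
  then obtain K where K: "\<And>i. 0 \<le> K i" "\<And>i x y. \<bar>partial i \<phi> x - partial i \<phi> y\<bar> \<le> K i * norm (x - y)" by metis
  show ?thesis
  proof (rule that[of "\<Sum>i\<in>UNIV. K i"])
    show "0 \<le> (\<Sum>i\<in>UNIV. K i)" using K by (simp add: sum_nonneg)
    fix x y
    have "norm (classical_grad \<phi> x - classical_grad \<phi> y) \<le> (\<Sum>i\<in>UNIV. \<bar>(classical_grad \<phi> x - classical_grad \<phi> y) $ i\<bar>)"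
      by (rule norm_le_l1_cart)
    also have "\<dots> \<le> (\<Sum>i\<in>UNIV. K i * norm (x - y))" using K(2) by (intro sum_mono) (simp add: classical_grad_def)
    finally show "norm (classical_grad \<phi> x - classical_grad \<phi> y) \<le> (\<Sum>i\<in>UNIV. K i) * norm (x - y)"
      by (simp add: sum_distrib_right)
  qed
qed

text \<open>Differentiation under the integral sign. The gradient of \<open>\<beta>\<close> is Lipschitz, so the Taylor remainder of
\<open>\<beta>\<close> is at most quadratic uniformly in \<open>y\<close>, and integrability of \<open>f\<close> is enough.\<close>

lemma convolution_derivative:
  fixes f :: "point \<Rightarrow> real"
  assumes f: "integrable lebesgue f" and s: "smooth \<beta>" and C: "compact (closure {x. \<beta> x \<noteq> 0})"
  defines "G \<equiv> \<lambda>x. - (LINT y|lebesgue. f y *\<^sub>R classical_grad \<beta> (y - x))"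
  shows "((\<lambda>x. LINT y|lebesgue. \<beta> (y - x) * f y) has_derivative (\<lambda>v. G x \<bullet> v)) (at x)"
    and "continuous_on UNIV G"
proof -
  obtain L where L: "0 \<le> L" "\<And>x y. norm (classical_grad \<beta> x - classical_grad \<beta> y) \<le> L * norm (x - y)"
    using grad_lipschitz[OF s C] by blast
  obtain K where K: "0 \<le> K" "\<And>x. norm (classical_grad \<beta> x) \<le> K"
    using compact_support_bound[OF smooth_continuous_grad(1)[OF s] C] grad_outside_support(1)[of _ \<beta>] by blast
  obtain K' where K': "0 \<le> K'" "\<And>x. norm (\<beta> x) \<le> K'"
    using compact_support_bound[OF smooth_continuous_grad(2)[OF s] C] grad_outside_support(2)[of _ \<beta>] by blast
  have fm[measurable]: "f \<in> borel_measurable lebesgue" using f by simp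
  have c1: "continuous_on UNIV (\<lambda>y. \<beta> (y - x))" and c2: "continuous_on UNIV (\<lambda>y. classical_grad \<beta> (y - x))" for x
    by (rule continuous_on_compose2[OF smooth_continuous_grad(2)[OF s]] continuous_on_compose2[OF smooth_continuous_grad(1)[OF s]];
        auto intro!: continuous_intros)+
  have m1: "(\<lambda>y. \<beta> (y - x)) \<in> borel_measurable lebesgue" and m2: "(\<lambda>y. classical_grad \<beta> (y - x)) \<in> borel_measurable lebesgue" for x
    using borel_measurable_continuous_onI[OF c1] borel_measurable_continuous_onI[OF c2] by (auto simp: measurable_completion)
  have i1: "integrable lebesgue (\<lambda>y. \<beta> (y - x) * f y)" for x
    using integrable_bounded_scale[OF f m1, of x K'] K' by simp
  have i2: "integrable lebesgue (\<lambda>y. f y *\<^sub>R classical_grad \<beta> (y - x))" for x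
  proof (rule Bochner_Integration.integrable_bound)
    show "integrable lebesgue (\<lambda>y. K * f y)" using f by simp
    show "(\<lambda>y. f y *\<^sub>R classical_grad \<beta> (y - x)) \<in> borel_measurable lebesgue" by (rule borel_measurable_scaleR[OF fm m2])
    show "AE y in lebesgue. norm (f y *\<^sub>R classical_grad \<beta> (y - x)) \<le> norm (K * f y)"
    proof (rule AE_I2)
      fix y show "norm (f y *\<^sub>R classical_grad \<beta> (y - x)) \<le> norm (K * f y)"
        using mult_left_mono[OF K(2)[of "y - x"], of "\<bar>f y\<bar>"] K(1) by (simp add: abs_mult mult.commute)
    qed
  qed
  define F where "F = (LINT y|lebesgue. \<bar>f y\<bar>)"
  have F0: "0 \<le> F" by (simp add: F_def)
  have fa: "integrable lebesgue (\<lambda>y. \<bar>f y\<bar>)" using f by simp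
  have Gl: "norm (G x - G x') \<le> L * F * norm (x - x')" for x x'
  proof -
    have "G x - G x' = - (LINT y|lebesgue. f y *\<^sub>R classical_grad \<beta> (y - x) - f y *\<^sub>R classical_grad \<beta> (y - x'))"
      unfolding G_def using i2 by simp
    also have "norm \<dots> \<le> (LINT y|lebesgue. L * norm (x - x') * \<bar>f y\<bar>)"
      unfolding norm_minus_cancel
    proof (rule order_trans[OF integral_norm_bound integral_mono])
      show "integrable lebesgue (\<lambda>y. norm (f y *\<^sub>R classical_grad \<beta> (y - x) - f y *\<^sub>R classical_grad \<beta> (y - x')))"
        using i2 by (intro integrable_norm Bochner_Integration.integrable_diff)
      show "integrable lebesgue (\<lambda>y. L * norm (x - x') * \<bar>f y\<bar>)" using fa by simp
      fix y
      have "norm (f y *\<^sub>R classical_grad \<beta> (y - x) - f y *\<^sub>R classical_grad \<beta> (y - x')) = \<bar>f y\<bar> * norm (classical_grad \<beta> (y - x) - classical_grad \<beta> (y - x'))"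
        by (simp add: scaleR_right_diff_distrib[symmetric])
      also have "\<dots> \<le> \<bar>f y\<bar> * (L * norm ((y - x) - (y - x')))" by (intro mult_left_mono L) auto
      finally show "norm (f y *\<^sub>R classical_grad \<beta> (y - x) - f y *\<^sub>R classical_grad \<beta> (y - x')) \<le> L * norm (x - x') * \<bar>f y\<bar>"
        by (simp add: norm_minus_commute mult.commute mult.left_commute)
    qed
    also have "\<dots> = L * F * norm (x - x')" by (simp add: F_def)
    finally show ?thesis .
  qed
  have "(L * F)-lipschitz_on UNIV G" using Gl L(1) F0 by (intro lipschitz_onI) (auto simp: dist_norm)
  then show "continuous_on UNIV G" by (rule lipschitz_on_continuous_on)
  have taylor: "\<bar>\<beta> (z - v) - \<beta> z + classical_grad \<beta> z \<bullet> v\<bar> \<le> L * norm v * norm v" for z v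
  proof -
    define k where "k = (\<lambda>w. \<beta> w - classical_grad \<beta> z \<bullet> w)"
    have "norm (k (z - v) - k z) \<le> (L * norm v) * norm (z - v - z)"
    proof (rule differentiable_bound[of "cball z (norm v)" k "\<lambda>w h. (classical_grad \<beta> w - classical_grad \<beta> z) \<bullet> h"])
      fix w assume w: "w \<in> cball z (norm v)"
      have "(k has_derivative (\<lambda>h. classical_grad \<beta> w \<bullet> h - classical_grad \<beta> z \<bullet> h)) (at w)"
        unfolding k_def by (intro has_derivative_diff smooth_has_derivative[OF s]) (auto intro!: derivative_eq_intros)
      then show "(k has_derivative (\<lambda>h. (classical_grad \<beta> w - classical_grad \<beta> z) \<bullet> h)) (at w within cball z (norm v))"
        by (simp add: inner_diff_left has_derivative_at_withinI)
      show "onorm (\<lambda>h. (classical_grad \<beta> w - classical_grad \<beta> z) \<bullet> h) \<le> L * norm v"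
      proof (rule onorm_le)
        fix h :: point
        have "norm ((classical_grad \<beta> w - classical_grad \<beta> z) \<bullet> h) \<le> norm (classical_grad \<beta> w - classical_grad \<beta> z) * norm h"
          using Cauchy_Schwarz_ineq2 by simp
        also have "\<dots> \<le> (L * norm (w - z)) * norm h" by (intro mult_right_mono L) auto
        also have "\<dots> \<le> (L * norm v) * norm h"
          using w L(1) by (intro mult_right_mono mult_left_mono) (auto simp: dist_norm norm_minus_commute)
        finally show "norm ((classical_grad \<beta> w - classical_grad \<beta> z) \<bullet> h) \<le> L * norm v * norm h" .
      qed
    qed (auto simp: dist_norm)
    then show ?thesis by (simp add: k_def inner_diff_right algebra_simps)
  qed
  show "((\<lambda>x. LINT y|lebesgue. \<beta> (y - x) * f y) has_derivative (\<lambda>v. G x \<bullet> v)) (at x)"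
    unfolding has_derivative_at
  proof
    show "bounded_linear (\<lambda>v. G x \<bullet> v)" by (rule bounded_linear_inner_right)
    have rem: "\<bar>(LINT y|lebesgue. \<beta> (y - (x + v)) * f y) - (LINT y|lebesgue. \<beta> (y - x) * f y) - G x \<bullet> v\<bar> \<le> L * F * norm v * norm v" for v
    proof -
      have Gv: "G x \<bullet> v = - (LINT y|lebesgue. f y * (classical_grad \<beta> (y - x) \<bullet> v))"
      proof -
        have "(LINT y|lebesgue. (f y *\<^sub>R classical_grad \<beta> (y - x)) \<bullet> v) = (LINT y|lebesgue. f y *\<^sub>R classical_grad \<beta> (y - x)) \<bullet> v"
          by (rule integral_inner_left) (rule i2)
        then show ?thesis unfolding G_def by (simp only: inner_minus_left inner_scaleR_left)
      qed
      have i3: "integrable lebesgue (\<lambda>y. f y * (classical_grad \<beta> (y - x) \<bullet> v))"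
      proof -
        have "integrable lebesgue (\<lambda>y. (f y *\<^sub>R classical_grad \<beta> (y - x)) \<bullet> v)"
          by (rule integrable_inner_left) (rule i2)
        then show ?thesis by (simp only: inner_scaleR_left)
      qed
      have "(LINT y|lebesgue. \<beta> (y - (x + v)) * f y) - (LINT y|lebesgue. \<beta> (y - x) * f y) - G x \<bullet> v
         = (LINT y|lebesgue. \<beta> (y - (x + v)) * f y - \<beta> (y - x) * f y + f y * (classical_grad \<beta> (y - x) \<bullet> v))"
        unfolding Gv using i1 i3 by simp
      also have "norm \<dots> \<le> (LINT y|lebesgue. L * norm v * norm v * \<bar>f y\<bar>)"
      proof (rule order_trans[OF integral_norm_bound integral_mono])
        show "integrable lebesgue (\<lambda>y. norm (\<beta> (y - (x + v)) * f y - \<beta> (y - x) * f y + f y * (classical_grad \<beta> (y - x) \<bullet> v)))"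
          using i1 i3 by (intro integrable_norm Bochner_Integration.integrable_add Bochner_Integration.integrable_diff)
        show "integrable lebesgue (\<lambda>y. L * norm v * norm v * \<bar>f y\<bar>)" using fa by simp
        fix y
        have "\<beta> (y - (x + v)) * f y - \<beta> (y - x) * f y + f y * (classical_grad \<beta> (y - x) \<bullet> v)
            = (\<beta> (y - x - v) - \<beta> (y - x) + classical_grad \<beta> (y - x) \<bullet> v) * f y"
          by (simp add: algebra_simps)
        then show "norm (\<beta> (y - (x + v)) * f y - \<beta> (y - x) * f y + f y * (classical_grad \<beta> (y - x) \<bullet> v)) \<le> L * norm v * norm v * \<bar>f y\<bar>"
          using mult_right_mono[OF taylor[of "y - x" v], of "\<bar>f y\<bar>"] by (simp add: abs_mult)
      qed
      also have "\<dots> = L * F * norm v * norm v" by (simp add: F_def)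
      finally show ?thesis by simp
    qed
    show "(\<lambda>v. norm ((LINT y|lebesgue. \<beta> (y - (x + v)) * f y) - (LINT y|lebesgue. \<beta> (y - x) * f y) - G x \<bullet> v) / norm v) \<midarrow>0\<rightarrow> 0"
    proof (rule Lim_null_comparison)
      have "norm (norm ((LINT y|lebesgue. \<beta> (y - (x + v)) * f y) - (LINT y|lebesgue. \<beta> (y - x) * f y) - G x \<bullet> v) / norm v) \<le> L * F * norm v" for v
        using rem[of v] L(1) F0 by (cases "v = 0") (simp_all add: divide_le_eq)
      then show "\<forall>\<^sub>F v in at 0. norm (norm ((LINT y|lebesgue. \<beta> (y - (x + v)) * f y) - (LINT y|lebesgue. \<beta> (y - x) * f y) - G x \<bullet> v) / norm v) \<le> L * F * norm v"
        by simp
      show "(\<lambda>v. L * F * norm v) \<midarrow>0\<rightarrow> 0" by (auto intro!: tendsto_eq_intros)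
    qed
  qed
qed

lemma mean_minimizes:
  fixes u :: "'a \<Rightarrow> real"
  assumes "finite_measure M" and u: "integrable M u" "integrable M (\<lambda>x. (u x)\<^sup>2)" and pos: "0 < measure M (space M)"
  defines "\<mu> \<equiv> (LINT x|M. u x) / measure M (space M)"
  shows "(LINT x|M. (u x - \<mu>)\<^sup>2) \<le> (LINT x|M. (u x - m)\<^sup>2)"
proof -
  interpret finite_measure M by fact
  have sq: "(LINT y|M. (u y - k)\<^sup>2) = (LINT y|M. (u y)\<^sup>2) - 2 * k * (LINT y|M. u y) + k\<^sup>2 * measure M (space M)" for k
  proof -
    have "(LINT y|M. (u y - k)\<^sup>2) = (LINT y|M. (u y)\<^sup>2 - 2 * k * u y + k\<^sup>2)"
      by (simp add: power2_eq_square algebra_simps)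
    then show ?thesis using u by simp
  qed
  have A: "(LINT y|M. u y) = \<mu> * measure M (space M)" using pos by (simp add: \<mu>_def)
  have "(LINT x|M. (u x - m)\<^sup>2) - (LINT x|M. (u x - \<mu>)\<^sup>2) = measure M (space M) * (m - \<mu>)\<^sup>2"
    unfolding sq A by (simp add: power2_eq_square algebra_simps)
  moreover have "0 \<le> measure M (space M) * (m - \<mu>)\<^sup>2" by simp
  ultimately show ?thesis by linarith
qed

lemma double_integral_eq_nn_integral:
  fixes u :: "'a \<Rightarrow> real"
  assumes "finite_measure M" and u: "integrable M u" "integrable M (\<lambda>x. (u x)\<^sup>2)"
  shows "(\<integral>\<^sup>+x. \<integral>\<^sup>+y. ennreal ((u x - u y)\<^sup>2) \<partial>M \<partial>M) = ennreal (LINT x|M. LINT y|M. (u x - u y)\<^sup>2)"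
proof -
  interpret finite_measure M by fact
  have i: "integrable M (\<lambda>y. (k - u y)\<^sup>2)" for k
  proof -
    have "integrable M (\<lambda>y. k\<^sup>2 + (u y)\<^sup>2 - 2 * k * u y)" using u by simp
    then show ?thesis by (simp only: power2_diff)
  qed
  have inner: "(LINT y|M. (k - u y)\<^sup>2) = k\<^sup>2 * measure M (space M) - 2 * k * (LINT y|M. u y) + (LINT y|M. (u y)\<^sup>2)" for k
  proof -
    have "(LINT y|M. (k - u y)\<^sup>2) = (LINT y|M. k\<^sup>2 + (u y)\<^sup>2 - 2 * k * u y)" by (simp only: power2_diff)
    then show ?thesis using u by simp
  qed
  have o: "integrable M (\<lambda>x. LINT y|M. (u x - u y)\<^sup>2)" unfolding inner using u by simp
  have "(\<integral>\<^sup>+x. \<integral>\<^sup>+y. ennreal ((u x - u y)\<^sup>2) \<partial>M \<partial>M) = (\<integral>\<^sup>+x. ennreal (LINT y|M. (u x - u y)\<^sup>2) \<partial>M)"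
    by (intro nn_integral_cong nn_integral_eq_integral i) simp
  also have "\<dots> = ennreal (LINT x|M. LINT y|M. (u x - u y)\<^sup>2)"
    by (intro nn_integral_eq_integral o) simp
  finally show ?thesis .
qed

lemma measure_triangle:
  assumes "cross2 (b - a) (c - a) \<noteq> 0"
  shows "measure lborel (convex hull {a, b, c}) = \<bar>cross2 (b - a) (c - a)\<bar> / 2"
proof -
  have "(LINT s|UI. LINT y|UI. (if y \<le> s then 1 else 0)) + (LINT s|UI. LINT y|UI. (if y \<le> s then 0 else 1)) = (1::real)"
    using fold_split[of "\<lambda>_. 1" "\<lambda>_. 1" a b c] measure_UI by simp
  then have "(LINT x:convex hull {a, b, c}|lborel. 1) = \<bar>cross2 (b - a) (c - a)\<bar> / 2"
    using integral_triangle_fold[of "\<lambda>_. 1" a b c 1] assms by simp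
  then show ?thesis by (simp add: set_lebesgue_integral_def)
qed

text \<open>The form of the inequality that is passed to the limit: nonnegative integrands throughout, so that no
integrability of the limit has to be known beforehand.\<close>

lemma poincare_smooth_double:
  fixes g :: "point \<Rightarrow> real"
  assumes dg: "\<And>x. (g has_derivative (\<lambda>v. G x \<bullet> v)) (at x)" and cG: "continuous_on UNIV G"
    and d: "cross2 (b - a) (c - a) \<noteq> 0"
  defines "T \<equiv> convex hull {a, b, c}"
  shows "(\<integral>\<^sup>+x. \<integral>\<^sup>+y. indicator T x * indicator T y * ennreal ((g x - g y)\<^sup>2) \<partial>lborel \<partial>lborel) \<le>
    ennreal (2 * measure lborel T * (173/1728 * (diameter T)\<^sup>2 * (LINT x:T|lborel. (norm (G x))\<^sup>2)))"
proof -
  interpret smooth_fold g G a b c using dg cG by unfold_locales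
  have cT: "compact T" unfolding T_def by (intro compact_convex_hull finite_imp_compact) simp
  then have Tb: "T \<in> sets borel" by (intro borel_closed compact_imp_closed)
  define M where "M = restrict_space lborel T"
  have fin: "finite_measure M" unfolding M_def
    using emeasure_bounded_finite[OF compact_imp_bounded[OF cT]] Tb
    by (intro finite_measureI) (simp add: space_restrict_space emeasure_restrict_space less_top)
  have mM: "measure M (space M) = measure lborel T"
    using Tb by (simp add: M_def space_restrict_space measure_restrict_space)
  have pos: "0 < measure M (space M)" unfolding mM T_def measure_triangle[OF d] using d by simp
  have LM: "(LINT x|M. f x) = (LINT x:T|lborel. f x)" for f :: "point \<Rightarrow> real"
    using Tb by (simp add: M_def integral_restrict_space set_lebesgue_integral_def)
  have iM: "integrable M f" if "continuous_on UNIV f" for f :: "point \<Rightarrow> real"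
    using borel_integrable_compact[OF cT continuous_on_subset[OF that]] Tb
    by (simp add: M_def integrable_restrict_space)
  have ig: "integrable M g" "integrable M (\<lambda>x. (g x)\<^sup>2)" using cg by (auto intro!: iM continuous_intros)
  obtain m where m: "(LINT x:T|lborel. (g x - m)\<^sup>2) \<le> 173/1728 * (diameter T)\<^sup>2 * (LINT x:T|lborel. (norm (G x))\<^sup>2)"
    using poincare_smooth[OF d] unfolding T_def by blast
  have nnM: "(\<integral>\<^sup>+x. f x \<partial>M) = (\<integral>\<^sup>+x. indicator T x * f x \<partial>lborel)" for f :: "point \<Rightarrow> ennreal"
    using Tb by (simp add: M_def nn_integral_restrict_space mult.commute)
  have "(\<integral>\<^sup>+x. \<integral>\<^sup>+y. indicator T x * indicator T y * ennreal ((g x - g y)\<^sup>2) \<partial>lborel \<partial>lborel) =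
     (\<integral>\<^sup>+x. \<integral>\<^sup>+y. ennreal ((g x - g y)\<^sup>2) \<partial>M \<partial>M)"
    unfolding nnM by (intro nn_integral_cong) (auto simp: indicator_def)
  also have "\<dots> = ennreal (LINT x|M. LINT y|M. (g x - g y)\<^sup>2)" by (rule double_integral_eq_nn_integral[OF fin ig])
  also have "(LINT x|M. LINT y|M. (g x - g y)\<^sup>2) = 2 * measure lborel T * (LINT x|M. (g x - (LINT y|M. g y) / measure M (space M))\<^sup>2)"
    using variance_identity[OF fin ig pos] by (simp add: mM)
  also have "\<dots> \<le> 2 * measure lborel T * (173/1728 * (diameter T)\<^sup>2 * (LINT x:T|lborel. (norm (G x))\<^sup>2))"
    using order_trans[OF mean_minimizes[OF fin ig pos, of m] m[folded LM]] by (intro mult_left_mono) (auto simp: LM)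
  finally show ?thesis by (simp add: ennreal_leI)
qed

text \<open>The mollification \<open>g\<close> averages \<open>u\<close> with the density \<open>bump / h\<^sup>2\<close>, whose total mass is at most 1. As
soon as the square at \<open>x\<close> lies in \<open>U\<close>, the bump is an admissible test function, and the gradient of
\<open>g\<close> is the same average of the weak gradient \<open>p\<close>. Its square is then at most the average of
\<open>|p|\<^sup>2\<close> over the square by Cauchy-Schwarz.\<close>

lemma mollified_gradient:
  fixes u :: "point \<Rightarrow> real" and h :: real and n :: nat
  assumes U: "open U" "bounded U" and u: "u \<in> L2_on U" and w: "has_weak_grad U u p" and h: "0 < h"
  defines "g \<equiv> \<lambda>x. (LINT y|lebesgue. bump n h (y - x) * (indicator U y * u y)) / h\<^sup>2"
  obtains G where "\<And>x. (g has_derivative (\<lambda>v. G x \<bullet> v)) (at x)" "continuous_on UNIV G"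
    "\<And>x. cbox x (x + h *\<^sub>R One) \<subseteq> U \<Longrightarrow>
        (norm (G x))\<^sup>2 \<le> (LINT y:cbox x (x + h *\<^sub>R One)|lebesgue. indicator U y * (norm (p y))\<^sup>2) / h\<^sup>2"
proof -
  let ?\<beta> = "bump n h"
  have Ul: "U \<in> lmeasurable" using U by (simp add: lmeasurable_open)
  then have Um: "U \<in> sets lebesgue" by auto
  have s: "smooth ?\<beta>" using smooth_bump[of n h 0] by simp
  have C: "compact (closure {x. ?\<beta> x \<noteq> 0})"
    using bump_test_function[of h 0 UNIV n] h unfolding test_functions_def by simp
  define f where "f = (\<lambda>y. indicator U y * u y)"
  have f: "integrable lebesgue f"
    using L2_integrable[OF u Ul] Um by (simp add: f_def integrable_restrict_space)
  (* The derivative of the bump with respect to x instead of y accounts for the sign. *)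
  define G0 where "G0 = (\<lambda>x. - (LINT y|lebesgue. f y *\<^sub>R classical_grad ?\<beta> (y - x)))"
  define G where "G = (\<lambda>x. (1 / h\<^sup>2) *\<^sub>R G0 x)"
  have G1: "(g has_derivative (\<lambda>v. G x \<bullet> v)) (at x)" for x
  proof -
    have "((\<lambda>x. LINT y|lebesgue. ?\<beta> (y - x) * f y) has_derivative (\<lambda>v. G0 x \<bullet> v)) (at x)"
      unfolding G0_def by (rule convolution_derivative(1)[OF f s C])
    then have "((\<lambda>x. (1 / h\<^sup>2) *\<^sub>R (LINT y|lebesgue. ?\<beta> (y - x) * f y)) has_derivative (\<lambda>v. (1 / h\<^sup>2) *\<^sub>R (G0 x \<bullet> v))) (at x)"
      by (rule has_derivative_scaleR_right)
    then show ?thesis by (simp add: g_def f_def G_def divide_inverse mult.commute)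
  qed
  have G2: "continuous_on UNIV G"
    unfolding G_def G0_def by (intro continuous_on_scaleR continuous_on_const convolution_derivative(2)[OF f s C])
  have p2: "p \<in> L2_on U" using w by (simp add: has_weak_grad_def)
  have G3: "(norm (G x))\<^sup>2 \<le> (LINT y:cbox x (x + h *\<^sub>R One)|lebesgue. indicator U y * (norm (p y))\<^sup>2) / h\<^sup>2"
    if x: "cbox x (x + h *\<^sub>R One) \<subseteq> U" for x
  proof -
    let ?b = "box x (x + h *\<^sub>R One)"
    have bU: "?b \<subseteq> U" using x box_subset_cbox by blast
    have bm: "?b \<in> sets lebesgue" by simp
    have tf: "(\<lambda>y. ?\<beta> (y - x)) \<in> test_functions U" by (rule bump_test_function[OF h x])
    have gs: "classical_grad (\<lambda>y. ?\<beta> (y - x)) y = classical_grad ?\<beta> (y - x)" for y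
    proof (rule classical_grad_eq)
      have "((\<lambda>y. y - x) has_derivative (\<lambda>v. v)) (at y)" by (auto intro!: derivative_eq_intros)
      from has_derivative_compose[OF this smooth_has_derivative[OF s]]
      show "((\<lambda>y. ?\<beta> (y - x)) has_derivative (\<lambda>v. classical_grad ?\<beta> (y - x) \<bullet> v)) (at y)" .
    qed
    have "(LINT y|lebesgue. f y *\<^sub>R classical_grad ?\<beta> (y - x)) = (LINT y|lebesgue_on U. u y *\<^sub>R classical_grad ?\<beta> (y - x))"
      using Um by (simp add: integral_restrict_space f_def)
    also have "\<dots> = - (LINT y|lebesgue_on U. ?\<beta> (y - x) *\<^sub>R p y)"
      using conjunct2[OF w[unfolded has_weak_grad_def], rule_format, OF tf] unfolding gs by simp
    also have "(LINT y|lebesgue_on U. ?\<beta> (y - x) *\<^sub>R p y) = (LINT y|lebesgue_on ?b. ?\<beta> (y - x) *\<^sub>R p y)"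
      by (rule integral_subset_support[OF bU bm Um]) (simp add: bump_eq_0_iff)
    finally have G0: "G0 x = (LINT y|lebesgue_on ?b. ?\<beta> (y - x) *\<^sub>R p y)" by (simp add: G0_def)
    have pb: "p \<in> L2_on ?b" by (rule L2_subset[OF p2 bU bm Um])
    have bl: "?b \<in> lmeasurable" by simp
    interpret fb: finite_measure "lebesgue_on ?b" by (rule finite_measure_lebesgue_on[OF bl])
    have \<beta>m: "(\<lambda>y. ?\<beta> (y - x)) \<in> borel_measurable (lebesgue_on ?b)"
      by (rule borel_lebesgue_on[OF test_function_facts(5)[OF tf]])
    have \<beta>b: "\<bar>?\<beta> (y - x)\<bar> \<le> 1" for y using bump_bounds[of n h "y - x"] by simp
    have ip: "integrable (lebesgue_on ?b) (\<lambda>y. norm (p y))" using L2_integrable[OF pb bl] by (rule integrable_norm)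
    have ip2: "integrable (lebesgue_on ?b) (\<lambda>y. (norm (p y))\<^sup>2)" using pb by (simp add: L2_space_def)
    have i1: "integrable (lebesgue_on ?b) (\<lambda>y. ?\<beta> (y - x) * norm (p y))"
      using integrable_bounded_scale[OF ip \<beta>m \<beta>b] by (simp only: real_scaleR_def)
    have i2: "integrable (lebesgue_on ?b) (\<lambda>y. ?\<beta> (y - x) * (norm (p y))\<^sup>2)"
      using integrable_bounded_scale[OF ip2 \<beta>m \<beta>b] by (simp only: real_scaleR_def)
    have i3: "integrable (lebesgue_on ?b) (\<lambda>y. ?\<beta> (y - x))"
      using \<beta>b by (intro fb.integrable_const_bound[where B=1] AE_I2 \<beta>m) simp
    have vol: "measure (lebesgue_on ?b) (space (lebesgue_on ?b)) = h\<^sup>2"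
      using h by (simp add: space_restrict_space measure_restrict_space measure_lborel_box_eq inner_add_left DIM_cart
          box_eq_empty flip: power2_eq_square)
    have le1: "(LINT y|lebesgue_on ?b. ?\<beta> (y - x)) \<le> h\<^sup>2"
    proof -
      have "(LINT y|lebesgue_on ?b. ?\<beta> (y - x)) \<le> (LINT y|lebesgue_on ?b. 1::real)"
        using i3 bump_bounds by (intro integral_mono) auto
      also have "(LINT y|lebesgue_on ?b. 1::real) = measure (lebesgue_on ?b) (space (lebesgue_on ?b))" by simp
      finally show ?thesis unfolding vol .
    qed
    have ne: "?\<beta> (y - x) \<noteq> 0" "0 < ?\<beta> (y - x)" if "y \<in> ?b" for y
      using that bump_eq_0_iff[of n h y x] bump_bounds(1)[of n h "y - x"] by (auto simp: less_le)
    have eq: "(LINT y|lebesgue_on ?b. (?\<beta> (y - x) * norm (p y))\<^sup>2 / ?\<beta> (y - x)) = (LINT y|lebesgue_on ?b. ?\<beta> (y - x) * (norm (p y))\<^sup>2)"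
      "integrable (lebesgue_on ?b) (\<lambda>y. (?\<beta> (y - x) * norm (p y))\<^sup>2 / ?\<beta> (y - x)) = integrable (lebesgue_on ?b) (\<lambda>y. ?\<beta> (y - x) * (norm (p y))\<^sup>2)"
    proof -
      have *: "y \<in> space (lebesgue_on ?b) \<Longrightarrow> (?\<beta> (y - x) * norm (p y))\<^sup>2 / ?\<beta> (y - x) = ?\<beta> (y - x) * (norm (p y))\<^sup>2" for y
        using ne(1)[of y] by (simp add: power2_eq_square)
      show "(LINT y|lebesgue_on ?b. (?\<beta> (y - x) * norm (p y))\<^sup>2 / ?\<beta> (y - x)) = (LINT y|lebesgue_on ?b. ?\<beta> (y - x) * (norm (p y))\<^sup>2)"
        by (rule Bochner_Integration.integral_cong[OF refl *])
      show "integrable (lebesgue_on ?b) (\<lambda>y. (?\<beta> (y - x) * norm (p y))\<^sup>2 / ?\<beta> (y - x)) = integrable (lebesgue_on ?b) (\<lambda>y. ?\<beta> (y - x) * (norm (p y))\<^sup>2)"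
        by (rule Bochner_Integration.integrable_cong[OF refl *])
    qed
    have "norm (G0 x) \<le> (LINT y|lebesgue_on ?b. ?\<beta> (y - x) * norm (p y))"
      unfolding G0 by (rule order_trans[OF integral_norm_bound]) (simp add: bump_bounds)
    then have "(norm (G0 x))\<^sup>2 \<le> (LINT y|lebesgue_on ?b. ?\<beta> (y - x) * norm (p y))\<^sup>2" by (rule power_mono) simp
    also have "\<dots> \<le> h\<^sup>2 * (LINT y|lebesgue_on ?b. (?\<beta> (y - x) * norm (p y))\<^sup>2 / ?\<beta> (y - x))"
      using h i1 i3 i2 ne le1 by (intro weighted_cauchy_schwarz) (auto simp: eq)
    also have "\<dots> \<le> h\<^sup>2 * (LINT y|lebesgue_on ?b. (norm (p y))\<^sup>2)"
      unfolding eq using i2 ip2 bump_bounds by (intro mult_left_mono integral_mono) (auto intro: mult_left_le_one_le)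
    also have "(LINT y|lebesgue_on ?b. (norm (p y))\<^sup>2) \<le> (LINT y:cbox x (x + h *\<^sub>R One)|lebesgue. indicator U y * (norm (p y))\<^sup>2)"
    proof -
      have "integrable lebesgue (\<lambda>y. indicator U y * (norm (p y))\<^sup>2)"
        using p2 Um by (simp add: L2_space_def integrable_restrict_space)
      then have "integrable lebesgue (\<lambda>y. indicator (cbox x (x + h *\<^sub>R One)) y *\<^sub>R (indicator U y * (norm (p y))\<^sup>2))"
        by (rule integrable_mult_indicator[rotated]) simp
      moreover have "integrable lebesgue (\<lambda>y. indicator ?b y *\<^sub>R (norm (p y))\<^sup>2)" using ip2 by (simp add: integrable_restrict_space)
      ultimately have "(LINT y|lebesgue. indicator ?b y *\<^sub>R (norm (p y))\<^sup>2) \<le> (LINT y|lebesgue. indicator (cbox x (x + h *\<^sub>R One)) y *\<^sub>R (indicator U y * (norm (p y))\<^sup>2))"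
        using bU box_subset_cbox[of x "x + h *\<^sub>R One"] by (intro integral_mono) (auto simp: indicator_def)
      then show ?thesis by (simp add: set_lebesgue_integral_def integral_restrict_space)
    qed
    finally have "(norm (G0 x))\<^sup>2 \<le> h\<^sup>2 * (LINT y:cbox x (x + h *\<^sub>R One)|lebesgue. indicator U y * (norm (p y))\<^sup>2)"
      by (simp add: mult_left_mono)
    then show ?thesis using h by (simp add: G_def power_divide power2_eq_square field_simps)
  qed
  show ?thesis by (rule that[OF G1 G2 G3])
qed

text \<open>By Tonelli: each point \<open>y\<close> belongs to the squares of a set of corners \<open>x\<close> of area \<open>h\<^sup>2\<close>. The function
\<open>q\<close> is replaced by a Borel function first, because a Lebesgue measurable one can fail to be measurable
for the product of the Borel \<open>\<sigma>\<close>-algebras.\<close>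

lemma average_integral_bound:
  fixes q :: "point \<Rightarrow> real"
  assumes q: "integrable lebesgue q" "\<And>y. 0 \<le> q y" and h: "0 < h"
  shows "(\<integral>\<^sup>+x. ennreal (LINT y:cbox x (x + h *\<^sub>R One)|lebesgue. q y) \<partial>lborel) \<le> ennreal (h\<^sup>2 * (LINT y|lebesgue. q y))"
proof -
  have "(\<lambda>y. ennreal (q y)) \<in> borel_measurable (completion lborel)" using q by simp
  then obtain q' where [measurable]: "q' \<in> borel_measurable lborel" and q': "AE y in lborel. ennreal (q y) = q' y"
    using completion_ex_borel_measurable by blast
  define S :: "point \<Rightarrow> point \<Rightarrow> ennreal" where "S = (\<lambda>x y. (if x $ 1 \<le> y $ 1 \<and> y $ 1 \<le> x $ 1 + h \<and> x $ 2 \<le> y $ 2 \<and> y $ 2 \<le> x $ 2 + h then 1 else 0) :: ennreal)"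
  have S: "S x y = indicator (cbox x (x + h *\<^sub>R One)) y" for x y :: point
    by (auto simp: S_def indicator_def mem_square forall_2)
  have S': "S x y = indicator (cbox (y - h *\<^sub>R One) y) x" for x y :: point
    by (auto simp: S_def indicator_def mem_box_cart forall_2 Cart_1[symmetric])
  have [measurable]: "(\<lambda>x::point. x $ i) \<in> borel_measurable borel" for i
    by (intro borel_measurable_continuous_onI continuous_intros)
  have Sm[measurable]: "(\<lambda>z. S (fst z) (snd z)) \<in> borel_measurable (lborel \<Otimes>\<^sub>M lborel)"
    unfolding S_def by measurable
  have vol: "(\<integral>\<^sup>+x. S x y \<partial>lborel) = ennreal (h\<^sup>2)" for y
    unfolding S' using h by (simp add: emeasure_lborel_cbox_eq inner_diff_left DIM_cart)
  have "(\<integral>\<^sup>+x. ennreal (LINT y:cbox x (x + h *\<^sub>R One)|lebesgue. q y) \<partial>lborel) = (\<integral>\<^sup>+x. \<integral>\<^sup>+y. S x y * q' y \<partial>lborel \<partial>lborel)"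
  proof (intro nn_integral_cong)
    fix x
    have "ennreal (LINT y:cbox x (x + h *\<^sub>R One)|lebesgue. q y) = (\<integral>\<^sup>+y. ennreal (indicator (cbox x (x + h *\<^sub>R One)) y *\<^sub>R q y) \<partial>lebesgue)"
      unfolding set_lebesgue_integral_def
    proof (rule nn_integral_eq_integral[symmetric])
      show "integrable lebesgue (\<lambda>y. indicator (cbox x (x + h *\<^sub>R One)) y *\<^sub>R q y)"
        using q(1) by (intro integrable_mult_indicator) auto
    qed (simp add: q(2))
    also have "\<dots> = (\<integral>\<^sup>+y. ennreal (indicator (cbox x (x + h *\<^sub>R One)) y *\<^sub>R q y) \<partial>lborel)" by (rule nn_integral_completion)
    also have "\<dots> = (\<integral>\<^sup>+y. S x y * q' y \<partial>lborel)"
      by (rule nn_integral_cong_AE) (use q' in eventually_elim, auto simp: S indicator_def)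
    finally show "ennreal (LINT y:cbox x (x + h *\<^sub>R One)|lebesgue. q y) = (\<integral>\<^sup>+y. S x y * q' y \<partial>lborel)" .
  qed
  also have "\<dots> = (\<integral>\<^sup>+y. \<integral>\<^sup>+x. S x y * q' y \<partial>lborel \<partial>lborel)"
    using lborel_pair.Fubini'[of "\<lambda>x y. S x y * q' y"] by (simp add: split_beta')
  also have "\<dots> = (\<integral>\<^sup>+y. ennreal (h\<^sup>2) * q' y \<partial>lborel)"
  proof (intro nn_integral_cong)
    fix y
    have "(\<lambda>x. S x y) \<in> borel_measurable lborel" unfolding S' by measurable
    then show "(\<integral>\<^sup>+x. S x y * q' y \<partial>lborel) = ennreal (h\<^sup>2) * q' y" by (simp add: nn_integral_multc vol)
  qed
  also have "\<dots> = ennreal (h\<^sup>2) * (\<integral>\<^sup>+y. q' y \<partial>lborel)" by (simp add: nn_integral_cmult)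
  also have "(\<integral>\<^sup>+y. q' y \<partial>lborel) = (\<integral>\<^sup>+y. ennreal (q y) \<partial>lborel)"
    by (rule nn_integral_cong_AE) (use q' in eventually_elim, simp)
  also have "\<dots> = (\<integral>\<^sup>+y. ennreal (q y) \<partial>lebesgue)" by (rule nn_integral_completion[symmetric])
  also have "\<dots> = ennreal (LINT y|lebesgue. q y)" using q by (intro nn_integral_eq_integral) auto
  finally show ?thesis using q by (simp add: ennreal_mult)
qed

lemma fatou_double:
  fixes W :: "nat \<Rightarrow> point \<Rightarrow> point \<Rightarrow> ennreal"
  assumes W[measurable]: "\<And>n. (\<lambda>z. W n (fst z) (snd z)) \<in> borel_measurable (lborel \<Otimes>\<^sub>M lborel)"
    and K: "\<And>n. (\<integral>\<^sup>+x. \<integral>\<^sup>+y. W n x y \<partial>lborel \<partial>lborel) \<le> K"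
    and V: "AE x in lborel. AE y in lborel. V x y \<le> liminf (\<lambda>n. W n x y)"
  shows "(\<integral>\<^sup>+x. \<integral>\<^sup>+y. V x y \<partial>lborel \<partial>lborel) \<le> K"
proof -
  have m1: "W n x \<in> borel_measurable lborel" for n x
    using measurable_compose[OF measurable_Pair1'[of x lborel lborel] W[of n]] by simp
  have m2: "(\<lambda>x. \<integral>\<^sup>+y. W n x y \<partial>lborel) \<in> borel_measurable lborel" for n
    using lborel.borel_measurable_nn_integral[of "\<lambda>x y. W n x y" lborel] W[of n] by (simp add: split_beta')
  have "(\<integral>\<^sup>+x. \<integral>\<^sup>+y. V x y \<partial>lborel \<partial>lborel) \<le> (\<integral>\<^sup>+x. \<integral>\<^sup>+y. liminf (\<lambda>n. W n x y) \<partial>lborel \<partial>lborel)"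
    by (rule nn_integral_mono_AE) (use V in eventually_elim, rule nn_integral_mono_AE)
  also have "\<dots> \<le> (\<integral>\<^sup>+x. liminf (\<lambda>n. \<integral>\<^sup>+y. W n x y \<partial>lborel) \<partial>lborel)"
    by (intro nn_integral_mono nn_integral_liminf m1)
  also have "\<dots> \<le> liminf (\<lambda>n. \<integral>\<^sup>+x. \<integral>\<^sup>+y. W n x y \<partial>lborel \<partial>lborel)"
    by (rule nn_integral_liminf[OF m2])
  also have "\<dots> \<le> K" by (rule Liminf_le) (use K in simp_all)
  finally show ?thesis .
qed

definition double_variation :: "point set \<Rightarrow> (point \<Rightarrow> real) \<Rightarrow> point \<Rightarrow> point \<Rightarrow> ennreal" where
  "double_variation S f x y = indicator S x * indicator S y * ennreal ((f x - f y)\<^sup>2)"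

lemma double_variation_measurable:
  assumes "f \<in> borel_measurable borel" "S \<in> sets borel"
  shows "(\<lambda>z. double_variation S f (fst z) (snd z)) \<in> borel_measurable (lborel \<Otimes>\<^sub>M lborel)"
proof -
  note [measurable] = assms
  show ?thesis unfolding double_variation_def by measurable
qed

text \<open>The integrands of the approximating double integrals may live on sets \<open>S n\<close> that exhaust \<open>U\<close> only in
the limit.\<close>

lemma double_variation_liminf:
  assumes "(\<lambda>n. f n x) \<longlonglongrightarrow> u x" "(\<lambda>n. f n y) \<longlonglongrightarrow> u y"
    and "x \<in> U \<Longrightarrow> eventually (\<lambda>n. x \<in> S n) sequentially" "y \<in> U \<Longrightarrow> eventually (\<lambda>n. y \<in> S n) sequentially"
  shows "double_variation U u x y \<le> liminf (\<lambda>n. double_variation (S n) (f n) x y)"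
proof (cases "x \<in> U \<and> y \<in> U")
  case True
  have "(\<lambda>n. ennreal ((f n x - f n y)\<^sup>2)) \<longlonglongrightarrow> ennreal ((u x - u y)\<^sup>2)"
    by (intro tendsto_ennrealI tendsto_power tendsto_diff assms)
  moreover have "eventually (\<lambda>n. ennreal ((f n x - f n y)\<^sup>2) = double_variation (S n) (f n) x y) sequentially"
    using assms(3,4)[of] True by (auto simp: double_variation_def elim: eventually_elim2)
  ultimately have "(\<lambda>n. double_variation (S n) (f n) x y) \<longlonglongrightarrow> ennreal ((u x - u y)\<^sup>2)"
    by (rule Lim_transform_eventually)
  moreover have "double_variation U u x y = ennreal ((u x - u y)\<^sup>2)"
    using True by (simp add: double_variation_def)
  ultimately have "(\<lambda>n. double_variation (S n) (f n) x y) \<longlonglongrightarrow> double_variation U u x y" by simp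
  then show ?thesis by (simp add: lim_imp_Liminf)
qed (auto simp: double_variation_def)

text \<open>The averages of \<open>u\<close> over squares of a fixed side \<open>h\<close> need not be smooth; they are the limits of the
mollifications with the \<open>n\<close>-th bump, to which the smooth case applies. The right side refers to the larger set \<open>T\<close>, so it is the same for all the
triangles and all \<open>h\<close> that occur later.\<close>

lemma steklov_variation:
  fixes u :: "point \<Rightarrow> real"
  assumes U: "open U" "bounded U" "U \<subseteq> T" "T \<in> sets borel" "bounded T" and u: "u \<in> L2_on U" and w: "has_weak_grad U u p" and h: "0 < h"
    and d: "cross2 (b - a) (c - a) \<noteq> 0" and T': "convex hull {a, b, c} \<subseteq> U"
    and inU: "\<And>x. x \<in> convex hull {a, b, c} \<Longrightarrow> cbox x (x + h *\<^sub>R One) \<subseteq> U"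
  defines "s \<equiv> \<lambda>x. (LINT y:cbox x (x + h *\<^sub>R One)|lebesgue. indicator U y * u y) / h\<^sup>2"
  shows "s \<in> borel_measurable borel"
    and "(\<integral>\<^sup>+x. \<integral>\<^sup>+y. double_variation (convex hull {a, b, c}) s x y \<partial>lborel \<partial>lborel)
       \<le> ennreal (2 * measure lborel T * (173/1728 * (diameter T)\<^sup>2 * (LINT y|lebesgue. indicator U y * (norm (p y))\<^sup>2)))"
proof -
  let ?T = "convex hull {a, b, c}"
  have cT: "compact ?T" by (intro compact_convex_hull finite_imp_compact) simp
  then have Tb: "?T \<in> sets borel" by (intro borel_closed compact_imp_closed)
  have Ul: "U \<in> lmeasurable" using U by (simp add: lmeasurable_open)
  then have Um: "U \<in> sets lebesgue" by auto
  have f: "integrable lebesgue (\<lambda>y. indicator U y * u y)"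
    using L2_integrable[OF u Ul] Um by (simp add: integrable_restrict_space)
  define g where "g = (\<lambda>n x. (LINT y|lebesgue. bump n h (y - x) * (indicator U y * u y)) / h\<^sup>2)"
  have gl: "(\<lambda>n. g n x) \<longlonglongrightarrow> s x" for x
    unfolding g_def s_def by (intro tendsto_divide bump_integral_limit[OF f] tendsto_const) (use h in auto)
  define E where "E = (LINT y|lebesgue. indicator U y * (norm (p y))\<^sup>2)"
  have q: "integrable lebesgue (\<lambda>y. indicator U y * (norm (p y))\<^sup>2)"
    using w Um by (simp add: has_weak_grad_def L2_space_def integrable_restrict_space)
  have gn: "g n \<in> borel_measurable borel \<and> (\<integral>\<^sup>+x. \<integral>\<^sup>+y. double_variation ?T (g n) x y \<partial>lborel \<partial>lborel) \<le>
      ennreal (2 * measure lborel T * (173/1728 * (diameter T)\<^sup>2 * E))" for n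
  proof -
    obtain G where G: "\<And>x. (g n has_derivative (\<lambda>v. G x \<bullet> v)) (at x)" "continuous_on UNIV G"
      "\<And>x. cbox x (x + h *\<^sub>R One) \<subseteq> U \<Longrightarrow>
        (norm (G x))\<^sup>2 \<le> (LINT y:cbox x (x + h *\<^sub>R One)|lebesgue. indicator U y * (norm (p y))\<^sup>2) / h\<^sup>2"
      using mollified_gradient[OF U(1,2) u w h, of n] unfolding g_def by blast
    have cg: "continuous_on UNIV (g n)"
      using G(1) has_derivative_continuous_on[of UNIV "g n" "\<lambda>x v. G x \<bullet> v"] by simp
    have cG2: "continuous_on ?T (\<lambda>x. (norm (G x))\<^sup>2)"
      by (intro continuous_intros continuous_on_subset[OF G(2)]) simp
    have iG: "integrable lborel (\<lambda>x. indicator ?T x *\<^sub>R (norm (G x))\<^sup>2)"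
      by (rule borel_integrable_compact[OF cT cG2])
    have "ennreal (LINT x:?T|lborel. (norm (G x))\<^sup>2) = (\<integral>\<^sup>+x. ennreal (indicator ?T x *\<^sub>R (norm (G x))\<^sup>2) \<partial>lborel)"
      unfolding set_lebesgue_integral_def by (rule nn_integral_eq_integral[OF iG, symmetric]) simp
    also have "\<dots> \<le> (\<integral>\<^sup>+x. ennreal (LINT y:cbox x (x + h *\<^sub>R One)|lebesgue. indicator U y * (norm (p y))\<^sup>2 / h\<^sup>2) \<partial>lborel)"
    proof (intro nn_integral_mono ennreal_leI)
      fix x
      have nn: "0 \<le> (LINT y:cbox x (x + h *\<^sub>R One)|lebesgue. indicator U y * (norm (p y))\<^sup>2 / h\<^sup>2)"
        unfolding set_lebesgue_integral_def by (rule Bochner_Integration.integral_nonneg) simp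
      show "indicator ?T x *\<^sub>R (norm (G x))\<^sup>2 \<le> (LINT y:cbox x (x + h *\<^sub>R One)|lebesgue. indicator U y * (norm (p y))\<^sup>2 / h\<^sup>2)"
        using G(3)[OF inU, of x] nn by (cases "x \<in> ?T") (simp_all add: set_lebesgue_integral_def)
    qed
    also have "\<dots> \<le> ennreal (h\<^sup>2 * (LINT y|lebesgue. indicator U y * (norm (p y))\<^sup>2 / h\<^sup>2))"
      using q h by (intro average_integral_bound) auto
    also have "\<dots> = ennreal E" using h by (simp add: E_def)
    finally have GE: "(LINT x:?T|lborel. (norm (G x))\<^sup>2) \<le> E"
      by (subst (asm) ennreal_le_iff) (simp add: E_def)
    have meas: "measure lborel ?T \<le> measure lborel T"
      using T' U(3) Tb U(4) emeasure_bounded_finite[OF U(5)] by (intro measure_mono_fmeasurable) (auto simp: fmeasurable_def)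
    have diam: "(diameter ?T)\<^sup>2 \<le> (diameter T)\<^sup>2"
      using T' U(3,5) compact_imp_bounded[OF cT] by (intro power_mono diameter_subset diameter_ge_0) auto
    have "(\<integral>\<^sup>+x. \<integral>\<^sup>+y. double_variation ?T (g n) x y \<partial>lborel \<partial>lborel) \<le>
       ennreal (2 * measure lborel ?T * (173/1728 * (diameter ?T)\<^sup>2 * (LINT x:?T|lborel. (norm (G x))\<^sup>2)))"
      unfolding double_variation_def by (rule poincare_smooth_double[OF G(1,2) d])
    also have "\<dots> \<le> ennreal (2 * measure lborel T * (173/1728 * (diameter T)\<^sup>2 * E))"
      using meas diam GE by (intro ennreal_leI mult_mono) (auto simp: set_lebesgue_integral_def)
    finally show ?thesis using cg by (auto intro: borel_measurable_continuous_onI)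
  qed
  show sm: "s \<in> borel_measurable borel"
    by (rule borel_measurable_LIMSEQ_real[OF gl]) (use gn in auto)
  show "(\<integral>\<^sup>+x. \<integral>\<^sup>+y. double_variation ?T s x y \<partial>lborel \<partial>lborel)
       \<le> ennreal (2 * measure lborel T * (173/1728 * (diameter T)\<^sup>2 * (LINT y|lebesgue. indicator U y * (norm (p y))\<^sup>2)))"
    unfolding E_def[symmetric]
  proof (rule fatou_double[of "\<lambda>n. double_variation ?T (g n)"])
    show "AE x in lborel. AE y in lborel. double_variation ?T s x y \<le> liminf (\<lambda>n. double_variation ?T (g n) x y)"
      by (intro AE_I2 double_variation_liminf gl) simp_all
  qed (use gn Tb double_variation_measurable in auto)
qed

lemma shrunk_triangle_exhausts:
  fixes z x :: point
  assumes "open U" "U \<subseteq> T" "x \<in> U" "\<epsilon> \<longlonglongrightarrow> 0"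
  shows "eventually (\<lambda>n. x \<in> (\<lambda>x. \<epsilon> n *\<^sub>R z + (1 - \<epsilon> n) *\<^sub>R x) ` T) sequentially"
proof -
  have "(\<lambda>n. (1 / (1 - \<epsilon> n)) *\<^sub>R (x - \<epsilon> n *\<^sub>R z)) \<longlonglongrightarrow> (1 / (1 - 0)) *\<^sub>R (x - 0 *\<^sub>R z)"
    by (intro tendsto_intros assms) simp
  then have "eventually (\<lambda>n. (1 / (1 - \<epsilon> n)) *\<^sub>R (x - \<epsilon> n *\<^sub>R z) \<in> U) sequentially"
    using assms by (auto dest: topological_tendstoD)
  moreover have "eventually (\<lambda>n. \<epsilon> n < 1) sequentially" using order_tendstoD(2)[OF assms(4), of 1] by simp
  ultimately show ?thesis
  proof eventually_elim
    case (elim n)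
    then have "x = \<epsilon> n *\<^sub>R z + (1 - \<epsilon> n) *\<^sub>R ((1 / (1 - \<epsilon> n)) *\<^sub>R (x - \<epsilon> n *\<^sub>R z))" by simp
    then show ?case using elim assms(2) by blast
  qed
qed

text \<open>The triangle is shrunk towards an interior point with a factor that tends to 1, and on each shrunk
triangle the averages over squares of sufficiently small side satisfy the inequality with a common
right side. The averages converge to \<open>u\<close> almost everywhere, and Fatou's lemma applies once more.\<close>

theorem poincare_triangle:
  fixes u :: "point \<Rightarrow> real" and a b c :: point
  defines "T \<equiv> convex hull {a, b, c}"
  defines "U \<equiv> interior T"
  assumes d: "cross2 (b - a) (c - a) \<noteq> 0" and ne: "U \<noteq> {}" and u: "u \<in> L2_on U" and w: "has_weak_grad U u p"
  shows "(norm_L2 U (\<lambda>x. u x - (LINT y|lebesgue_on U. u y) / measure lebesgue U))\<^sup>2 \<le> 173/1728 * (diameter T)\<^sup>2 * (norm_L2 U p)\<^sup>2"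
proof -
  have cT: "compact T" unfolding T_def by (intro compact_convex_hull finite_imp_compact) simp
  then have Tb: "T \<in> sets borel" "bounded T" by (auto intro: borel_closed compact_imp_closed compact_imp_bounded)
  have cv: "convex T" by (simp add: T_def)
  have U: "open U" "U \<subseteq> T" "bounded U" unfolding U_def using interior_subset Tb(2) bounded_subset by auto
  have Ul: "U \<in> lmeasurable" using U by (simp add: lmeasurable_open)
  then have Um: "U \<in> sets lebesgue" by auto
  obtain z where z: "z \<in> U" using ne by blast
  define \<epsilon> where "\<epsilon> = (\<lambda>k::nat. 1 / real (k + 2))"
  have \<epsilon>: "0 < \<epsilon> k" "\<epsilon> k < 1" for k by (simp_all add: \<epsilon>_def)
  have \<epsilon>0: "\<epsilon> \<longlonglongrightarrow> 0" unfolding \<epsilon>_def by (rule LIMSEQ_ignore_initial_segment[OF lim_1_over_n])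
  define v where "v = (\<lambda>k x. \<epsilon> k *\<^sub>R z + (1 - \<epsilon> k) *\<^sub>R x)"
  define S where "S = (\<lambda>k. convex hull {v k a, v k b, v k c})"
  have Sv: "S k = v k ` T" for k
    using convex_hull_affinity[of "\<epsilon> k *\<^sub>R z" "1 - \<epsilon> k" "{a, b, c}"] by (simp add: S_def v_def T_def)
  have SU: "S k \<subseteq> U" for k
  proof
    fix x assume "x \<in> S k"
    then obtain y where y: "y \<in> T" "x = v k y" by (auto simp: Sv)
    have "y - \<epsilon> k *\<^sub>R (y - z) \<in> interior T"
      using cv z y(1) \<epsilon>[of k] by (intro mem_interior_convex_shrink) (auto simp: U_def)
    then show "x \<in> U" unfolding U_def y(2) v_def by (simp add: algebra_simps)
  qed
  have dk: "cross2 (v k b - v k a) (v k c - v k a) \<noteq> 0" for k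
  proof -
    have "cross2 (v k b - v k a) (v k c - v k a) = (1 - \<epsilon> k)\<^sup>2 * cross2 (b - a) (c - a)"
      by (simp add: cross2_def v_def power2_eq_square algebra_simps)
    then show ?thesis using d \<epsilon>(2)[of k] by simp
  qed
  (* The sides must tend to 0, but also keep all squares at points of S k inside U; a square of
     side e/4 lies in the ball of radius e about its corner. *)
  have "\<exists>h>0. h \<le> 1 / real (Suc k) \<and> (\<forall>x\<in>S k. cbox x (x + h *\<^sub>R One) \<subseteq> U)" for k
  proof -
    have "compact (S k)" unfolding S_def by (intro compact_convex_hull finite_imp_compact) simp
    then obtain e where e: "0 < e" "(\<Union>x\<in>S k. ball x e) \<subseteq> U"
      using compact_subset_open_imp_ball_epsilon_subset[OF _ U(1) SU] by metis
    define h where "h = min (e / 4) (1 / real (Suc k))"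
    have h: "0 < h" "h \<le> e / 4" "h \<le> 1 / real (Suc k)" using e by (auto simp: h_def)
    have "cbox x (x + h *\<^sub>R One) \<subseteq> U" if "x \<in> S k" for x
    proof
      fix y assume y: "y \<in> cbox x (x + h *\<^sub>R One)"
      have c: "\<bar>(y - x) $ i\<bar> \<le> h" for i
      proof -
        have "x $ i \<le> y $ i" "y $ i \<le> x $ i + h" using y unfolding mem_square by blast+
        then show ?thesis by simp
      qed
      have "(\<Sum>i\<in>UNIV. \<bar>(y - x) $ i\<bar>) \<le> 2 * h" using c[of 1] c[of 2] by (simp add: UNIV_2)
      then have "norm (y - x) < e" using norm_le_l1_cart[of "y - x"] h e(1) by linarith
      then have "y \<in> ball x e" by (simp add: dist_norm norm_minus_commute)
      then show "y \<in> U" using e(2) that by blast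
    qed
    then show ?thesis using h by blast
  qed
  then obtain h where h: "\<And>k. 0 < h k" "\<And>k. h k \<le> 1 / real (Suc k)" "\<And>k x. x \<in> S k \<Longrightarrow> cbox x (x + h k *\<^sub>R One) \<subseteq> U"
    by metis
  have h0: "h \<longlonglongrightarrow> 0"
    using LIMSEQ_Suc[OF lim_1_over_n] h(1,2)
    by (intro tendsto_sandwich[of "\<lambda>_. 0" h sequentially "\<lambda>k. 1 / real (Suc k)"]) (auto intro!: always_eventually less_imp_le)
  define f where "f = (\<lambda>y. indicator U y * u y)"
  have fi: "integrable lebesgue f"
    using L2_integrable[OF u Ul] Um by (simp add: f_def integrable_restrict_space)
  define s where "s = (\<lambda>k x. (LINT y:cbox x (x + h k *\<^sub>R One)|lebesgue. f y) / (h k)\<^sup>2)"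
  define E where "E = (LINT y|lebesgue. indicator U y * (norm (p y))\<^sup>2)"
  define K where "K = 2 * measure lborel T * (173/1728 * (diameter T)\<^sup>2 * E)"
  have sk: "s k \<in> borel_measurable borel" "(\<integral>\<^sup>+x. \<integral>\<^sup>+y. double_variation (S k) (s k) x y \<partial>lborel \<partial>lborel) \<le> ennreal K" for k
    using steklov_variation[OF U(1,3,2) Tb u w h(1)[of k] dk[of k] SU[of k, unfolded S_def] h(3)[of _ k, unfolded S_def]]
    unfolding s_def f_def S_def K_def E_def by blast+
  have Sb: "S k \<in> sets borel" for k
    unfolding S_def by (intro borel_closed compact_imp_closed compact_convex_hull finite_imp_compact) simp
  have lim: "AE x in lborel. (\<lambda>k. s k x) \<longlonglongrightarrow> f x"
  proof -
    have "AE x in lebesgue. (\<lambda>k. s k x) \<longlonglongrightarrow> f x"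
      using steklov_limit[OF fi] by eventually_elim (use h(1) h0 in \<open>simp add: s_def\<close>)
    then show ?thesis by (simp add: AE_completion_iff)
  qed
  have "(\<integral>\<^sup>+x. \<integral>\<^sup>+y. double_variation U f x y \<partial>lborel \<partial>lborel) \<le> ennreal K"
  proof (rule fatou_double[of "\<lambda>k. double_variation (S k) (s k)"])
    have ev: "eventually (\<lambda>k. x \<in> S k) sequentially" if "x \<in> U" for x
      using shrunk_triangle_exhausts[OF U(1,2) that \<epsilon>0, of z] unfolding Sv v_def .
    show "AE x in lborel. AE y in lborel. double_variation U f x y \<le> liminf (\<lambda>k. double_variation (S k) (s k) x y)"
      using lim
    proof eventually_elim
      case x: (elim x)
      show ?case using lim
      proof eventually_elim
        case y: (elim y)
        show ?case by (rule double_variation_liminf) (use x y ev in auto)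
      qed
    qed
  qed (use sk Sb double_variation_measurable in auto)
  moreover have "(\<integral>\<^sup>+x. \<integral>\<^sup>+y. double_variation U f x y \<partial>lborel \<partial>lborel) =
      (\<integral>\<^sup>+x. \<integral>\<^sup>+y. ennreal ((u x - u y)\<^sup>2) \<partial>lebesgue_on U \<partial>lebesgue_on U)"
  proof -
    have nnU: "(\<integral>\<^sup>+x. k x \<partial>lebesgue_on U) = (\<integral>\<^sup>+x. indicator U x * k x \<partial>lborel)" for k :: "point \<Rightarrow> ennreal"
      using Um by (simp add: nn_integral_restrict_space nn_integral_completion mult.commute)
    show ?thesis unfolding nnU
    proof (intro nn_integral_cong)
      fix x
      show "(\<integral>\<^sup>+y. double_variation U f x y \<partial>lborel) = indicator U x * (\<integral>\<^sup>+y. indicator U y * ennreal ((u x - u y)\<^sup>2) \<partial>lborel)"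
      proof (cases "x \<in> U")
        case True
        then have "double_variation U f x y = indicator U y * ennreal ((u x - u y)\<^sup>2)" for y
          by (auto simp: double_variation_def f_def indicator_def)
        then show ?thesis using True by simp
      qed (simp add: double_variation_def)
    qed
  qed
  moreover have "(\<integral>\<^sup>+x. \<integral>\<^sup>+y. ennreal ((u x - u y)\<^sup>2) \<partial>lebesgue_on U \<partial>lebesgue_on U) =
     ennreal (LINT x|lebesgue_on U. LINT y|lebesgue_on U. (u x - u y)\<^sup>2)"
    using u L2_integrable[OF u Ul] by (intro double_integral_eq_nn_integral finite_measure_lebesgue_on Ul) (auto simp: L2_space_def)
  ultimately have le: "ennreal (LINT x|lebesgue_on U. LINT y|lebesgue_on U. (u x - u y)\<^sup>2) \<le> ennreal K" by simp
  have mU: "measure (lebesgue_on U) (space (lebesgue_on U)) = measure lebesgue U"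
    using Um by (simp add: space_restrict_space measure_restrict_space)
  have pos: "0 < measure lebesgue U"
  proof -
    have "\<not> negligible U" using U(1) ne open_not_negligible by blast
    then have "measure lebesgue U \<noteq> 0" using Ul by (simp add: negligible_iff_measure)
    then show ?thesis using measure_nonneg[of lebesgue U] by linarith
  qed
  have mUT: "measure lebesgue U = measure lborel T"
  proof -
    have "negligible (frontier T)" by (rule negligible_convex_frontier[OF cv])
    then have "measure lebesgue T = measure lebesgue (interior T)"
      by (metis cT frontier_def compact_imp_closed closure_closed lmeasurable_compact interior_subset measure_negligible_symdiff sup.order_iff Un_Diff_cancel Diff_eq_empty_iff sup_bot.right_neutral measure_interior)
    then show ?thesis using Tb by (simp add: U_def)
  qed
  have E0: "0 \<le> E" unfolding E_def by (rule Bochner_Integration.integral_nonneg) simp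
  have K0: "0 \<le> K" unfolding K_def using E0 by simp
  define Var where "Var = (LINT x|lebesgue_on U. (u x - (LINT y|lebesgue_on U. u y) / measure lebesgue U)\<^sup>2)"
  have "(LINT x|lebesgue_on U. LINT y|lebesgue_on U. (u x - u y)\<^sup>2) = 2 * measure lebesgue U * Var"
  proof -
    have "integrable (lebesgue_on U) (\<lambda>x. (u x)\<^sup>2)" using u by (simp add: L2_space_def)
    moreover have "0 < measure (lebesgue_on U) (space (lebesgue_on U))" using pos by (simp only: mU)
    ultimately show ?thesis
      using variance_identity[OF finite_measure_lebesgue_on[OF Ul] L2_integrable[OF u Ul]]
      unfolding Var_def mU by blast
  qed
  then have "2 * measure lebesgue U * Var \<le> 2 * measure lebesgue U * (173/1728 * (diameter T)\<^sup>2 * E)"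
    using le K0 by (simp add: ennreal_le_iff K_def mUT)
  moreover have "0 < 2 * measure lebesgue U" using pos by simp
  ultimately have "Var \<le> 173/1728 * (diameter T)\<^sup>2 * E" by (simp only: mult_le_cancel_left_pos)
  moreover have "(norm_L2 U (\<lambda>x. u x - (LINT y|lebesgue_on U. u y) / measure lebesgue U))\<^sup>2 = Var"
    unfolding L2_norm_def Var_def by simp
  moreover have "(norm_L2 U p)\<^sup>2 = E"
    unfolding L2_norm_def E_def using Um by (simp add: integral_restrict_space)
  ultimately show ?thesis by simp
qed

section \<open>Sobolev and interpolation norms on subdomains\<close>

lemma has_weak_grad_weak_grad: "u \<in> H1 S \<Longrightarrow> has_weak_grad S u (weak_grad S u)"
  unfolding weak_grad_def H1_def by (auto intro: someI[of "has_weak_grad S u"])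

text \<open>The norm on \<open>U\<close> is defined through a chosen weak gradient on \<open>U\<close>; by uniqueness it agrees almost
everywhere with the restriction of the one chosen on \<open>S\<close>.\<close>

lemma H1_subset:
  assumes u: "u \<in> H1 S" and U: "open U" "bounded U" "U \<subseteq> S" and S: "S \<in> sets lebesgue"
  shows "u \<in> H1 U" "norm_H1 U u \<le> norm_H1 S u"
proof -
  have Um: "U \<in> sets lebesgue" using U by simp
  have uS: "u \<in> L2_on S" using u by (simp add: H1_def)
  have w: "has_weak_grad U u (weak_grad S u)" by (rule has_weak_grad_subset[OF has_weak_grad_weak_grad[OF u] U(3) Um S])
  show H: "u \<in> H1 U" using L2_subset[OF uS U(3) Um S] w by (auto simp: H1_def)
  have m: "weak_grad U u \<in> borel_measurable (lebesgue_on U)" "weak_grad S u \<in> borel_measurable (lebesgue_on U)"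
    using has_weak_grad_weak_grad[OF H] w by (auto simp: has_weak_grad_def L2_space_def)
  have "norm_L2 U (weak_grad U u) = norm_L2 U (weak_grad S u)"
    by (rule norm_L2_cong_AE[OF weak_grad_unique[OF U(1,2) has_weak_grad_weak_grad[OF H] w] m])
  also have "\<dots> \<le> norm_L2 S (weak_grad S u)"
    using has_weak_grad_weak_grad[OF u] by (intro norm_L2_mono[OF _ U(3) Um S]) (simp add: has_weak_grad_def)
  finally show "norm_H1 U u \<le> norm_H1 S u"
    unfolding norm_H1_def using norm_L2_mono[OF uS U(3) Um S]
    by (intro real_sqrt_le_mono add_mono power_mono L2_norm_nonneg)
qed

lemma zero_in_H1:
  assumes "S \<in> lmeasurable"
  shows "(\<lambda>_. 0) \<in> H1 S"
  using L2_const[OF assms, of "0::real"] L2_const[OF assms, of "0::point"]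
  by (auto simp: H1_def has_weak_grad_def)

lemma K_functional_bounds:
  assumes "0 \<le> t" "S \<in> lmeasurable"
  shows "bdd_below ((\<lambda>w. norm_L2 S (\<lambda>x. f x - w x) + t * norm_H1 S w) ` H1 S)" "0 \<le> K_functional S t f"
proof -
  have nn: "0 \<le> norm_L2 S (\<lambda>x. f x - w x) + t * norm_H1 S w" for w
    using assms(1) by (simp add: L2_norm_nonneg norm_H1_def)
  then show "bdd_below ((\<lambda>w. norm_L2 S (\<lambda>x. f x - w x) + t * norm_H1 S w) ` H1 S)" by (rule bdd_belowI2)
  show "0 \<le> K_functional S t f" unfolding K_functional_def
    by (rule cINF_greatest) (use zero_in_H1[OF assms(2)] nn in auto)
qed

text \<open>Restriction is a contraction for both norms in the K-functional. Membership of \<open>f\<close> in the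
interpolation space over the whole domain therefore makes the integral over a single triangle finite.\<close>

lemma interpolation_integral_subset:
  assumes f: "f \<in> L2_on S" and U: "open U" "bounded U" "U \<subseteq> S" and S: "S \<in> lmeasurable"
  shows "interpolation_integral s U f \<le> interpolation_integral s S f"
proof -
  have Ul: "U \<in> lmeasurable" using U by (simp add: lmeasurable_open)
  have Sm: "S \<in> sets lebesgue" and Um: "U \<in> sets lebesgue" using S Ul by auto
  have K: "K_functional U t f \<le> K_functional S t f" if t: "0 \<le> t" for t
    unfolding K_functional_def
  proof (rule cINF_mono)
    show "H1 S \<noteq> {}" using zero_in_H1[OF S] by blast
    show "bdd_below ((\<lambda>w. norm_L2 U (\<lambda>x. f x - w x) + t * norm_H1 U w) ` H1 U)" by (rule K_functional_bounds[OF t Ul])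
    fix w assume w: "w \<in> H1 S"
    have "norm_L2 U (\<lambda>x. f x - w x) \<le> norm_L2 S (\<lambda>x. f x - w x)"
      using w by (intro norm_L2_mono[OF L2_diff[OF f] U(3) Um Sm]) (simp add: H1_def)
    then show "\<exists>w'\<in>H1 U. norm_L2 U (\<lambda>x. f x - w' x) + t * norm_H1 U w' \<le> norm_L2 S (\<lambda>x. f x - w x) + t * norm_H1 S w"
      using H1_subset[OF w U Sm] t by (intro bexI[of _ w] add_mono mult_left_mono) auto
  qed
  show ?thesis unfolding interpolation_integral_def
  proof (intro nn_integral_mono)
    fix t :: real
    show "ennreal ((t powr - s * K_functional U t f)\<^sup>2 / t) * indicator {0<..} t \<le> ennreal ((t powr - s * K_functional S t f)\<^sup>2 / t) * indicator {0<..} t"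
    proof (cases "0 < t")
      case True
      then have "(t powr - s * K_functional U t f)\<^sup>2 \<le> (t powr - s * K_functional S t f)\<^sup>2"
        using K[of t] K_functional_bounds(2)[OF _ Ul, of t f] by (intro power_mono mult_left_mono) auto
      then show ?thesis using True by (simp add: ennreal_leI divide_right_mono)
    qed simp
  qed
qed

section \<open>Piecewise constant approximation on a triangle\<close>

text \<open>Numerically \<open>0.1001 < 0.1013\<close>.\<close>

lemma poincare_constant_le_inverse_pi_squared: "173/1728 \<le> (1 / pi)\<^sup>2"
proof -
  have "pi\<^sup>2 \<le> (31416/10000)\<^sup>2" using pi_approx by (intro power_mono) auto
  also have "\<dots> \<le> 1728/173" by (simp add: power2_eq_square)
  finally have "pi\<^sup>2 \<le> 1728/173" .
  then show ?thesis by (simp add: power_divide field_simps)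
qed

definition mean_value :: "point set \<Rightarrow> (point \<Rightarrow> real) \<Rightarrow> real" where
  "mean_value S f = (LINT x|lebesgue_on S. f x) / measure lebesgue S"

text \<open>Cells of a mesh are closed, while Sobolev norms and weak derivatives belong to open sets; hence the
two names.\<close>

locale triangle =
  fixes a b c :: point and T U :: "point set"
  assumes T_def: "T = convex hull {a, b, c}" and U_def: "U = interior T"
    and d: "cross2 (b - a) (c - a) \<noteq> 0" and ne: "U \<noteq> {}"
begin

lemma interior_facts: "compact T" "convex T" "open U" "bounded U" "U \<subseteq> T" "U \<in> lmeasurable" "U \<in> sets lebesgue"
  "measure (lebesgue_on U) (space (lebesgue_on U)) = measure lebesgue U" "0 < measure lebesgue U" "0 < diameter T"
proof -
  show cT: "compact T" unfolding T_def by (intro compact_convex_hull finite_imp_compact) simp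
  show "convex T" by (simp add: T_def)
  show oU: "open U" and UT: "U \<subseteq> T" by (auto simp: U_def interior_subset)
  show bU: "bounded U" using UT compact_imp_bounded[OF cT] bounded_subset by blast
  show Ul: "U \<in> lmeasurable" using oU bU by (simp add: lmeasurable_open)
  then show Um: "U \<in> sets lebesgue" by auto
  show "measure (lebesgue_on U) (space (lebesgue_on U)) = measure lebesgue U"
    using Um by (simp add: space_restrict_space measure_restrict_space)
  have "\<not> negligible U" using oU ne open_not_negligible by blast
  then have "measure lebesgue U \<noteq> 0" using Ul by (simp add: negligible_iff_measure)
  then show "0 < measure lebesgue U" using measure_nonneg[of lebesgue U] by linarith
  have "b \<noteq> a" using d by (auto simp: cross2_def)
  then have "0 < dist a b" by auto
  also have "dist a b \<le> diameter T"
    by (rule diameter_bounded_bound[OF compact_imp_bounded[OF cT]]) (auto simp: T_def hull_inc)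
  finally show "0 < diameter T" .
qed

lemma average_minimizes:
  assumes f: "f \<in> L2_on U"
  shows "norm_L2 U (\<lambda>x. f x - mean_value U f) \<le> norm_L2 U (\<lambda>x. f x - k)"
proof -
  have "integrable (lebesgue_on U) (\<lambda>x. (f x)\<^sup>2)" using f by (simp add: L2_space_def)
  then have "(LINT x|lebesgue_on U. (f x - mean_value U f)\<^sup>2) \<le> (LINT x|lebesgue_on U. (f x - k)\<^sup>2)"
    using mean_minimizes[OF finite_measure_lebesgue_on[OF interior_facts(6)] L2_integrable[OF f interior_facts(6)], of k] interior_facts(9)
    unfolding interior_facts(8) mean_value_def by blast
  then show ?thesis by (simp add: L2_norm_def)
qed

lemma poincare_H1:
  assumes w: "w \<in> H1 U"
  shows "norm_L2 U (\<lambda>x. w x - mean_value U w) \<le> diameter T / pi * norm_H1 U w"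
proof -
  have "(norm_L2 U (\<lambda>x. w x - mean_value U w))\<^sup>2 \<le> 173/1728 * (diameter T)\<^sup>2 * (norm_L2 U (weak_grad U w))\<^sup>2"
    using poincare_triangle[OF d, of w "weak_grad U w"] ne w has_weak_grad_weak_grad[OF w]
    unfolding mean_value_def U_def T_def by (simp add: H1_def)
  also have "\<dots> \<le> (1 / pi)\<^sup>2 * (diameter T)\<^sup>2 * (norm_H1 U w)\<^sup>2"
    using poincare_constant_le_inverse_pi_squared by (intro mult_mono) (auto simp: norm_H1_def)
  also have "\<dots> = (diameter T / pi * norm_H1 U w)\<^sup>2" by (simp add: power_mult_distrib power_divide)
  finally show ?thesis
    by (rule power2_le_imp_le) (use interior_facts(10) in \<open>simp add: norm_H1_def\<close>)
qed

text \<open>For any \<open>w\<close> in \<open>H\<^sup>1\<close> replace the mean of \<open>f\<close> by that of \<open>w\<close>, which can only increase the norm, and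
apply the Poincare inequality to \<open>w\<close>.\<close>

lemma average_error_le_K:
  assumes f: "f \<in> L2_on U" and t: "diameter T / pi \<le> t"
  shows "norm_L2 U (\<lambda>x. f x - mean_value U f) \<le> K_functional U t f"
  unfolding K_functional_def
proof (rule cINF_greatest)
  show "H1 U \<noteq> {}" using zero_in_H1[OF interior_facts(6)] by blast
  fix w assume w: "w \<in> H1 U"
  have w2: "w \<in> L2_on U" using w by (simp add: H1_def)
  have "norm_L2 U (\<lambda>x. f x - mean_value U f) \<le> norm_L2 U (\<lambda>x. f x - mean_value U w)" by (rule average_minimizes[OF f])
  also have "\<dots> = norm_L2 U (\<lambda>x. (f x - w x) + (w x - mean_value U w))" by simp
  also have "\<dots> \<le> norm_L2 U (\<lambda>x. f x - w x) + norm_L2 U (\<lambda>x. w x - mean_value U w)"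
    by (intro L2_norm_triangle L2_diff f w2 L2_const interior_facts(6))
  also have "norm_L2 U (\<lambda>x. w x - mean_value U w) \<le> diameter T / pi * norm_H1 U w" by (rule poincare_H1[OF w])
  also have "\<dots> \<le> t * norm_H1 U w" using t by (rule mult_right_mono) (simp add: norm_H1_def)
  finally show "norm_L2 U (\<lambda>x. f x - mean_value U f) \<le> norm_L2 U (\<lambda>x. f x - w x) + t * norm_H1 U w" by simp
qed

text \<open>With \<open>h = diameter T / \<pi>\<close>, the integral over \<open>[h, 2h]\<close> alone is at least
\<open>h (2h)\<^sup>-\<^sup>2\<^sup>s N\<^sup>2 / (2h)\<close>, where \<open>N\<close> is the error. Solving for \<open>N\<close> gives the factor
\<open>\<surd>2 (2h)\<^sup>s\<close>.\<close>

lemma average_error_interpolation: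
  assumes f: "f \<in> L2_on U" and s: "0 < s" and fin: "interpolation_integral s U f < \<infinity>"
  shows "norm_L2 U (\<lambda>x. f x - mean_value U f) \<le> sqrt 2 * (2 / pi) powr s * diameter T powr s * sqrt (enn2real (interpolation_integral s U f))"
proof -
  (* The bound by the K-functional holds for t >= h. *)
  define h N I where "h = diameter T / pi" and "N = norm_L2 U (\<lambda>x. f x - mean_value U f)" and "I = interpolation_integral s U f"
  have h: "0 < h" using interior_facts(10) by (simp add: h_def)
  have N: "0 \<le> N" by (simp add: N_def L2_norm_nonneg)
  define Q where "Q = ((2 * h) powr - s * N)\<^sup>2 / (2 * h)"
  have Q: "0 \<le> Q" using h by (simp add: Q_def)
  have "ennreal (h * Q) = (\<integral>\<^sup>+t. ennreal Q * indicator {h..2*h} t \<partial>lborel)"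
    using h Q by (simp add: nn_integral_cmult_indicator ennreal_mult[symmetric] mult.commute)
  also have "\<dots> \<le> I" unfolding I_def interpolation_integral_def
  proof (intro nn_integral_mono)
    fix t :: real
    show "ennreal Q * indicator {h..2*h} t \<le> ennreal ((t powr - s * K_functional U t f)\<^sup>2 / t) * indicator {0<..} t"
    proof (cases "t \<in> {h..2*h}")
      case True
      then have t: "h \<le> t" "t \<le> 2 * h" "0 < t" using h by auto
      have "(2 * h) powr - s * N \<le> t powr - s * K_functional U t f"
        using average_error_le_K[OF f, of t] t s h N
        by (intro mult_mono powr_mono2') (auto simp: h_def N_def)
      then have "((2 * h) powr - s * N)\<^sup>2 \<le> (t powr - s * K_functional U t f)\<^sup>2"
        using N by (intro power_mono) auto
      then have "Q \<le> (t powr - s * K_functional U t f)\<^sup>2 / t"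
        unfolding Q_def using t h by (intro frac_le) auto
      then show ?thesis using True t by (simp add: ennreal_leI)
    qed simp
  qed
  finally have "h * Q \<le> enn2real I"
    using fin h Q unfolding I_def[symmetric] by (cases I) (auto simp: ennreal_le_iff)
  moreover have "h * Q = ((2 * h) powr - s * N)\<^sup>2 / 2" using h by (simp add: Q_def)
  ultimately have "((2 * h) powr - s * N)\<^sup>2 \<le> 2 * enn2real I" by simp
  then have "(2 * h) powr - s * N \<le> sqrt (2 * enn2real I)" by (rule real_le_rsqrt)
  then have "(2 * h) powr s * ((2 * h) powr - s * N) \<le> (2 * h) powr s * sqrt (2 * enn2real I)"
    by (rule mult_left_mono) simp
  moreover have "(2 * h) powr s * ((2 * h) powr - s * N) = N"
    using h by (simp add: mult.assoc[symmetric] powr_add[symmetric])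
  moreover have "(2 * h) powr s = (2 / pi) powr s * diameter T powr s"
    using interior_facts(10) by (simp add: h_def powr_mult[symmetric])
  ultimately have "N \<le> ((2 / pi) powr s * diameter T powr s) * sqrt (2 * enn2real I)" by (simp only:)
  then show ?thesis unfolding N_def I_def real_sqrt_mult by (simp only: mult_ac)
qed

end

section \<open>Triangles of a mesh\<close>

text \<open>The complement of the boundary curve has a second component, whose frontier is the whole curve.
Every neighbourhood of a boundary point therefore meets a set disjoint from the closure of \<open>\<Omega>\<close>.\<close>

lemma interior_closure_jordan_domain:
  fixes \<Omega> :: "point set"
  assumes \<Omega>: "open \<Omega>" "connected \<Omega>" "\<Omega> \<noteq> {}"
    and p: "simple_path p" "pathfinish p = pathstart p" "path_image p = frontier \<Omega>"
  shows "interior (closure \<Omega>) = \<Omega>"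
proof
  show "\<Omega> \<subseteq> interior (closure \<Omega>)" using \<Omega>(1) by (simp add: closure_subset interior_maximal)
  define S where "S = frontier \<Omega>"
  have "S homeomorphic sphere (0::complex) 1"
    unfolding S_def p(3)[symmetric] by (rule homeomorphic_simple_path_image_circle[OF p(1,2)]) simp
  moreover have "sphere (0::complex) 1 homeomorphic sphere (0::point) 1"
    by (rule homeomorphic_spheres_gen) (simp_all add: DIM_complex)
  ultimately have S: "S homeomorphic sphere (0::point) 1" by (rule homeomorphic_trans)
  have dis: "\<Omega> \<subseteq> - S" unfolding S_def frontier_def using \<Omega>(1) by (auto simp: interior_open)
  have nc: "\<not> connected (- S)" using Jordan_Brouwer_separation[OF S] by simp
  obtain C where C: "C \<in> components (- S)" "\<Omega> \<subseteq> C"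
    using exists_component_superset[OF dis _ \<Omega>(2)] \<Omega>(3) dis by blast
  (* Otherwise the complement of the curve would be connected. *)
  have "\<exists>C'\<in>components (- S). C' \<noteq> C"
  proof (rule ccontr)
    assume "\<not> ?thesis"
    then have "\<Union> (components (- S)) \<subseteq> C" by blast
    then have "- S = C" using in_components_subset[OF C(1)] by (auto simp: Union_components[symmetric])
    then show False using nc in_components_connected[OF C(1)] by simp
  qed
  then obtain C' where C': "C' \<in> components (- S)" "C' \<noteq> C" by blast
  have disj: "C' \<inter> \<Omega> = {}" using components_nonoverlap[OF C'(1) C(1)] C'(2) C(2) by blast
  have "closed S" by (simp add: S_def)
  then have oC: "open C'" using open_components[OF _ C'(1)] by auto
  have fC: "frontier C' = S" by (rule Jordan_Brouwer_frontier[OF S C'(1)]) simp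
  show "interior (closure \<Omega>) \<subseteq> \<Omega>"
  proof (rule ccontr)
    assume "\<not> ?thesis"
    then obtain x where x: "x \<in> interior (closure \<Omega>)" "x \<notin> \<Omega>" by blast
    then have "x \<in> S" using interior_subset \<Omega>(1) by (auto simp: S_def frontier_def interior_open)
    then have "x \<in> closure C'" using fC by (auto simp: frontier_def)
    then obtain y where y: "y \<in> C'" "y \<in> interior (closure \<Omega>)"
      using x(1) open_Int_closure_eq_empty[of "interior (closure \<Omega>)" C'] by blast
    then have "y \<in> closure \<Omega>" using interior_subset by blast
    then show False using y(1) disj open_Int_closure_eq_empty[OF oC, of \<Omega>] by blast
  qed
qed

text \<open>A vanishing cross product puts the three vertices on a line.\<close>

lemma cross2_nonzero_of_interior:
  fixes a b c :: point
  assumes "interior (convex hull {a, b, c}) \<noteq> {}"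
  shows "cross2 (b - a) (c - a) \<noteq> 0"
proof
  assume z: "cross2 (b - a) (c - a) = 0"
  have *: "convex hull {a, b, c} \<subseteq> {x. n \<bullet> x = n \<bullet> a}" if "n \<bullet> (b - a) = 0" "n \<bullet> (c - a) = 0" for n
    using that by (intro hull_minimal convex_hyperplane) (auto simp: inner_diff_right)
  have "\<exists>n::point. n \<noteq> 0 \<and> n \<bullet> (b - a) = 0 \<and> n \<bullet> (c - a) = 0"
  proof (cases "b = a \<and> c = a")
    case True
    then show ?thesis by (intro exI[of _ "axis 1 1"]) simp
  next
    case False
    define w where "w = (if b = a then c - a else b - a)"
    define n :: point where "n = vector [- (w $ 2), w $ 1]"
    have "w \<noteq> 0" using False by (auto simp: w_def)
    then have "n \<noteq> 0" by (auto simp: n_def vec_eq_iff forall_2)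
    moreover have "n \<bullet> v = cross2 w v" for v by (simp add: n_def inner_vec_def UNIV_2 cross2_def)
    moreover have "cross2 w (b - a) = 0" "cross2 w (c - a) = 0"
      using z by (auto simp: w_def cross2_def mult.commute)
    ultimately show ?thesis by auto
  qed
  then obtain n where "n \<noteq> 0" "n \<bullet> (b - a) = 0" "n \<bullet> (c - a) = 0" by blast
  then have "interior (convex hull {a, b, c}) \<subseteq> {}"
    using interior_mono[OF *, of n] interior_hyperplane[of n "n \<bullet> a"] by simp
  then show False using assms by blast
qed

text \<open>The mesh covers the closure of \<open>\<Omega>\<close>, so a priori an open triangle could contain boundary points of
\<open>\<Omega>\<close>; the Jordan curve theorem excludes this.\<close>

lemma mesh_triangle:
  assumes \<Omega>: "polygonal_domain \<Omega>" and mesh: "conforming_mesh \<Omega> \<T>" and T: "T \<in> \<T>"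
  obtains a b c where "T = convex hull {a, b, c}" "cross2 (b - a) (c - a) \<noteq> 0" "interior T \<noteq> {}" "interior T \<subseteq> \<Omega>"
proof -
  have "2 simplex T" using mesh T by (auto simp: conforming_mesh_def)
  then obtain V where V: "\<not> affine_dependent V" "card V = 3" "T = convex hull V"
    by (auto simp: simplex_def)
  then obtain a b c where abc: "V = {a, b, c}" by (auto simp: card_3_iff)
  have ne: "interior T \<noteq> {}"
    using V interior_convex_hull_eq_empty[of V] by simp
  obtain p where p: "simple_path p" "pathfinish p = pathstart p" "path_image p = frontier \<Omega>"
    using \<Omega> unfolding polygonal_domain_def by blast
  have "interior (closure \<Omega>) = \<Omega>"
    using \<Omega> by (intro interior_closure_jordan_domain[OF _ _ _ p]) (auto simp: polygonal_domain_def)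
  moreover have "T \<subseteq> closure \<Omega>" using mesh T by (auto simp: conforming_mesh_def)
  ultimately have "interior T \<subseteq> \<Omega>" using interior_mono by blast
  then show ?thesis using that[of a b c] ne cross2_nonzero_of_interior V(3) abc by blast
qed

text \<open>The intersection of two cells is a face of both, and a face that meets the interior is everything.\<close>

lemma mesh_interiors_disjoint:
  assumes mesh: "conforming_mesh \<Omega> \<T>" and T: "T \<in> \<T>" "T' \<in> \<T>" "T \<noteq> T'"
  shows "interior T \<inter> interior T' = {}"
proof (rule ccontr)
  assume ne: "interior T \<inter> interior T' \<noteq> {}"
  have f: "(T \<inter> T') face_of T" "(T' \<inter> T) face_of T'"
    using mesh T by (auto simp: conforming_mesh_def triangulation_def)
  have "T \<subseteq> T \<inter> T'"
    by (rule subset_of_face_of[OF f(1) order_refl]) (use ne interior_subset interior_subset_rel_interior in blast)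
  moreover have "T' \<subseteq> T' \<inter> T"
    by (rule subset_of_face_of[OF f(2) order_refl]) (use ne interior_subset interior_subset_rel_interior in blast)
  ultimately show False using T(3) by blast
qed

lemma Sigma_space_affine:
  assumes "\<tau> \<in> Sigma_space \<Omega> \<T>" "T \<in> \<T>"
  obtains c A where "\<And>x i. x \<in> interior T \<Longrightarrow> \<tau> x $ i = c i + A i \<bullet> x"
proof -
  have "\<forall>i. \<exists>c a. \<forall>x\<in>interior T. \<tau> x $ i = c + a \<bullet> x"
    using assms by (auto simp: Sigma_space_def CR_space_def)
  then show ?thesis using that by metis
qed

section \<open>The divergence error of the discrete solution\<close>

text \<open>Both infima are attained at the mean value of \<open>f\<close>, continued by zero to the other triangles. Boundaries
of triangles are null sets, so norms over \<open>T\<close> and over its interior agree.\<close>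

theorem divergence_error:
  assumes \<Omega>: "polygonal_domain \<Omega>" and mesh: "conforming_mesh \<Omega> \<T>" and f: "f \<in> L2_on \<Omega>"
    and ex: "exact_solution \<Omega> f g \<sigma> u" and di: "discrete_solution \<Omega> \<T> f g \<sigma>h uh" and T: "T \<in> \<T>"
    and tri: "T = convex hull {a, b, c}" "cross2 (b - a) (c - a) \<noteq> 0" "interior T \<noteq> {}" "interior T \<subseteq> \<Omega>"
  shows "norm_L2 T (weak_div (interior T) (\<lambda>x. \<sigma> x - \<sigma>h x)) = norm_L2 (interior T) (\<lambda>x. f x - mean_value (interior T) f)"
    and "(INF v\<in>V_space \<T>. norm_L2 T (\<lambda>x. v x - weak_div \<Omega> \<sigma> x)) = norm_L2 (interior T) (\<lambda>x. f x - mean_value (interior T) f)"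
    and "(INF v\<in>V_space \<T>. norm_L2 T (\<lambda>x. v x - f x)) = norm_L2 (interior T) (\<lambda>x. f x - mean_value (interior T) f)"
proof -
  define U where "U = interior T"
  interpret triangle a b c T U
    using tri by unfold_locales (simp_all add: U_def)
  have \<Omega>o: "open \<Omega>" "bounded \<Omega>" using \<Omega> by (auto simp: polygonal_domain_def)
  have \<Omega>l: "\<Omega> \<in> lmeasurable" using \<Omega>o by (simp add: lmeasurable_open)
  then have \<Omega>m: "\<Omega> \<in> sets lebesgue" by auto
  have U\<Omega>: "U \<subseteq> \<Omega>" using tri by (simp add: U_def)
  have fU: "f \<in> L2_on U" by (rule L2_subset[OF f U\<Omega> interior_facts(7) \<Omega>m])
  have \<sigma>: "\<sigma> \<in> L2_on \<Omega>" and d\<sigma>: "has_weak_div \<Omega> \<sigma> (weak_div \<Omega> \<sigma>)" and df: "AE x in lebesgue_on \<Omega>. weak_div \<Omega> \<sigma> x = f x"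
  proof -
    show "\<sigma> \<in> L2_on \<Omega>" "AE x in lebesgue_on \<Omega>. weak_div \<Omega> \<sigma> x = f x" using ex by (auto simp: exact_solution_def Hdiv_def)
    obtain d where "has_weak_div \<Omega> \<sigma> d" using ex by (auto simp: exact_solution_def Hdiv_def)
    then show "has_weak_div \<Omega> \<sigma> (weak_div \<Omega> \<sigma>)" by (rule weak_div_eq_AE(1)[OF \<Omega>o])
  qed
  have \<sigma>U: "\<sigma> \<in> L2_on U" by (rule L2_subset[OF \<sigma> U\<Omega> interior_facts(7) \<Omega>m])
  have d\<sigma>U: "has_weak_div U \<sigma> (weak_div \<Omega> \<sigma>)" by (rule has_weak_div_subset[OF d\<sigma> U\<Omega> interior_facts(7) \<Omega>m])
  have dU2: "weak_div \<Omega> \<sigma> \<in> L2_on U" using d\<sigma>U by (simp add: has_weak_div_def)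
  have dfU: "AE x in lebesgue_on U. weak_div \<Omega> \<sigma> x = f x"
  proof -
    have "AE x in lebesgue. x \<in> \<Omega> \<longrightarrow> weak_div \<Omega> \<sigma> x = f x" using df \<Omega>m by (simp add: AE_restrict_space_iff)
    then have "AE x in lebesgue. x \<in> U \<longrightarrow> weak_div \<Omega> \<sigma> x = f x" by eventually_elim (use U\<Omega> in auto)
    then show ?thesis using interior_facts(7) by (simp add: AE_restrict_space_iff)
  qed
  obtain cc A where A: "\<And>x i. x \<in> interior T \<Longrightarrow> \<sigma>h x $ i = cc i + A i \<bullet> x"
    using Sigma_space_affine[OF _ T] di unfolding discrete_solution_def by blast
  define \<delta> where "\<delta> = (\<Sum>i\<in>UNIV. A i $ i)"
  have \<sigma>h: "\<sigma>h \<in> L2_on U" by (rule affine_L2[OF interior_facts(3,4)]) (use A in \<open>simp add: U_def\<close>)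
  have dh: "has_weak_div U \<sigma>h (\<lambda>_. \<delta>)" unfolding \<delta>_def by (rule affine_weak_div[OF interior_facts(3,4)]) (use A in \<open>simp add: U_def\<close>)
  have dhU: "has_weak_div U \<sigma>h (weak_div U \<sigma>h)" "AE x in lebesgue_on U. weak_div U \<sigma>h x = \<delta>"
    using weak_div_eq_AE[OF interior_facts(3,4) dh] by auto
  have disj: "x \<notin> interior T'" if "T' \<in> \<T>" "T' \<noteq> T" "x \<in> U" for T' x
    using mesh_interiors_disjoint[OF mesh that(1) T that(2)] that(3) by (auto simp: U_def)
  have finT: "finite \<T>" using mesh by (auto simp: conforming_mesh_def triangulation_def)
  have V: "(\<lambda>x. k * indicator U x) \<in> V_space \<T>" for k :: real
    unfolding V_space_def
  proof (intro CollectI ballI)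
    fix T' assume T': "T' \<in> \<T>"
    show "\<exists>c. \<forall>x\<in>interior T'. k * indicator U x = c"
    proof (cases "T' = T")
      case True then show ?thesis by (intro exI[of _ k]) (simp add: U_def)
    next
      case False
      then have "indicator U x = (0::real)" if "x \<in> interior T'" for x using disj[OF T' False] that by (auto simp: indicator_def)
      then show ?thesis by (intro exI[of _ 0]) simp
    qed
  qed
  have \<delta>: "\<delta> = mean_value U f"
  proof -
    (* Test the discrete equation with the indicator function of the triangle. *)
    have "(\<lambda>x. 1 * indicator U x) \<in> V_space \<T>" by (rule V)
    then have eq: "form_b \<Omega> \<T> \<sigma>h (\<lambda>x. 1 * indicator U x) = form_F \<Omega> f (\<lambda>x. 1 * indicator U x)"
      using di unfolding discrete_solution_def by force
    have dh': "div_h \<T> \<sigma>h x = weak_div U \<sigma>h x" if "x \<in> U" for x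
    proof -
      have "div_h \<T> \<sigma>h x = indicator (interior T) x * weak_div (interior T) \<sigma>h x + (\<Sum>T'\<in>\<T> - {T}. indicator (interior T') x * weak_div (interior T') \<sigma>h x)"
        unfolding div_h_def by (rule sum.remove[OF finT T])
      moreover have "(\<Sum>T'\<in>\<T> - {T}. indicator (interior T') x * weak_div (interior T') \<sigma>h x) = 0"
        by (rule sum.neutral) (use disj that in \<open>auto simp: indicator_def\<close>)
      ultimately show ?thesis using that by (simp add: U_def)
    qed
    have "form_b \<Omega> \<T> \<sigma>h (\<lambda>x. 1 * indicator U x) = (LINT x|lebesgue_on U. 1 * indicator U x * div_h \<T> \<sigma>h x)"
      unfolding form_b_def by (rule integral_subset_support[OF U\<Omega> interior_facts(7) \<Omega>m]) simp
    also have "\<dots> = (LINT x|lebesgue_on U. weak_div U \<sigma>h x)"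
      by (intro Bochner_Integration.integral_cong refl) (simp add: dh')
    also have "\<dots> = (LINT x|lebesgue_on U. \<delta>)"
      using dhU by (intro integral_cong_AE) (auto simp: has_weak_div_def L2_space_def)
    also have "\<dots> = \<delta> * measure lebesgue U" using interior_facts(8) by (simp add: mult.commute)
    finally have b: "form_b \<Omega> \<T> \<sigma>h (\<lambda>x. 1 * indicator U x) = \<delta> * measure lebesgue U" .
    have "form_F \<Omega> f (\<lambda>x. 1 * indicator U x) = (LINT x|lebesgue_on U. f x * (1 * indicator U x))"
      unfolding form_F_def by (rule integral_subset_support[OF U\<Omega> interior_facts(7) \<Omega>m]) simp
    also have "\<dots> = (LINT x|lebesgue_on U. f x)" by (intro Bochner_Integration.integral_cong refl) simp
    finally show ?thesis using eq b interior_facts(9) by (simp add: mean_value_def field_simps)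
  qed
  have Tn: "norm_L2 T F = norm_L2 U F" if "F \<in> borel_measurable (lebesgue_on U)" for F :: "point \<Rightarrow> real"
    using norm_L2_interior[OF interior_facts(2,1)] that by (simp add: U_def)
  have fm: "f \<in> borel_measurable (lebesgue_on U)" and dm: "weak_div \<Omega> \<sigma> \<in> borel_measurable (lebesgue_on U)"
    using fU dU2 by (auto simp: L2_space_def)
  show "norm_L2 T (weak_div (interior T) (\<lambda>x. \<sigma> x - \<sigma>h x)) = norm_L2 (interior T) (\<lambda>x. f x - mean_value (interior T) f)"
  proof -
    have e: "has_weak_div U (\<lambda>x. \<sigma> x - \<sigma>h x) (\<lambda>x. weak_div \<Omega> \<sigma> x - \<delta>)"
      by (rule has_weak_div_diff[OF interior_facts(3,4) \<sigma>U d\<sigma>U \<sigma>h dh])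
    have w: "has_weak_div U (\<lambda>x. \<sigma> x - \<sigma>h x) (weak_div U (\<lambda>x. \<sigma> x - \<sigma>h x))"
      "AE x in lebesgue_on U. weak_div U (\<lambda>x. \<sigma> x - \<sigma>h x) x = weak_div \<Omega> \<sigma> x - \<delta>"
      using weak_div_eq_AE[OF interior_facts(3,4) e] by auto
    have wm: "weak_div U (\<lambda>x. \<sigma> x - \<sigma>h x) \<in> borel_measurable (lebesgue_on U)"
      using w(1) by (simp add: has_weak_div_def L2_space_def)
    have "AE x in lebesgue_on U. weak_div U (\<lambda>x. \<sigma> x - \<sigma>h x) x = f x - mean_value U f"
      using w(2) dfU by eventually_elim (simp add: \<delta>)
    then have "norm_L2 U (weak_div U (\<lambda>x. \<sigma> x - \<sigma>h x)) = norm_L2 U (\<lambda>x. f x - mean_value U f)"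
      by (rule norm_L2_cong_AE[OF _ wm]) (use fm in measurable)
    then show ?thesis using Tn[OF wm] by (simp add: U_def)
  qed
  (* Used for the weak divergence of the exact solution and for f itself, which agree only
     almost everywhere. *)
  have inf: "(INF v\<in>V_space \<T>. norm_L2 T (\<lambda>x. v x - k x)) = norm_L2 (interior T) (\<lambda>x. f x - mean_value (interior T) f)"
    if km: "k \<in> borel_measurable (lebesgue_on U)" and kf: "AE x in lebesgue_on U. k x = f x" for k
  proof -
    have val: "norm_L2 T (\<lambda>x. v x - k x) = norm_L2 U (\<lambda>x. f x - r)" if v: "\<And>x. x \<in> U \<Longrightarrow> v x = r" for v r
    proof -
      have vm: "v \<in> borel_measurable (lebesgue_on U)"
        using measurable_cong[of "lebesgue_on U" v "\<lambda>_. r" borel] v by simp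
      have m: "(\<lambda>x. v x - k x) \<in> borel_measurable (lebesgue_on U)" using vm km by measurable
      have m': "(\<lambda>x. - (f x - r)) \<in> borel_measurable (lebesgue_on U)" using fm by measurable
      have "AE x in lebesgue_on U. x \<in> U" using interior_facts(7) by (simp add: AE_restrict_space_iff)
      then have "AE x in lebesgue_on U. v x - k x = - (f x - r)" using kf by eventually_elim (simp add: v)
      then have "norm_L2 U (\<lambda>x. v x - k x) = norm_L2 U (\<lambda>x. - (f x - r))" by (rule norm_L2_cong_AE[OF _ m m'])
      also have "\<dots> = norm_L2 U (\<lambda>x. f x - r)" unfolding L2_norm_def norm_minus_cancel ..
      finally show ?thesis using Tn[OF m] by simp
    qed
    show ?thesis
    proof (rule cInf_eq_minimum)
      have "norm_L2 T (\<lambda>x. mean_value U f * indicator U x - k x) = norm_L2 U (\<lambda>x. f x - mean_value U f)" by (rule val) simp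
      then show "norm_L2 (interior T) (\<lambda>x. f x - mean_value (interior T) f) \<in> (\<lambda>v. norm_L2 T (\<lambda>x. v x - k x)) ` V_space \<T>"
        using V[of "mean_value U f"] unfolding U_def[symmetric] by (intro image_eqI[of _ _ "\<lambda>x. mean_value U f * indicator U x"]) simp_all
      fix y assume "y \<in> (\<lambda>v. norm_L2 T (\<lambda>x. v x - k x)) ` V_space \<T>"
      then obtain v where v: "v \<in> V_space \<T>" "y = norm_L2 T (\<lambda>x. v x - k x)" by blast
      then obtain r where "\<And>x. x \<in> U \<Longrightarrow> v x = r" using T by (auto simp: V_space_def U_def)
      then show "norm_L2 (interior T) (\<lambda>x. f x - mean_value (interior T) f) \<le> y"
        using val average_minimizes[OF fU] v(2) unfolding U_def[symmetric] by simp
    qed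
  qed
  show "(INF v\<in>V_space \<T>. norm_L2 T (\<lambda>x. v x - weak_div \<Omega> \<sigma> x)) = norm_L2 (interior T) (\<lambda>x. f x - mean_value (interior T) f)"
    by (rule inf[OF dm dfU])
  show "(INF v\<in>V_space \<T>. norm_L2 T (\<lambda>x. v x - f x)) = norm_L2 (interior T) (\<lambda>x. f x - mean_value (interior T) f)"
    by (rule inf[OF fm]) simp
qed

theorem projection_error_rate:
  assumes \<Omega>: "polygonal_domain \<Omega>" and f: "f \<in> L2_on \<Omega>" "f \<in> Hs s \<Omega>" and s: "0 < s" "s \<le> 1"
    and tri: "T = convex hull {a, b, c}" "cross2 (b - a) (c - a) \<noteq> 0" "interior T \<noteq> {}" "interior T \<subseteq> \<Omega>"
  shows "norm_L2 (interior T) (\<lambda>x. f x - mean_value (interior T) f) \<le>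
     (if s = 1 then 1 / pi else sqrt 2 * (2 / pi) powr s) * diameter T powr s * norm_Hs s (interior T) f"
proof -
  define U where "U = interior T"
  interpret triangle a b c T U
    using tri by unfold_locales (simp_all add: U_def)
  have \<Omega>o: "open \<Omega>" "bounded \<Omega>" using \<Omega> by (auto simp: polygonal_domain_def)
  have \<Omega>l: "\<Omega> \<in> lmeasurable" using \<Omega>o by (simp add: lmeasurable_open)
  then have \<Omega>m: "\<Omega> \<in> sets lebesgue" by auto
  have U\<Omega>: "U \<subseteq> \<Omega>" using tri by (simp add: U_def)
  have fU: "f \<in> L2_on U" by (rule L2_subset[OF f(1) U\<Omega> interior_facts(7) \<Omega>m])
  show ?thesis
  proof (cases "s = 1")
    case True
    then have "f \<in> H1 U" using f(2) H1_subset(1)[OF _ interior_facts(3,4) U\<Omega> \<Omega>m] by (simp add: Hs_def)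
    then show ?thesis using poincare_H1[of f] interior_facts(10) True by (simp add: norm_Hs_def U_def mult.commute)
  next
    case False
    then have "interpolation_integral s \<Omega> f < \<infinity>" using f(2) by (simp add: Hs_def)
    then have "interpolation_integral s U f < \<infinity>"
      using interpolation_integral_subset[OF f(1) interior_facts(3,4) U\<Omega> \<Omega>l, of s] by (rule le_less_trans[rotated])
    then show ?thesis using average_error_interpolation[OF fU s(1)] False by (simp add: norm_Hs_def U_def)
  qed
qed

theorem lemma4p3:
  fixes \<Omega> :: "point set"
  assumes "polygonal_domain \<Omega>"
  shows
    "(\<forall>\<T> f g \<sigma> u \<sigma>h uh.
        conforming_mesh \<Omega> \<T> \<and> f \<in> L2_on \<Omega> \<and> g \<in> H_half \<Omega> \<and>
        exact_solution \<Omega> f g \<sigma> u \<and> discrete_solution \<Omega> \<T> f g \<sigma>h uh \<longrightarrow>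
        (\<forall>T\<in>\<T>.
           norm_L2 T (weak_div (interior T) (\<lambda>x. \<sigma> x - \<sigma>h x))
             = (INF v\<in>V_space \<T>. norm_L2 T (\<lambda>x. v x - weak_div \<Omega> \<sigma> x)) \<and>
           (INF v\<in>V_space \<T>. norm_L2 T (\<lambda>x. v x - weak_div \<Omega> \<sigma> x))
             = (INF v\<in>V_space \<T>. norm_L2 T (\<lambda>x. v x - f x)))) \<and>
     (\<forall>s::real. 0 < s \<and> s \<le> 1 \<longrightarrow>
        (\<exists>C>0. (s = 1 \<longrightarrow> C = 1 / pi) \<and>
           (\<forall>\<T> f g \<sigma> u \<sigma>h uh.
              conforming_mesh \<Omega> \<T> \<and> f \<in> L2_on \<Omega> \<and> g \<in> H_half \<Omega> \<and>
              exact_solution \<Omega> f g \<sigma> u \<and> discrete_solution \<Omega> \<T> f g \<sigma>h uh \<and>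
              f \<in> Hs s \<Omega> \<longrightarrow>
              (\<forall>T\<in>\<T>.
                 norm_L2 T (weak_div (interior T) (\<lambda>x. \<sigma> x - \<sigma>h x))
                   \<le> C * diameter T powr s * norm_Hs s (interior T) f))))"
proof (intro conjI allI impI ballI)
  fix \<T> f g \<sigma> u \<sigma>h uh T
  assume H: "conforming_mesh \<Omega> \<T> \<and> f \<in> L2_on \<Omega> \<and> g \<in> H_half \<Omega> \<and>
        exact_solution \<Omega> f g \<sigma> u \<and> discrete_solution \<Omega> \<T> f g \<sigma>h uh" and T: "T \<in> \<T>"
  then have mesh: "conforming_mesh \<Omega> \<T>" and f: "f \<in> L2_on \<Omega>" and ex: "exact_solution \<Omega> f g \<sigma> u"
    and di: "discrete_solution \<Omega> \<T> f g \<sigma>h uh" by blast+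
  obtain a b c where tri: "T = convex hull {a, b, c}" "cross2 (b - a) (c - a) \<noteq> 0" "interior T \<noteq> {}" "interior T \<subseteq> \<Omega>"
    using mesh_triangle[OF assms mesh T] .
  note eqs = divergence_error[OF assms mesh f ex di T tri]
  show "norm_L2 T (weak_div (interior T) (\<lambda>x. \<sigma> x - \<sigma>h x)) = (INF v\<in>V_space \<T>. norm_L2 T (\<lambda>x. v x - weak_div \<Omega> \<sigma> x))"
    unfolding eqs(1,2) ..
  show "(INF v\<in>V_space \<T>. norm_L2 T (\<lambda>x. v x - weak_div \<Omega> \<sigma> x)) = (INF v\<in>V_space \<T>. norm_L2 T (\<lambda>x. v x - f x))"
    unfolding eqs(2,3) ..
next
  fix s :: real assume s: "0 < s \<and> s \<le> 1"
  define C where "C = (if s = 1 then 1 / pi else sqrt 2 * (2 / pi) powr s)"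
  show "\<exists>C>0. (s = 1 \<longrightarrow> C = 1 / pi) \<and>
           (\<forall>\<T> f g \<sigma> u \<sigma>h uh.
              conforming_mesh \<Omega> \<T> \<and> f \<in> L2_on \<Omega> \<and> g \<in> H_half \<Omega> \<and>
              exact_solution \<Omega> f g \<sigma> u \<and> discrete_solution \<Omega> \<T> f g \<sigma>h uh \<and>
              f \<in> Hs s \<Omega> \<longrightarrow>
              (\<forall>T\<in>\<T>.
                 norm_L2 T (weak_div (interior T) (\<lambda>x. \<sigma> x - \<sigma>h x))
                   \<le> C * diameter T powr s * norm_Hs s (interior T) f))"
  proof (intro exI[of _ C] conjI allI impI ballI)
    show "0 < C" by (simp add: C_def)
    show "s = 1 \<Longrightarrow> C = 1 / pi" by (simp add: C_def)
    fix \<T> f g \<sigma> u \<sigma>h uh T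
    assume H: "conforming_mesh \<Omega> \<T> \<and> f \<in> L2_on \<Omega> \<and> g \<in> H_half \<Omega> \<and>
              exact_solution \<Omega> f g \<sigma> u \<and> discrete_solution \<Omega> \<T> f g \<sigma>h uh \<and> f \<in> Hs s \<Omega>" and T: "T \<in> \<T>"
    then have mesh: "conforming_mesh \<Omega> \<T>" and f: "f \<in> L2_on \<Omega>" "f \<in> Hs s \<Omega>" and ex: "exact_solution \<Omega> f g \<sigma> u"
      and di: "discrete_solution \<Omega> \<T> f g \<sigma>h uh" by blast+
    obtain a b c where tri: "T = convex hull {a, b, c}" "cross2 (b - a) (c - a) \<noteq> 0" "interior T \<noteq> {}" "interior T \<subseteq> \<Omega>"
      using mesh_triangle[OF assms mesh T] .
    show "norm_L2 T (weak_div (interior T) (\<lambda>x. \<sigma> x - \<sigma>h x)) \<le> C * diameter T powr s * norm_Hs s (interior T) f"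
      unfolding divergence_error(1)[OF assms mesh f(1) ex di T tri] C_def
      using projection_error_rate[OF assms f _ _ tri] s by blast
  qed
qed

end
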